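(* Let $u$ be a sufficiently smooth solution on $\bar\Omega\times[0,T]$ of the initial-boundary value problem $$\rho(x)\partial_t^2u-(a_1^2\partial_1^2+\ldots+a_n^2\partial_n^2)u=f(x,t)\ \text{ in }\Omega\times(0,T),\quad u|_{\partial\Omega\times(0,T)}=g,\quad u|_{t=0}=u_0,\ \ \partial_tu|_{t=0}=u_1\ \text{ in }\Omega,$$ with sufficiently smooth $\rho$, where $g$ and the boundary values of $f$ may be arbitrary (not only zero). Let $v$ (on $\bar\omega_h\times\{t_m\}_{m=0}^M$) and $v_{11},\ldots,v_{nn}$ (on $\bar\omega_h\times\{t_m\}_{m=0}^{M-1}$) be the solution of the semi-explicit vector compact scheme $$\rho\Lambda_tv^m-\big(\rho I+\tfrac1{12}h_t^2L_h\big)\tfrac1\rho(a_1^2v_{11}^m+\ldots+a_n^2v_{nn}^m)=f_{\mathbf h}^m\ \text{ on }\omega_h,\quad 1\le m\le M-1,$$ $$s_{kN}v_{kk}^m=\Lambda_kv^m\ \text{ on }\omega_h,\quad 0\le m\le M-1,\ 1\le k\le n,$$ $$\rho(\delta_tv)^0=\tfrac12h_t\big(\rho I+\tfrac1{12}h_t^2L_h\big)\tfrac1\rho(a_1^2v_{11}^0+\ldots+a_n^2v_{nn}^0)+u_{1\mathbf h}+\tfrac12h_tf_{\mathbf h}^0\ \text{ on }\omega_h,$$ with the boundary conditions $v|_{\partial\omega_h}=g$ and $a_k^2v_{kk}|_{\partial\omega_h}=g_k$, $1\le k\le n$, and with $v^0=u^0$ on $\bar\omega_h$, where the data $f_{\mathbf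 h}$, $u_{1\mathbf h}$ and $g_k$ are the specific ones defined in the context. Let the stability conditions $$\tfrac13h_t^2\Big(\tfrac{a_1^2}{h_1^2}+\ldots+\tfrac{a_n^2}{h_n^2}\Big)\le(1-\varepsilon)\underline\rho\ \text{ with }0<\varepsilon<1,\qquad\tfrac14h_t^2E_h\le(1-\varepsilon_0^2)\underline\rho\,I\ \text{ in }H_h\ \text{ for some }0<\varepsilon_0<1$$ hold. Then the following 4th order error bound holds: $$\sqrt\varepsilon\,\varepsilon_0\max_{1\le m\le M}\Big(\|\bar\delta_t(u-v)^m\|_h+\|(u-v)^m\|_{H_h^1}+\sqrt\varepsilon\,\|I_{h_t}^mL_h(u-v)\|_h\Big)=\mathcal O(|\mathbf h|^4),$$ that is, the left-hand side is at most $C|\mathbf h|^4$ with a constant $C$ independent of $\mathbf h$, $\varepsilon$ and $\varepsilon_0$.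
   Context: Let $n\ge1$, $X_1,\ldots,X_n>0$, $\Omega=(0,X_1)\times\ldots\times(0,X_n)$, $T>0$; $a_1,\ldots,a_n>0$ are constants, $\rho$ is a function on $\bar\Omega$ with $0<\underline\rho\le\rho(x)\le\bar\rho$ for constants $\underline\rho,\bar\rho$. Time mesh: $t_m=mh_t$, $0\le m\le M$, $h_t=T/M$, $M\ge2$. For a function $y$ of time, $y^m=y(t_m)$, $\bar\delta_ty^m=\frac{y^m-y^{m-1}}{h_t}$, $\delta_ty^m=\frac{y^{m+1}-y^m}{h_t}$, $\Lambda_ty^m=\frac{y^{m+1}-2y^m+y^{m-1}}{h_t^2}$; $I_{h_t}^my=h_t\sum_{l=1}^my^l$ for $1\le m\le M$. Space mesh: in direction $x_k$ the nodes are $x_{ki}=ih_k$, $0\le i\le N_k$, $h_k=X_k/N_k$; $\bar\omega_h$ is the product of these meshes over $k=1,\ldots,n$, $\omega_h$ is its set of interior nodes ($1\le i_k\le N_k-1$ for all $k$), $\partial\omega_h=\bar\omega_h\setminus\omega_h$. $h=(h_1,\ldots,h_n)$, $\mathbf h=(h,h_t)$, and $|\mathbf h|$ is the Euclidean norm. Operators on mesh functions on $\bar\omega_h$ (values taken at nodes of $\omega_h$): acting in the $k$-th variable, $(\Lambda_kw)_i=\frac1{h_k^2}(w_{i+1}-2w_i+w_{i-1})$, $s_{kN}w_i=\frac1{12}(w_{i-1}+10w_i+w_{i+1})$; $L_h=a_1^2\Lambda_1+\ldots+a_n^2\Lambda_n$. Functions $\rho$, $1/\rho$ act by multiplication; $(\rho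 I+\frac1{12}h_t^2L_h)\frac1\rho w$ means $w+\frac1{12}h_t^2L_h(w/\rho)$, and $I$ is the identity. $H_h$ is the space of real functions on $\bar\omega_h$ equal to $0$ on $\partial\omega_h$, with $(v,w)_h=h_1\cdots h_n\sum_{x\in\omega_h}v(x)w(x)$ and $\|w\|_h=\big(h_1\cdots h_n\sum_{x\in\omega_h}w(x)^2\big)^{1/2}$. For $w\in H_h$, $\|w\|_{H_h^1}^2:=(-L_hw,w)_h$. In $H_h$ (with values of difference operators set to $0$ on $\partial\omega_h$), $s_{kN}$ is self-adjoint with $\frac23I<s_{kN}<I$, and $E_h:=-(a_1^2s_{1N}^{-1}\Lambda_1+\ldots+a_n^2s_{nN}^{-1}\Lambda_n)$ is self-adjoint and positive; operator inequalities are between self-adjoint operators in $H_h$. Data of the scheme. For $1\le m\le M-1$: $f_{\mathbf h}=f+\frac1{12}h_t^2\big(\Lambda_tf+L_h\frac f\rho\big)$. For the initial step, on $\omega_h$, $$u_{1\mathbf h}=\big(\rho I+\tfrac16h_t^2L_h\big)u_1,\qquad f_{\mathbf h}^0=f_{dh_t}^{(0)}+\tfrac1{12}h_t^2L_h\tfrac{f_0}\rho,\qquad f_0=f|_{t=0},$$ where either $f_{dh_t}^{(0)}=\frac7{12}f^0+\frac12f^1-\frac1{12}f^2$ or $f_{dh_t}^{(0)}=\frac13f^0+\frac23f^{1/2}$ with $f^{1/2}=f|_{t=h_t/2}$. Boundary data: $g_k=\rho\,\partial_t^2g-\sum_{1\le l\le n,\,l\ne k}a_l^2\partial_l^2g-f$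 for $x_k=0,X_k$, and $g_k=a_k^2\partial_k^2g$ for $x_l=0,X_l$, $1\le l\le n$, $l\ne k$. For the exact smooth solution these are the boundary values of $a_k^2\partial_k^2u$. The condition $v=g$ is imposed on $\partial\omega_h$ at the time levels $t_1,\ldots,t_M$ (at $t_0$, $v^0=u^0$), and the condition for $v_{kk}$ is imposed on $\partial\omega_h$ at the time levels $t_0,\ldots,t_{M-1}$ (at $t_0$ one may equivalently use the values of $\partial_k^2u_0$). *)

theory Defs
  imports "HOL-Analysis.Analysis"
begin

section \<open>Derivatives and smoothness up to the boundary\<close>

text \<open>
  Partial derivative in direction \<open>b\<close> of a function that is only considered on \<open>S\<close>; it is
  one-sided where the line through \<open>z\<close> leaves \<open>S\<close>, and the usual one in the interior.
\<close>

definition pd :: "'a::euclidean_space set \<Rightarrow> 'a \<Rightarrow> ('a \<Rightarrow> real) \<Rightarrow> 'a \<Rightarrow> real" where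
  "pd S b F z = vector_derivative (\<lambda>s. F (z + s *\<^sub>R b)) (at 0 within {s. z + s *\<^sub>R b \<in> S})"

definition pd2 :: "'a::euclidean_space set \<Rightarrow> 'a \<Rightarrow> ('a \<Rightarrow> real) \<Rightarrow> 'a \<Rightarrow> real" where
  "pd2 S b F = pd S b (pd S b F)"

text \<open>
  Class \<open>C\<^sup>K(S)\<close> for a closed box \<open>S\<close>: all (iterated, mixed) partial derivatives up to order \<open>K\<close>
  exist on \<open>S\<close> and are continuous on \<open>S\<close>.
\<close>

primrec Ck_on :: "nat \<Rightarrow> 'a::euclidean_space set \<Rightarrow> ('a \<Rightarrow> real) \<Rightarrow> bool" where
  "Ck_on 0 S F \<longleftrightarrow> continuous_on S F"
| "Ck_on (Suc K) S F \<longleftrightarrow> continuous_on S F \<and>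
     (\<forall>b\<in>Basis.
        (\<forall>z\<in>S. (\<lambda>s. F (z + s *\<^sub>R b)) differentiable (at 0 within {s. z + s *\<^sub>R b \<in> S})) \<and>
        Ck_on K S (pd S b F))"

text \<open>Functions of space and time live on \<open>real ^ 'n \<times> real\<close>.\<close>

definition dir_x :: "'n::finite \<Rightarrow> (real ^ 'n) \<times> real" where
  "dir_x k = (axis k 1, 0)"

definition dir_t :: "(real ^ 'n::finite) \<times> real" where
  "dir_t = (0, 1)"

section \<open>The initial-boundary value problem\<close>

abbreviation cyl :: "real ^ 'n::finite \<Rightarrow> real \<Rightarrow> ((real ^ 'n) \<times> real) set" where
  "cyl X T \<equiv> cbox 0 X \<times> {0..T}"

abbreviation lateral :: "real ^ 'n::finite \<Rightarrow> real \<Rightarrow> ((real ^ 'n) \<times> real) set" where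
  "lateral X T \<equiv> frontier (box 0 X) \<times> {0..T}"

text \<open>
  The scheme uses the values of \<open>f\<close>, \<open>g\<close>, \<open>u\<^sub>0\<close>, \<open>u\<^sub>1\<close> also on the closures of the sets on which
  the equations prescribe them; the continuity conditions pin those values down.
\<close>

definition ibvp_solution ::
  "real ^ 'n::finite \<Rightarrow> real \<Rightarrow> real ^ 'n \<Rightarrow> (real ^ 'n \<Rightarrow> real) \<Rightarrow>
   ((real ^ 'n) \<times> real \<Rightarrow> real) \<Rightarrow> ((real ^ 'n) \<times> real \<Rightarrow> real) \<Rightarrow>
   (real ^ 'n \<Rightarrow> real) \<Rightarrow> (real ^ 'n \<Rightarrow> real) \<Rightarrow> ((real ^ 'n) \<times> real \<Rightarrow> real) \<Rightarrow> bool" where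
  "ibvp_solution X T a \<rho> f g u\<^sub>0 u\<^sub>1 u \<longleftrightarrow>
     continuous_on (cyl X T) f \<and> continuous_on (lateral X T) g \<and>
     continuous_on (cbox 0 X) u\<^sub>0 \<and> continuous_on (cbox 0 X) u\<^sub>1 \<and>
     (\<forall>x\<in>box 0 X. \<forall>t\<in>{0<..<T}.
        \<rho> x * pd2 (cyl X T) dir_t u (x, t)
          - (\<Sum>k\<in>UNIV. (a $ k)\<^sup>2 * pd2 (cyl X T) (dir_x k) u (x, t)) = f (x, t)) \<and>
     (\<forall>x\<in>frontier (box 0 X). \<forall>t\<in>{0<..<T}. u (x, t) = g (x, t)) \<and>
     (\<forall>x\<in>box 0 X. u (x, 0) = u\<^sub>0 x) \<and>
     (\<forall>x\<in>box 0 X. pd (cyl X T) dir_t u (x, 0) = u\<^sub>1 x)"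

text \<open>
  Boundary data \<open>g\<^sub>k\<close>.  On the faces concerned, lines in the directions that are used stay in the
  boundary as long as they stay in the closed box, so these are tangential derivatives of \<open>g\<close>.
  Points lying both on a face \<open>x\<^sub>k \<in> {0, X\<^sub>k}\<close> and on another face are covered by both formulas;
  these agree for the data of a smooth solution.
\<close>

definition g_bd ::
  "real ^ 'n::finite \<Rightarrow> real \<Rightarrow> real ^ 'n \<Rightarrow> (real ^ 'n \<Rightarrow> real) \<Rightarrow>
   ((real ^ 'n) \<times> real \<Rightarrow> real) \<Rightarrow> ((real ^ 'n) \<times> real \<Rightarrow> real) \<Rightarrow>
   'n \<Rightarrow> real ^ 'n \<Rightarrow> real \<Rightarrow> real" where
  "g_bd X T a \<rho> f g k x t =
     (if x $ k = 0 \<or> x $ k = X $ k then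
        \<rho> x * pd2 (lateral X T) dir_t g (x, t)
          - (\<Sum>l\<in>UNIV - {k}. (a $ l)\<^sup>2 * pd2 (lateral X T) (dir_x l) g (x, t)) - f (x, t)
      else (a $ k)\<^sup>2 * pd2 (lateral X T) (dir_x k) g (x, t))"

section \<open>Meshes and mesh operators\<close>

definition mesh_step :: "real ^ 'n::finite \<Rightarrow> ('n \<Rightarrow> nat) \<Rightarrow> real ^ 'n" where
  "mesh_step X N = (\<chi> k. X $ k / real (N k))"

text \<open>
  Mesh functions are functions on \<open>real ^ 'n\<close> of which only the values at the nodes matter.
\<close>

definition mesh :: "('n::finite \<Rightarrow> nat) \<Rightarrow> real ^ 'n \<Rightarrow> (real ^ 'n) set" where
  "mesh N h = {(\<chi> k. real (i k) * h $ k) | i. \<forall>k. i k \<le> N k}"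

definition mesh_int :: "('n::finite \<Rightarrow> nat) \<Rightarrow> real ^ 'n \<Rightarrow> (real ^ 'n) set" where
  "mesh_int N h = {(\<chi> k. real (i k) * h $ k) | i. \<forall>k. 1 \<le> i k \<and> i k < N k}"

definition mesh_bd :: "('n::finite \<Rightarrow> nat) \<Rightarrow> real ^ 'n \<Rightarrow> (real ^ 'n) set" where
  "mesh_bd N h = mesh N h - mesh_int N h"

definition Lam :: "real ^ 'n::finite \<Rightarrow> 'n \<Rightarrow> (real ^ 'n \<Rightarrow> real) \<Rightarrow> real ^ 'n \<Rightarrow> real" where
  "Lam h k w x = (w (x + axis k (h $ k)) - 2 * w x + w (x - axis k (h $ k))) / (h $ k)\<^sup>2"

definition sN :: "real ^ 'n::finite \<Rightarrow> 'n \<Rightarrow> (real ^ 'n \<Rightarrow> real) \<Rightarrow> real ^ 'n \<Rightarrow> real" where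
  "sN h k w x = (w (x - axis k (h $ k)) + 10 * w x + w (x + axis k (h $ k))) / 12"

definition Lh :: "real ^ 'n::finite \<Rightarrow> real ^ 'n \<Rightarrow> (real ^ 'n \<Rightarrow> real) \<Rightarrow> real ^ 'n \<Rightarrow> real" where
  "Lh a h w x = (\<Sum>k\<in>UNIV. (a $ k)\<^sup>2 * Lam h k w x)"

text \<open>The operator \<open>(\<rho> I + (h\<^sub>t\<^sup>2 / 12) L\<^sub>h) (1 / \<rho>)\<close>.\<close>

definition rho_op ::
  "(real ^ 'n::finite \<Rightarrow> real) \<Rightarrow> real ^ 'n \<Rightarrow> real ^ 'n \<Rightarrow> real \<Rightarrow>
   (real ^ 'n \<Rightarrow> real) \<Rightarrow> real ^ 'n \<Rightarrow> real" where
  "rho_op \<rho> a h ht w x = w x + ht\<^sup>2 / 12 * Lh a h (\<lambda>y. w y / \<rho> y) x"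

definition Lam_t :: "real \<Rightarrow> (nat \<Rightarrow> real) \<Rightarrow> nat \<Rightarrow> real" where
  "Lam_t ht y m = (y (m + 1) - 2 * y m + y (m - 1)) / ht\<^sup>2"

definition delta_t :: "real \<Rightarrow> (nat \<Rightarrow> real) \<Rightarrow> nat \<Rightarrow> real" where
  "delta_t ht y m = (y (m + 1) - y m) / ht"

definition delta_bar_t :: "real \<Rightarrow> (nat \<Rightarrow> real) \<Rightarrow> nat \<Rightarrow> real" where
  "delta_bar_t ht y m = (y m - y (m - 1)) / ht"

definition I_t :: "real \<Rightarrow> (nat \<Rightarrow> real) \<Rightarrow> nat \<Rightarrow> real" where
  "I_t ht y m = ht * (\<Sum>l=1..m. y l)"

section \<open>The space \<open>H\<^sub>h\<close>\<close>

text \<open>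
  Elements of \<open>H\<^sub>h\<close> are made unique by requiring the value 0 everywhere outside the interior
  nodes, not only at the boundary nodes.
\<close>

definition Hh :: "('n::finite \<Rightarrow> nat) \<Rightarrow> real ^ 'n \<Rightarrow> (real ^ 'n \<Rightarrow> real) set" where
  "Hh N h = {w. \<forall>x. x \<notin> mesh_int N h \<longrightarrow> w x = 0}"

definition zero_ext ::
  "('n::finite \<Rightarrow> nat) \<Rightarrow> real ^ 'n \<Rightarrow> (real ^ 'n \<Rightarrow> real) \<Rightarrow> real ^ 'n \<Rightarrow> real" where
  "zero_ext N h w x = (if x \<in> mesh_int N h then w x else 0)"

definition inner_h ::
  "('n::finite \<Rightarrow> nat) \<Rightarrow> real ^ 'n \<Rightarrow> (real ^ 'n \<Rightarrow> real) \<Rightarrow> (real ^ 'n \<Rightarrow> real) \<Rightarrow> real" where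
  "inner_h N h v w = (\<Prod>k\<in>UNIV. h $ k) * (\<Sum>x\<in>mesh_int N h. v x * w x)"

definition norm_h :: "('n::finite \<Rightarrow> nat) \<Rightarrow> real ^ 'n \<Rightarrow> (real ^ 'n \<Rightarrow> real) \<Rightarrow> real" where
  "norm_h N h w = sqrt ((\<Prod>k\<in>UNIV. h $ k) * (\<Sum>x\<in>mesh_int N h. (w x)\<^sup>2))"

definition norm_H1 ::
  "real ^ 'n \<Rightarrow> ('n::finite \<Rightarrow> nat) \<Rightarrow> real ^ 'n \<Rightarrow> (real ^ 'n \<Rightarrow> real) \<Rightarrow> real" where
  "norm_H1 a N h w = sqrt (inner_h N h (\<lambda>x. - Lh a h w x) w)"

text \<open>The inverse of \<open>s\<^bsub>kN\<^esub>\<close> as an operator in \<open>H\<^sub>h\<close>.\<close>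

definition sN_inv ::
  "('n::finite \<Rightarrow> nat) \<Rightarrow> real ^ 'n \<Rightarrow> 'n \<Rightarrow> (real ^ 'n \<Rightarrow> real) \<Rightarrow> real ^ 'n \<Rightarrow> real" where
  "sN_inv N h k = inv_into (Hh N h) (\<lambda>w. zero_ext N h (sN h k w))"

definition Eh ::
  "real ^ 'n \<Rightarrow> ('n::finite \<Rightarrow> nat) \<Rightarrow> real ^ 'n \<Rightarrow> (real ^ 'n \<Rightarrow> real) \<Rightarrow> real ^ 'n \<Rightarrow> real" where
  "Eh a N h w x = - (\<Sum>k\<in>UNIV. (a $ k)\<^sup>2 * sN_inv N h k (zero_ext N h (Lam h k w)) x)"

text \<open>The order \<open>A \<le> B\<close> between self-adjoint operators in \<open>H\<^sub>h\<close>.\<close>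

definition op_le ::
  "('n::finite \<Rightarrow> nat) \<Rightarrow> real ^ 'n \<Rightarrow> ((real ^ 'n \<Rightarrow> real) \<Rightarrow> (real ^ 'n \<Rightarrow> real)) \<Rightarrow>
   ((real ^ 'n \<Rightarrow> real) \<Rightarrow> (real ^ 'n \<Rightarrow> real)) \<Rightarrow> bool" where
  "op_le N h A B \<longleftrightarrow> (\<forall>w\<in>Hh N h. inner_h N h (A w) w \<le> inner_h N h (B w) w)"

section \<open>The semi-explicit vector compact scheme\<close>

definition f_h ::
  "(real ^ 'n::finite \<Rightarrow> real) \<Rightarrow> real ^ 'n \<Rightarrow> real ^ 'n \<Rightarrow> real \<Rightarrow>
   ((real ^ 'n) \<times> real \<Rightarrow> real) \<Rightarrow> nat \<Rightarrow> real ^ 'n \<Rightarrow> real" where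
  "f_h \<rho> a h ht f m x = f (x, real m * ht) +
     ht\<^sup>2 / 12 * (Lam_t ht (\<lambda>j. f (x, real j * ht)) m + Lh a h (\<lambda>y. f (y, real m * ht) / \<rho> y) x)"

text \<open>The two admissible choices of \<open>f\<^sub>d\<^sub>h\<^sub>t\<^sup>(\<^sup>0\<^sup>)\<close>.\<close>

definition f_d0_three_level ::
  "real \<Rightarrow> ((real ^ 'n::finite) \<times> real \<Rightarrow> real) \<Rightarrow> real ^ 'n \<Rightarrow> real" where
  "f_d0_three_level ht f x = 7/12 * f (x, 0) + 1/2 * f (x, ht) - 1/12 * f (x, 2 * ht)"

definition f_d0_half_step ::
  "real \<Rightarrow> ((real ^ 'n::finite) \<times> real \<Rightarrow> real) \<Rightarrow> real ^ 'n \<Rightarrow> real" where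
  "f_d0_half_step ht f x = 1/3 * f (x, 0) + 2/3 * f (x, ht / 2)"

definition f_h0 ::
  "(real ^ 'n::finite \<Rightarrow> real) \<Rightarrow> real ^ 'n \<Rightarrow> real ^ 'n \<Rightarrow> real \<Rightarrow>
   ((real ^ 'n) \<times> real \<Rightarrow> real) \<Rightarrow> (real ^ 'n \<Rightarrow> real) \<Rightarrow> real ^ 'n \<Rightarrow> real" where
  "f_h0 \<rho> a h ht f fd x = fd x + ht\<^sup>2 / 12 * Lh a h (\<lambda>y. f (y, 0) / \<rho> y) x"

definition u1_h ::
  "(real ^ 'n::finite \<Rightarrow> real) \<Rightarrow> real ^ 'n \<Rightarrow> real ^ 'n \<Rightarrow> real \<Rightarrow>
   (real ^ 'n \<Rightarrow> real) \<Rightarrow> real ^ 'n \<Rightarrow> real" where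
  "u1_h \<rho> a h ht u\<^sub>1 x = \<rho> x * u\<^sub>1 x + ht\<^sup>2 / 6 * Lh a h u\<^sub>1 x"

text \<open>
  \<open>v m\<close> and \<open>vv k m\<close> stand for \<open>v\<^sup>m\<close> and \<open>v\<^sub>k\<^sub>k\<^sup>m\<close>; \<open>fd\<close> is the chosen \<open>f\<^sub>d\<^sub>h\<^sub>t\<^sup>(\<^sup>0\<^sup>)\<close>.
\<close>

definition scheme_solution ::
  "real ^ 'n::finite \<Rightarrow> real \<Rightarrow> real ^ 'n \<Rightarrow> (real ^ 'n \<Rightarrow> real) \<Rightarrow>
   ((real ^ 'n) \<times> real \<Rightarrow> real) \<Rightarrow> ((real ^ 'n) \<times> real \<Rightarrow> real) \<Rightarrow>
   (real ^ 'n \<Rightarrow> real) \<Rightarrow> (real ^ 'n \<Rightarrow> real) \<Rightarrow> ('n \<Rightarrow> nat) \<Rightarrow> nat \<Rightarrow> (real ^ 'n \<Rightarrow> real) \<Rightarrow>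
   (nat \<Rightarrow> real ^ 'n \<Rightarrow> real) \<Rightarrow> ('n \<Rightarrow> nat \<Rightarrow> real ^ 'n \<Rightarrow> real) \<Rightarrow> bool" where
  "scheme_solution X T a \<rho> f g u\<^sub>0 u\<^sub>1 N M fd v vv \<longleftrightarrow>
     (let h = mesh_step X N; ht = T / real M;
          w = (\<lambda>m x. \<Sum>k\<in>UNIV. (a $ k)\<^sup>2 * vv k m x)
      in (\<forall>m\<in>{1..M - 1}. \<forall>x\<in>mesh_int N h.
            \<rho> x * Lam_t ht (\<lambda>j. v j x) m - rho_op \<rho> a h ht (w m) x = f_h \<rho> a h ht f m x) \<and>
         (\<forall>k. \<forall>m\<in>{0..M - 1}. \<forall>x\<in>mesh_int N h. sN h k (vv k m) x = Lam h k (v m) x) \<and>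
         (\<forall>x\<in>mesh_int N h.
            \<rho> x * delta_t ht (\<lambda>j. v j x) 0 =
              ht / 2 * rho_op \<rho> a h ht (w 0) x + u1_h \<rho> a h ht u\<^sub>1 x
                + ht / 2 * f_h0 \<rho> a h ht f fd x) \<and>
         (\<forall>m\<in>{1..M}. \<forall>x\<in>mesh_bd N h. v m x = g (x, real m * ht)) \<and>
         (\<forall>k. \<forall>m\<in>{0..M - 1}. \<forall>x\<in>mesh_bd N h.
            (a $ k)\<^sup>2 * vv k m x = g_bd X T a \<rho> f g k x (real m * ht)) \<and>
         (\<forall>x\<in>mesh N h. v 0 x = u\<^sub>0 x))"

end

theory Submission
  imports Defs "HOL-Library.Function_Algebras"
begin

text \<open>
  The error \<open>e = u - v\<close> and the errors \<open>e\<^sub>k\<^sub>k\<close> of the auxiliary unknowns vanish on the boundary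
  (\<open>g_bd_eq\<close>: the data \<open>g\<^sub>k\<close> are the boundary values of \<open>a\<^sub>k\<^sup>2 \<partial>\<^sub>k\<^sup>2 u\<close>), so everything happens in
  \<open>H\<^sub>h\<close>.  There \<open>e\<^sub>k\<^sub>k = s\<^sub>k\<^sub>N\<^sup>-\<^sup>1 (\<Lambda>\<^sub>k e + r\<^sub>k)\<close>, whence the sum of the \<open>a\<^sub>k\<^sup>2 e\<^sub>k\<^sub>k\<close> is \<open>q - E\<^sub>h e\<close> with a small
  \<open>q\<close>.  With \<open>B = \<rho> I + h\<^sub>t\<^sup>2/12 L\<^sub>h\<close> the scheme reads \<open>\<rho> \<Lambda>\<^sub>t e + B \<rho>\<^sup>-\<^sup>1 E\<^sub>h e = B \<rho>\<^sup>-\<^sup>1 q + r\<close>.  This is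
  not symmetric, but multiplication by \<open>\<rho> B\<^sup>-\<^sup>1\<close> gives the symmetric three-level equation
  \<open>D \<Lambda>\<^sub>t e + E\<^sub>h e = D G\<close> with \<open>D = \<rho> B\<^sup>-\<^sup>1 \<rho>\<close> (\<open>D_equation\<close>).

  The first stability condition gives \<open>\<epsilon> \<rho>_lo \<le> B \<le> \<rho>\<close>; hence \<open>D \<ge> \<rho>\<close>, and the loss in
  \<open>B\<^sup>-\<^sup>1\<close> costs only a factor \<open>\<epsilon>\<^sup>-\<^sup>1\<^sup>/\<^sup>2\<close> in the norm defined by \<open>D\<close> (\<open>D_ge\<close>, \<open>sqrt_D_le\<close>).  The second one
  gives \<open>D - h\<^sub>t\<^sup>2/4 E\<^sub>h \<ge> \<epsilon>\<^sub>0\<^sup>2 D\<close>, so that the usual energy of the three-level equation controls the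
  \<open>D\<close>-norm of the time difference with the factor \<open>\<epsilon>\<^sub>0\<close>.  For a bound with a single power of
  \<open>\<epsilon>\<^sub>0\<close> the energy itself must grow without a factor \<open>\<epsilon>\<^sub>0\<^sup>-\<^sup>1\<close>; this is \<open>energy_step\<close>.
  The third term of the error follows by summing the equation over the time levels, which bounds
  \<open>E\<^sub>h I\<^sub>h\<^sub>t e\<close>, and from \<open>\<parallel>L\<^sub>h w\<parallel>\<^sup>2 \<le> (E\<^sub>h w, - L\<^sub>h w)\<close> (\<open>nLh_nLh_le_Eh_nLh\<close>), which rests on the
  commutation of all operators \<open>\<Lambda>\<^sub>k\<close>, \<open>s\<^sub>k\<^sub>N\<close> in \<open>H\<^sub>h\<close>.  At the last level there is no equation; an
  inverse inequality bounds the contribution of \<open>e\<^sup>M\<close>.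

  By continuity the differential equation holds up to the boundary of the cylinder (\<open>pde\<close>).
  Inserting it, the residual of \<open>u\<close> becomes a combination of the Numerov
  error \<open>\<Lambda>\<^sub>t u - s\<^sub>t\<^sub>N \<partial>\<^sub>t\<^sup>2 u = O(h\<^sub>t\<^sup>4)\<close> and of \<open>h\<^sub>t\<^sup>2/12\<close> times the differences
  \<open>\<Lambda>\<^sub>k \<partial>\<^sub>t\<^sup>2 u - \<Lambda>\<^sub>t \<partial>\<^sub>k\<^sup>2 u\<close>.  The latter are of second order, because both terms approximate
  \<open>\<Lambda>\<^sub>k \<Lambda>\<^sub>t u = \<Lambda>\<^sub>t \<Lambda>\<^sub>k u\<close> (\<open>mixed_difference\<close>).  The first step is treated in the same way; both choices
  of its right-hand side have the same Taylor coefficients up to second order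
  (\<open>start_weights\<close>).  Derivatives of order at most six enter.
\<close>

section \<open>Forms and the energy inequality\<close>

text \<open>
  Mesh functions are added and scaled pointwise, so that operators on them are linear maps in the sense
  of \<^const>\<open>linear\<close>, and products such as \<open>\<rho> * w\<close> are pointwise products.
\<close>

instantiation "fun" :: (type, real_vector) real_vector
begin

definition scaleR_fun :: "real \<Rightarrow> ('a \<Rightarrow> 'b) \<Rightarrow> 'a \<Rightarrow> 'b" where
  "c *\<^sub>R f = (\<lambda>x. c *\<^sub>R f x)"

instance
  by standard (simp_all add: scaleR_fun_def fun_eq_iff scaleR_add_right scaleR_add_left)

end

lemma scaleR_fun_apply [simp]: "(c *\<^sub>R f) x = c *\<^sub>R f x"
  by (simp add: scaleR_fun_def)

lemma sum_fun_apply [simp]: "(\<Sum>i\<in>A. f i) x = (\<Sum>i\<in>A. f i x)"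
  by (induction A rule: infinite_finite_induct) simp_all

definition psd_form :: "('v::real_vector \<Rightarrow> 'v \<Rightarrow> real) \<Rightarrow> bool" where
  "psd_form Q \<longleftrightarrow> (\<forall>y. linear (\<lambda>x. Q x y)) \<and> (\<forall>x y. Q x y = Q y x) \<and> (\<forall>x. 0 \<le> Q x x)"

lemma psd_form_sym: "psd_form Q \<Longrightarrow> Q x y = Q y x"
  and psd_form_nonneg: "psd_form Q \<Longrightarrow> 0 \<le> Q x x"
  by (auto simp: psd_form_def)

lemma psd_form_linear:
  assumes "psd_form Q"
  shows "Q (x + y) z = Q x z + Q y z" "Q (x - y) z = Q x z - Q y z" "Q (c *\<^sub>R x) z = c * Q x z"
    "Q z (x + y) = Q z x + Q z y" "Q z (x - y) = Q z x - Q z y" "Q z (c *\<^sub>R x) = c * Q z x"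
proof -
  have L: "linear (\<lambda>x. Q x z)" for z
    using assms by (auto simp: psd_form_def)
  note S = psd_form_sym[OF assms, of z]
  show "Q (x + y) z = Q x z + Q y z" "Q (x - y) z = Q x z - Q y z" "Q (c *\<^sub>R x) z = c * Q x z"
    using linear_add[OF L[of z]] linear_diff[OF L[of z]] linear_scale[OF L[of z]] by auto
  then show "Q z (x + y) = Q z x + Q z y" "Q z (x - y) = Q z x - Q z y" "Q z (c *\<^sub>R x) = c * Q z x"
    using S[of x] S[of y] S[of "x + y"] S[of "x - y"] S[of "c *\<^sub>R x"] by auto
qed

lemma psd_form_diff:
  assumes "psd_form P" "psd_form Q" "\<And>x. c * Q x x \<le> P x x"
  shows "psd_form (\<lambda>x y. P x y - c * Q x y)"
  unfolding psd_form_def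
proof (intro conjI allI)
  fix y show "linear (\<lambda>x. P x y - c * Q x y)"
    by (rule linearI) (simp_all add: psd_form_linear assms algebra_simps)
next
  fix x y show "P x y - c * Q x y = P y x - c * Q y x"
    using psd_form_sym[OF assms(1)] psd_form_sym[OF assms(2)] by metis
next
  fix x show "0 \<le> P x x - c * Q x x" using assms(3)[of x] by simp
qed

lemma psd_form_Cauchy:
  assumes "psd_form Q"
  shows "Q x y \<le> sqrt (Q x x) * sqrt (Q y y)"
proof -
  note nonneg = psd_form_nonneg[OF assms]
  have quad: "0 \<le> s\<^sup>2 * Q x x - 2 * s * t * Q x y + t\<^sup>2 * Q y y" for s t
    using nonneg[of "s *\<^sub>R x - t *\<^sub>R y"] psd_form_sym[OF assms, of y x]
    by (simp add: psd_form_linear[OF assms] algebra_simps power2_eq_square)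
  have "(Q x y)\<^sup>2 \<le> Q x x * Q y y"
  proof (cases "Q x x = 0")
    case True
    have "Q x y = 0"
    proof (rule ccontr)
      assume ne: "Q x y \<noteq> 0"
      show False using quad[of "(Q y y + 1) / (2 * Q x y)" 1] True ne by (simp add: field_simps)
    qed
    with True show ?thesis by simp
  next
    case False
    with nonneg[of x] have "0 < Q x x" by simp
    moreover have "0 \<le> Q x x * (Q x x * Q y y - (Q x y)\<^sup>2)"
      using quad[of "Q x y" "Q x x"] by (simp add: algebra_simps power2_eq_square)
    ultimately show ?thesis by (simp add: zero_le_mult_iff)
  qed
  then have "\<bar>Q x y\<bar> \<le> sqrt (Q x x * Q y y)"
    by (metis real_sqrt_abs real_sqrt_le_iff)
  then show ?thesis by (simp add: real_sqrt_mult)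
qed

lemma psd_form_triangle:
  assumes "psd_form Q"
  shows "sqrt (Q (x + y) (x + y)) \<le> sqrt (Q x x) + sqrt (Q y y)"
proof (rule real_le_lsqrt)
  show "0 \<le> sqrt (Q x x) + sqrt (Q y y)"
    using psd_form_nonneg[OF assms] by simp
  have "Q (x + y) (x + y) = Q x x + 2 * Q x y + Q y y"
    using psd_form_sym[OF assms, of y x] by (simp add: psd_form_linear[OF assms])
  also have "\<dots> \<le> (sqrt (Q x x) + sqrt (Q y y))\<^sup>2"
    using psd_form_Cauchy[OF assms, of x y] psd_form_nonneg[OF assms]
    by (simp add: power2_sum)
  finally show "Q (x + y) (x + y) \<le> (sqrt (Q x x) + sqrt (Q y y))\<^sup>2" .
qed

lemma psd_form_scale_sqrt:
  assumes "psd_form Q" "0 \<le> c"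
  shows "sqrt (Q (c *\<^sub>R x) (c *\<^sub>R x)) = c * sqrt (Q x x)"
proof -
  have "Q (c *\<^sub>R x) (c *\<^sub>R x) = c\<^sup>2 * Q x x"
    by (simp add: psd_form_linear[OF assms(1)] power2_eq_square)
  then show ?thesis using assms(2) by (simp add: real_sqrt_mult)
qed

text \<open>
  With \<open>y = y\<^sup>m\<close> and \<open>y' = y\<^sup>m\<^sup>-\<^sup>1\<close> this is the conserved quantity of \<open>D \<Lambda>\<^sub>t y + E y = 0\<close>: the form
  \<open>D - \<tau>\<^sup>2/4 E\<close> of the difference quotient plus the form \<open>E\<close> of the mean value.
\<close>

definition energy ::
  "('v::real_vector \<Rightarrow> 'v \<Rightarrow> real) \<Rightarrow> ('v \<Rightarrow> 'v \<Rightarrow> real) \<Rightarrow> real \<Rightarrow> 'v \<Rightarrow> 'v \<Rightarrow> real" where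
  "energy D E \<tau> y y' = (D (y - y') (y - y') - \<tau>\<^sup>2 / 4 * E (y - y') (y - y')) / \<tau>\<^sup>2
      + E (y + y') (y + y') / 4"

lemma sum_products_le_sqrt:
  fixes p q r s :: real
  shows "p * q + r * s \<le> sqrt (p\<^sup>2 + r\<^sup>2) * sqrt (q\<^sup>2 + s\<^sup>2)"
proof -
  have "(p * q + r * s)\<^sup>2 \<le> (p\<^sup>2 + r\<^sup>2) * (q\<^sup>2 + s\<^sup>2)"
    using zero_le_power2[of "p * s - r * q"] by (simp add: algebra_simps power2_eq_square)
  then show ?thesis
    by (metis real_le_rsqrt real_sqrt_mult)
qed

lemma energy_nonneg:
  assumes "psd_form E" "\<And>x. \<tau>\<^sup>2 / 4 * E x x \<le> D x x"
  shows "0 \<le> energy D E \<tau> y y'"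
  using assms(2)[of "y - y'"] psd_form_nonneg[OF assms(1), of "y + y'"]
  by (auto simp: energy_def intro!: add_nonneg_nonneg divide_nonneg_nonneg)

text \<open>
  The energy changes by \<open>D(G, y2 - y0)\<close>.  Estimating the two differences in \<open>y2 - y0\<close> separately would
  cost a factor \<open>\<epsilon>\<^sub>0\<^sup>-\<^sup>1\<close>.  Instead \<open>y2\<close> is eliminated by means of the equation; what remains pairs \<open>G\<close>
  with \<open>y1 - y0\<close> in the form \<open>D - \<tau>\<^sup>2/4 E\<close> and with \<open>y1 + y0\<close> in the form \<open>E\<close>, and since
  \<open>(D - \<tau>\<^sup>2/4 E) + \<tau>\<^sup>2/4 E = D\<close>, the two Cauchy inequalities combine to the \<open>D\<close>-norm of \<open>G\<close> times the
  square root of the energy.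
\<close>

lemma energy_step:
  fixes D E :: "'v::real_vector \<Rightarrow> 'v \<Rightarrow> real"
  assumes D: "psd_form D" and E: "psd_form E" and ED: "\<And>x. \<tau>\<^sup>2 / 4 * E x x \<le> D x x"
    and \<tau>: "0 < \<tau>"
    and eq: "\<And>z. D (y2 - 2 *\<^sub>R y1 + y0) z + \<tau>\<^sup>2 * E y1 z = \<tau>\<^sup>2 * D G z"
  shows "sqrt (energy D E \<tau> y2 y1) \<le> sqrt (energy D E \<tau> y1 y0) + \<tau> * sqrt (D G G)"
proof -
  define D0 where "D0 = (\<lambda>x y. D x y - \<tau>\<^sup>2 / 4 * E x y)"
  have D0: "psd_form D0" unfolding D0_def by (rule psd_form_diff[OF D E ED])
  note lin = psd_form_linear[OF D] psd_form_linear[OF E]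
  note nn = psd_form_nonneg[OF D] psd_form_nonneg[OF E] psd_form_nonneg[OF D0]
  define b where "b = y1 - y0"
  define s where "s = y1 + y0"
  define e where "e = energy D E \<tau> y1 y0"
  have e0: "0 \<le> e" unfolding e_def by (rule energy_nonneg) (use E ED in auto)
  have e_eq: "e = D0 b b / \<tau>\<^sup>2 + E s s / 4"
    by (simp add: e_def energy_def D0_def b_def s_def)
  have sym: "D y0 y1 = D y1 y0" "D y0 y2 = D y2 y0" "D y1 y2 = D y2 y1"
    "E y0 y1 = E y1 y0" "E y0 y2 = E y2 y0" "E y1 y2 = E y2 y1"
    "D y0 G = D G y0" "D y1 G = D G y1" "D y2 G = D G y2" "E y0 G = E G y0" "E y1 G = E G y1" "E y2 G = E G y2"
    using psd_form_sym[OF D] psd_form_sym[OF E] by auto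
  \<comment> \<open>Testing with the difference over two steps turns the equation into the energy balance.\<close>
  have bal: "energy D E \<tau> y2 y1 - e = D G (y2 - y0)"
  proof -
    have "\<tau>\<^sup>2 * (energy D E \<tau> y2 y1 - e) = D (y2 - 2 *\<^sub>R y1 + y0) (y2 - y0) + \<tau>\<^sup>2 * E y1 (y2 - y0)"
      using \<tau> by (simp add: energy_def e_def lin sym field_simps)
    then have "\<tau>\<^sup>2 * (energy D E \<tau> y2 y1 - e) = \<tau>\<^sup>2 * D G (y2 - y0)" using eq by simp
    then show ?thesis using \<tau> by simp
  qed
  \<comment> \<open>Here \<open>y2\<close> is eliminated: only \<open>y2 - 2 y1 + y0\<close> is left, which the equation expresses by \<open>G\<close> and \<open>y1\<close>.\<close>
  have "D G (y2 - y0) = 2 * D G b + D (y2 - 2 *\<^sub>R y1 + y0) G"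
    by (simp add: lin b_def sym)
  also have "\<dots> = 2 * D G b + \<tau>\<^sup>2 * D G G - \<tau>\<^sup>2 * E y1 G" using eq[of G] by simp
  also have "\<dots> = 2 * (D0 G b + (\<tau>\<^sup>2 / 4) * - E G s) + \<tau>\<^sup>2 * D G G"
    by (simp add: D0_def b_def s_def lin sym field_simps)
  finally have test: "D G (y2 - y0) = 2 * (D0 G b + (\<tau>\<^sup>2 / 4) * - E G s) + \<tau>\<^sup>2 * D G G" .
  have "- E G s \<le> sqrt (E G G) * sqrt (E s s)"
    using psd_form_Cauchy[OF E, of "- 1 *\<^sub>R G" s] psd_form_scale_sqrt[OF E, of 1 G]
    by (simp only: psd_form_linear[OF E]) simp
  then have "(\<tau>\<^sup>2 / 4) * - E G s \<le> (\<tau>\<^sup>2 / 4) * (sqrt (E G G) * sqrt (E s s))"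
    by (rule mult_left_mono) simp
  then have "D0 G b + (\<tau>\<^sup>2 / 4) * - E G s
      \<le> sqrt (D0 G G) * sqrt (D0 b b) + (\<tau>\<^sup>2 / 4) * (sqrt (E G G) * sqrt (E s s))"
    using psd_form_Cauchy[OF D0, of G b] by linarith
  also have "\<dots> = \<tau> * (sqrt (D0 G G) * (sqrt (D0 b b) / \<tau>)
      + (\<tau> / 2 * sqrt (E G G)) * (sqrt (E s s) / 2))"
    using \<tau> by (simp add: field_simps power2_eq_square)
  also have "\<dots> \<le> \<tau> * (sqrt ((sqrt (D0 G G))\<^sup>2 + (\<tau> / 2 * sqrt (E G G))\<^sup>2)
      * sqrt ((sqrt (D0 b b) / \<tau>)\<^sup>2 + (sqrt (E s s) / 2)\<^sup>2))"
    using \<tau> by (intro mult_left_mono sum_products_le_sqrt) simp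
  also have "(sqrt (D0 G G))\<^sup>2 + (\<tau> / 2 * sqrt (E G G))\<^sup>2 = D G G"
    using nn by (simp add: power_mult_distrib power_divide D0_def)
  also have "(sqrt (D0 b b) / \<tau>)\<^sup>2 + (sqrt (E s s) / 2)\<^sup>2 = e"
    using nn by (simp add: power_divide e_eq)
  finally have "D G (y2 - y0) \<le> 2 * (\<tau> * (sqrt (D G G) * sqrt e)) + \<tau>\<^sup>2 * D G G"
    unfolding test by (intro add_right_mono mult_left_mono) simp_all
  with bal have "energy D E \<tau> y2 y1 \<le> e + (2 * (\<tau> * (sqrt (D G G) * sqrt e)) + \<tau>\<^sup>2 * D G G)"
    by simp
  also have "\<dots> = (sqrt e + \<tau> * sqrt (D G G))\<^sup>2"
    using nn e0 by (simp add: power2_sum power_mult_distrib)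
  finally show ?thesis
    using \<tau> nn e0 unfolding e_def[symmetric]
    by (intro real_le_lsqrt) auto
qed

text \<open>
  Gaussian elimination without pivoting: the pivot \<open>A z z\<close> is positive, and the Schur complement \<open>A'\<close> is
  again positive definite because its form at \<open>w\<close> is the form of \<open>A\<close> at the extension of \<open>w\<close> that
  annihilates row \<open>z\<close>.
\<close>

lemma positive_definite_solvable:
  fixes A :: "'a \<Rightarrow> 'a \<Rightarrow> real"
  assumes "finite S"
    and "\<And>w. (\<exists>x\<in>S. w x \<noteq> 0) \<Longrightarrow> 0 < (\<Sum>x\<in>S. \<Sum>y\<in>S. w x * A x y * w y)"
  shows "\<exists>w. \<forall>x\<in>S. (\<Sum>y\<in>S. A x y * w y) = f x"
  using assms
proof (induction S arbitrary: A f rule: finite_induct)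
  case empty
  then show ?case by simp
next
  case (insert z S)
  have pos: "0 < A z z"
  proof -
    let ?w = "\<lambda>x. if x = z then 1 else (0::real)"
    have "0 < (\<Sum>x\<in>insert z S. \<Sum>y\<in>insert z S. ?w x * A x y * ?w y)"
      by (rule insert.prems) simp
    also have "\<dots> = A z z" using insert.hyps
      by (simp add: sum.insert_if if_distrib[of "\<lambda>t. t * _"] if_distrib[of "\<lambda>t. _ * t"] cong: if_cong)
    finally show ?thesis .
  qed
  define A' where "A' = (\<lambda>x y. A x y - A x z * A z y / A z z)"
  define f' where "f' = (\<lambda>x. f x - A x z * f z / A z z)"
  have "\<exists>w. \<forall>x\<in>S. (\<Sum>y\<in>S. A' x y * w y) = f' x"
  proof (rule insert.IH)
    fix w :: "'a \<Rightarrow> real" assume ne: "\<exists>x\<in>S. w x \<noteq> 0"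
    define \<sigma> where "\<sigma> = (\<Sum>y\<in>S. A z y * w y)"
    \<comment> \<open>This value at \<open>z\<close> makes row \<open>z\<close> of \<open>A\<close> vanish on the extension.\<close>
    define \<omega> where "\<omega> = w(z := - \<sigma> / A z z)"
    have w: "\<omega> x = w x" if "x \<in> S" for x using that insert.hyps by (auto simp: \<omega>_def)
    have wz: "\<omega> z = - \<sigma> / A z z" by (simp add: \<omega>_def)
    have "0 < (\<Sum>x\<in>insert z S. \<Sum>y\<in>insert z S. \<omega> x * A x y * \<omega> y)"
      by (rule insert.prems) (use ne w in auto)
    also have "\<dots> = \<omega> z * (A z z * \<omega> z + \<sigma>)
        + (\<Sum>x\<in>S. w x * A x z * \<omega> z + (\<Sum>y\<in>S. w x * A x y * w y))"
      using insert.hyps w by (simp add: \<sigma>_def sum_distrib_left algebra_simps)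
    also have "A z z * \<omega> z + \<sigma> = 0" using pos by (simp add: wz)
    also have "(\<Sum>x\<in>S. w x * A x z * \<omega> z + (\<Sum>y\<in>S. w x * A x y * w y))
        = (\<Sum>x\<in>S. \<Sum>y\<in>S. w x * A' x y * w y)"
      by (rule sum.cong)
        (simp_all add: A'_def wz \<sigma>_def algebra_simps sum_subtractf sum_distrib_left sum_divide_distrib)
    finally show "0 < (\<Sum>x\<in>S. \<Sum>y\<in>S. w x * A' x y * w y)" by simp
  qed
  then obtain w where w: "\<And>x. x \<in> S \<Longrightarrow> (\<Sum>y\<in>S. A' x y * w y) = f' x" by blast
  define \<sigma> where "\<sigma> = (\<Sum>y\<in>S. A z y * w y)"
  define \<omega> where "\<omega> = w(z := (f z - \<sigma>) / A z z)"
  have sum_eq: "(\<Sum>y\<in>insert z S. A x y * \<omega> y) = A x z * ((f z - \<sigma>) / A z z) + (\<Sum>y\<in>S. A x y * w y)" for x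
  proof -
    have "(\<Sum>y\<in>S. A x y * \<omega> y) = (\<Sum>y\<in>S. A x y * w y)"
      using insert.hyps by (intro sum.cong) (auto simp: \<omega>_def)
    then show ?thesis using insert.hyps by (simp add: \<omega>_def)
  qed
  have "(\<Sum>y\<in>insert z S. A x y * \<omega> y) = f x" if "x \<in> insert z S" for x
  proof (cases "x = z")
    case True
    then show ?thesis unfolding sum_eq using pos by (simp add: \<sigma>_def)
  next
    case False
    with that have "x \<in> S" by simp
    have "(\<Sum>y\<in>S. A' x y * w y) = (\<Sum>y\<in>S. A x y * w y) - A x z * \<sigma> / A z z"
      by (simp add: A'_def \<sigma>_def algebra_simps sum_subtractf sum_distrib_left sum_divide_distrib)
    then show ?thesis unfolding sum_eq using w[OF \<open>x \<in> S\<close>]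
      by (simp add: f'_def diff_divide_distrib algebra_simps)
  qed
  then show ?case by blast
qed

section \<open>Difference operators on the mesh\<close>

lemma axis_uminus: "axis k (- c) = - axis k (c :: real)"
  by (simp add: axis_def vec_eq_iff)

lemma axis_0: "axis k (0 :: real) = 0"
  by (simp add: axis_def vec_eq_iff)

locale mesh_space =
  fixes N :: "'n::finite \<Rightarrow> nat" and h :: "real ^ 'n"
  assumes h_pos: "0 < h $ k"
begin

lemma h_nonzero [simp]: "h $ k \<noteq> 0"
  using h_pos[of k] by simp

abbreviation ip where "ip \<equiv> inner_h N h"
abbreviation S where "S \<equiv> mesh_int N h"
abbreviation V where "V \<equiv> Hh N h"
abbreviation Z where "Z \<equiv> zero_ext N h"

text \<open>
  Membership is a condition on each coordinate separately; the commutation of differences in two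
  directions depends on this product structure.
\<close>

lemma mem_mesh_int: "x \<in> S \<longleftrightarrow> (\<forall>k. \<exists>i. 1 \<le> i \<and> i < N k \<and> x $ k = real i * h $ k)"
proof
  assume "\<forall>k. \<exists>i. 1 \<le> i \<and> i < N k \<and> x $ k = real i * h $ k"
  then obtain i where "\<And>k. 1 \<le> i k \<and> i k < N k \<and> x $ k = real (i k) * h $ k" by metis
  then show "x \<in> S" by (auto simp: mesh_int_def vec_eq_iff intro!: exI[of _ i])
qed (auto simp: mesh_int_def)

lemma finite_mesh_int: "finite S"
proof -
  have "finite (Pi UNIV (\<lambda>k. {..<N k}))"
    using finite_PiE[of "UNIV::'n set" "\<lambda>k. {..<N k}"] by (simp add: PiE_UNIV_domain)
  then have "finite ((\<lambda>i. (\<chi> k. real (i k) * h $ k) :: real ^ 'n) ` Pi UNIV (\<lambda>k. {..<N k}))"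
    by (rule finite_imageI)
  then show ?thesis by (rule rev_finite_subset) (auto simp: mesh_int_def)
qed

lemma Hh_zero: "w \<in> V \<Longrightarrow> x \<notin> S \<Longrightarrow> w x = 0"
  by (simp add: Hh_def)

lemma subspace_Hh: "subspace V"
  by (auto simp: subspace_def Hh_def)

lemmas Hh_closed = subspace_add[OF subspace_Hh] subspace_diff[OF subspace_Hh]
  subspace_scale[OF subspace_Hh] subspace_0[OF subspace_Hh]

lemma zero_ext_in_Hh [simp]: "Z w \<in> V"
  by (simp add: Hh_def zero_ext_def)

lemma zero_ext_id: "w \<in> V \<Longrightarrow> Z w = w"
  by (auto simp: Hh_def zero_ext_def)

lemma linear_zero_ext: "linear Z"
  by (rule linearI) (auto simp: zero_ext_def fun_eq_iff)

lemma prod_h_pos: "0 < (\<Prod>k\<in>UNIV. h $ k)"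
  by (rule prod_pos) (simp add: h_pos)

lemma ip_zero_ext [simp]: "ip (Z v) w = ip v w" "ip v (Z w) = ip v w"
  by (simp_all add: inner_h_def zero_ext_def cong: sum.cong)

lemma psd_form_ip: "psd_form ip"
  unfolding psd_form_def
proof (intro conjI allI)
  fix y show "linear (\<lambda>x. ip x y)"
    by (rule linearI) (simp_all add: inner_h_def sum.distrib sum_distrib_left algebra_simps)
next
  fix x y show "ip x y = ip y x" by (simp add: inner_h_def mult.commute)
next
  fix x show "0 \<le> ip x x"
    using prod_h_pos by (auto simp: inner_h_def intro!: mult_nonneg_nonneg[OF less_imp_le sum_nonneg])
qed

lemmas ip_sym = psd_form_sym[OF psd_form_ip]
lemmas ip_nonneg = psd_form_nonneg[OF psd_form_ip]
lemmas ip_linear = psd_form_linear[OF psd_form_ip]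
lemmas ip_Cauchy = psd_form_Cauchy[OF psd_form_ip]

lemma linear_ip: "linear (\<lambda>x. ip x y)" "linear (ip y)"
  by (rule linearI; simp add: ip_linear)+

lemma ip_sum: "ip (\<Sum>i\<in>A. f i) y = (\<Sum>i\<in>A. ip (f i) y)" "ip y (\<Sum>i\<in>A. f i) = (\<Sum>i\<in>A. ip y (f i))"
  using linear_sum[OF linear_ip(1)] linear_sum[OF linear_ip(2)] by auto

lemma norm_h_eq: "norm_h N h w = sqrt (ip w w)"
  by (simp add: norm_h_def inner_h_def power2_eq_square)

lemma ip_mono:
  assumes "\<And>x. x \<in> S \<Longrightarrow> v x * w x \<le> v' x * w' x"
  shows "ip v w \<le> ip v' w'"
  unfolding inner_h_def using prod_h_pos assms by (intro mult_left_mono sum_mono) auto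

lemma ip_cong:
  assumes "\<And>x. x \<in> S \<Longrightarrow> v x * w x = v' x * w' x"
  shows "ip v w = ip v' w'"
  unfolding inner_h_def using assms by simp

lemma ip_eq_0D:
  assumes "ip w w = 0" "x \<in> S" shows "w x = 0"
proof -
  have "(\<Sum>x\<in>S. w x * w x) = 0" using assms(1) by (simp add: inner_h_def)
  then show ?thesis using assms(2) finite_mesh_int by (subst (asm) sum_nonneg_eq_0_iff) auto
qed

lemma ip_pos:
  assumes "w \<in> V" "w \<noteq> 0" shows "0 < ip w w"
proof (rule ccontr)
  assume "\<not> 0 < ip w w"
  then have "ip w w = 0" using ip_nonneg[of w] by simp
  then have "w x = 0" for x using ip_eq_0D[of w x] Hh_zero[OF assms(1), of x] by blast
  then show False using assms(2) by (auto simp: fun_eq_iff)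
qed

text \<open>
  Both sides are sums over the pairs of interior nodes that differ by \<open>d\<close>.
\<close>

lemma ip_shift:
  assumes "v \<in> V" "w \<in> V"
  shows "ip v (\<lambda>x. w (x + d)) = ip (\<lambda>x. v (x - d)) w"
proof -
  let ?A = "{x\<in>S. x + d \<in> S}" and ?B = "{x\<in>S. x - d \<in> S}"
  have "(\<Sum>x\<in>S. v x * w (x + d)) = (\<Sum>x\<in>?A. v x * w (x + d))"
    using finite_mesh_int assms by (intro sum.mono_neutral_right) (auto simp: Hh_zero)
  also have "\<dots> = (\<Sum>x\<in>?B. v (x - d) * w x)"
    by (rule sum.reindex_bij_witness[of _ "\<lambda>x. x - d" "\<lambda>x. x + d"]) auto
  also have "\<dots> = (\<Sum>x\<in>S. v (x - d) * w x)"
    using finite_mesh_int assms by (intro sum.mono_neutral_left) (auto simp: Hh_zero)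
  finally show ?thesis by (simp add: inner_h_def)
qed

lemma ip_shift_le:
  assumes "w \<in> V"
  shows "ip (\<lambda>x. w (x + d)) (\<lambda>x. w (x + d)) \<le> ip w w"
proof -
  let ?A = "{x\<in>S. x + d \<in> S}" and ?B = "{x\<in>S. x - d \<in> S}"
  have "(\<Sum>x\<in>S. w (x + d) * w (x + d)) = (\<Sum>x\<in>?A. w (x + d) * w (x + d))"
    using finite_mesh_int assms by (intro sum.mono_neutral_right) (auto simp: Hh_zero)
  also have "\<dots> = (\<Sum>x\<in>?B. w x * w x)"
    by (rule sum.reindex_bij_witness[of _ "\<lambda>x. x - d" "\<lambda>x. x + d"]) auto
  also have "\<dots> \<le> (\<Sum>x\<in>S. w x * w x)"
    using finite_mesh_int by (intro sum_mono2) auto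
  finally show ?thesis using prod_h_pos by (simp add: inner_h_def)
qed

text \<open>
  The operator \<open>-\<Lambda>\<^sub>k\<close> in \<open>H\<^sub>h\<close>, with the value 0 on the boundary.
\<close>

definition nLam :: "'n \<Rightarrow> (real ^ 'n \<Rightarrow> real) \<Rightarrow> real ^ 'n \<Rightarrow> real" where
  "nLam k w = - Z (Lam h k w)"

lemma linear_Lam: "linear (Lam h k)"
proof (rule linearI)
  show "Lam h k (v + w) = Lam h k v + Lam h k w" for v w
    by (simp add: Lam_def fun_eq_iff add_divide_distrib diff_divide_distrib distrib_left)
  show "Lam h k (c *\<^sub>R w) = c *\<^sub>R Lam h k w" for c w
    by (simp add: Lam_def fun_eq_iff algebra_simps)
qed

lemma linear_nLam: "linear (nLam k)"
proof (rule linearI)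
  show "nLam k (v + w) = nLam k v + nLam k w" for v w
    by (simp add: nLam_def linear_add[OF linear_Lam] linear_add[OF linear_zero_ext])
  show "nLam k (c *\<^sub>R w) = c *\<^sub>R nLam k w" for c w
    by (simp add: nLam_def linear_scale[OF linear_Lam] linear_scale[OF linear_zero_ext])
qed

lemma nLam_in_Hh [simp]: "nLam k w \<in> V"
  by (simp add: nLam_def Hh_def zero_ext_def)

lemma nLam_apply: "x \<in> S \<Longrightarrow> nLam k w x = (2 * w x - w (x + axis k (h $ k)) - w (x - axis k (h $ k))) / (h $ k)\<^sup>2"
  by (simp add: nLam_def zero_ext_def Lam_def field_simps)

lemma ip_nLam_left:
  "ip (nLam k v) w = (2 * ip v w - ip (\<lambda>x. v (x + axis k (h $ k))) w - ip (\<lambda>x. v (x - axis k (h $ k))) w) / (h $ k)\<^sup>2"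
proof -
  have "ip (nLam k v) w = ip ((1 / (h $ k)\<^sup>2) *\<^sub>R (2 *\<^sub>R v - (\<lambda>x. v (x + axis k (h $ k))) - (\<lambda>x. v (x - axis k (h $ k))))) w"
    by (rule ip_cong) (simp add: nLam_apply)
  then show ?thesis unfolding ip_linear by simp
qed

lemma nLam_sym:
  assumes "v \<in> V" "w \<in> V" shows "ip (nLam k v) w = ip v (nLam k w)"
  using ip_shift[OF assms(2,1)] ip_shift[OF assms(2,1), of "- axis k (h $ k)"]
  unfolding ip_sym[of v] ip_nLam_left
  by (simp add: ip_sym[of w] )

lemma nLam_bounds:
  assumes "v \<in> V"
  shows nLam_nonneg: "0 \<le> ip (nLam k v) v" and nLam_le: "ip (nLam k v) v \<le> 4 / (h $ k)\<^sup>2 * ip v v"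
proof -
  have abs: "\<bar>ip (\<lambda>x. v (x + d)) v\<bar> \<le> ip v v" for d
  proof -
    let ?w = "\<lambda>x. v (x + d)"
    have "0 \<le> ip (?w + v) (?w + v)" "0 \<le> ip (?w - v) (?w - v)" by (rule ip_nonneg)+
    with ip_shift_le[OF assms, of d] show ?thesis
      by (simp add: ip_linear ip_sym[of v ?w])
  qed
  from abs[of "axis k (h $ k)"] abs[of "- axis k (h $ k)"]
  have "0 \<le> 2 * ip v v - ip (\<lambda>x. v (x + axis k (h $ k))) v - ip (\<lambda>x. v (x - axis k (h $ k))) v"
    "2 * ip v v - ip (\<lambda>x. v (x + axis k (h $ k))) v - ip (\<lambda>x. v (x - axis k (h $ k))) v \<le> 4 * ip v v"
    by simp_all
  then show "0 \<le> ip (nLam k v) v" "ip (nLam k v) v \<le> 4 / (h $ k)\<^sup>2 * ip v v"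
    unfolding ip_nLam_left by (auto intro!: divide_right_mono)
qed

text \<open>
  Differences commute before the values on the boundary are set to 0.  Setting them to 0 does no harm
  for \<open>k \<noteq> l\<close>: if a step in direction \<open>k\<close> from an interior node leaves the interior, then the whole line in
  direction \<open>l\<close> through the point reached lies outside, so \<open>\<Lambda>\<^sub>l w\<close> already vanishes there.
\<close>

lemma nLam_commute:
  assumes "w \<in> V" shows "nLam k (nLam l w) = nLam l (nLam k w)"
proof (cases "k = l")
  case False
  have shift_out: "Lam h l w (x + axis k c) = Z (Lam h l w) (x + axis k c)"
    if "x \<in> S" "k \<noteq> l" for x k l c
  proof (cases "x + axis k c \<in> S")
    case False
    define y where "y = x + axis k c"
    have "y + axis l d \<notin> S" for d
    proof
      assume A: "y + axis l d \<in> S"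
      have "y \<in> S" unfolding mem_mesh_int
      proof
        fix j
        show "\<exists>i. 1 \<le> i \<and> i < N j \<and> y $ j = real i * h $ j"
        proof (cases "j = k")
          case True
          then show ?thesis using A[unfolded mem_mesh_int, rule_format, of j] \<open>k \<noteq> l\<close> by (simp add: axis_def)
        next
          case False
          then show ?thesis using \<open>x \<in> S\<close>[unfolded mem_mesh_int, rule_format, of j]
            by (simp add: axis_def y_def)
        qed
      qed
      with False show False by (simp add: y_def)
    qed
    from this[of 0] this[of "h $ l"] this[of "- h $ l"] have "y \<notin> S" "y + axis l (h $ l) \<notin> S" "y - axis l (h $ l) \<notin> S"
      by (simp_all add: axis_uminus axis_0)
    then have "Lam h l w y = 0" by (simp add: Lam_def Hh_zero[OF assms])
    then show ?thesis using False by (simp add: zero_ext_def y_def)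
  qed (simp add: zero_ext_def)
  have PP: "nLam k (nLam l w) x = (if x \<in> S then Lam h k (Lam h l w) x else 0)" if "k \<noteq> l" for k l x
  proof (cases "x \<in> S")
    case True
    have "nLam k (nLam l w) x = - Lam h k (nLam l w) x"
      using True by (simp add: nLam_def[of k] zero_ext_def[of N h _ x])
    also have "\<dots> = Lam h k (Z (Lam h l w)) x"
      unfolding nLam_def linear_neg[OF linear_Lam] by simp
    also have "\<dots> = Lam h k (Lam h l w) x"
    proof -
      have "Lam h l w (x - axis k (h $ k)) = Z (Lam h l w) (x - axis k (h $ k))"
        using shift_out[OF True that, of "- h $ k"] by (simp add: axis_uminus)
      moreover have "Lam h l w x = Z (Lam h l w) x" using True by (simp add: zero_ext_def)
      ultimately show ?thesis
        using shift_out[OF True that, of "h $ k"] by (simp only: Lam_def[of h k])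
    qed
    finally show ?thesis using True by simp
  next
    case False
    then show ?thesis using Hh_zero[OF nLam_in_Hh] by simp
  qed
  have Lam_eq: "Lam h k = (\<lambda>u y. inverse ((h $ k)\<^sup>2) * (u (y + axis k (h $ k)) - 2 * u y + u (y - axis k (h $ k))))" for k
    by (simp add: Lam_def fun_eq_iff divide_inverse)
  have "Lam h k (Lam h l w) x = Lam h l (Lam h k w) x" for x
    unfolding Lam_eq by (simp add: algebra_simps)
  then show ?thesis using PP[of k l] PP[of l k] False by (auto simp: fun_eq_iff)
qed simp


lemma nLam_linear: "nLam k (x + y) = nLam k x + nLam k y" "nLam k (x - y) = nLam k x - nLam k y" "nLam k (c *\<^sub>R x) = c *\<^sub>R nLam k x"
  using linear_add[OF linear_nLam] linear_diff[OF linear_nLam] linear_scale[OF linear_nLam] by auto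

lemma linear_solvable:
  assumes L: "linear L" and pos: "\<And>w. w \<in> V \<Longrightarrow> w \<noteq> 0 \<Longrightarrow> 0 < ip (L w) w"
  shows "\<exists>w\<in>V. Z (L w) = Z f"
proof -
  define e where "e = (\<lambda>y x :: real ^ 'n. if x = y then 1 else 0 :: real)"
  define ext where "ext w = (\<Sum>y\<in>S. w y *\<^sub>R e y)" for w
  have ext_apply: "ext w x = (if x \<in> S then w x else 0)" for w x
    using finite_mesh_int by (simp add: ext_def e_def if_distrib[of "\<lambda>t. _ * t"] cong: if_cong)
  have ext_V: "ext w \<in> V" for w by (simp add: Hh_def ext_apply)
  have L_ext: "L (ext w) x = (\<Sum>y\<in>S. L (e y) x * w y)" for w x
    unfolding ext_def linear_sum[OF L] linear_scale[OF L] by (simp add: mult.commute)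
  have "\<exists>w. \<forall>x\<in>S. (\<Sum>y\<in>S. L (e y) x * w y) = f x"
  proof (rule positive_definite_solvable[OF finite_mesh_int])
    fix w :: "real ^ 'n \<Rightarrow> real" assume "\<exists>x\<in>S. w x \<noteq> 0"
    then have "ext w \<noteq> 0" by (auto simp: ext_apply fun_eq_iff)
    then have "0 < ip (L (ext w)) (ext w)" by (rule pos[OF ext_V])
    also have "ip (L (ext w)) (ext w) = (\<Prod>k\<in>UNIV. h $ k) * (\<Sum>x\<in>S. \<Sum>y\<in>S. w x * L (e y) x * w y)"
      by (simp add: inner_h_def L_ext ext_apply sum_distrib_left mult.commute mult.left_commute)
    finally show "0 < (\<Sum>x\<in>S. \<Sum>y\<in>S. w x * L (e y) x * w y)"
      using prod_h_pos by (simp add: zero_less_mult_iff)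
  qed
  then obtain w where "\<And>x. x \<in> S \<Longrightarrow> L (ext w) x = f x" by (auto simp: L_ext)
  then show ?thesis using ext_V[of w] by (intro bexI[of _ "ext w"]) (auto simp: zero_ext_def)
qed

section \<open>Inverses of coercive operators\<close>

definition inv_on :: "((real ^ 'n \<Rightarrow> real) \<Rightarrow> (real ^ 'n \<Rightarrow> real)) \<Rightarrow> (real ^ 'n \<Rightarrow> real) \<Rightarrow> real ^ 'n \<Rightarrow> real" where
  "inv_on L w = inv_into V L (Z w)"

end

text \<open>
  Both operators to be inverted, \<open>s\<^sub>k\<^sub>N\<close> and \<open>\<rho> I + h\<^sub>t\<^sup>2/12 L\<^sub>h\<close>, are of this kind; the
  constant \<open>c\<close> enters the bounds for the inverse.
\<close>

locale coercive_operator = mesh_space N h for N :: "'n::finite \<Rightarrow> nat" and h :: "real ^ 'n" +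
  fixes L :: "(real ^ 'n \<Rightarrow> real) \<Rightarrow> real ^ 'n \<Rightarrow> real" and c :: real
  assumes linear_L: "linear L" and L_in_Hh [simp]: "L w \<in> V"
    and c_pos: "0 < c" and coercive: "w \<in> V \<Longrightarrow> c * ip w w \<le> ip (L w) w"
    and L_sym: "v \<in> V \<Longrightarrow> w \<in> V \<Longrightarrow> ip (L v) w = ip v (L w)"
begin

lemma inj_on_L: "inj_on L V"
proof (rule inj_onI)
  fix v w assume V: "v \<in> V" "w \<in> V" and eq: "L v = L w"
  have d: "v - w \<in> V" using V by (rule Hh_closed)
  have "L (v - w) = 0" using eq by (simp add: linear_diff[OF linear_L])
  then have "c * ip (v - w) (v - w) \<le> 0" using coercive[OF d] by (simp add: inner_h_def)
  then have "\<not> 0 < ip (v - w) (v - w)" using c_pos by (simp add: mult_le_0_iff)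
  then show "v = w" using ip_pos[OF d] by fastforce
qed

lemma surj_L: assumes "w \<in> V" shows "w \<in> L ` V"
proof -
  have "\<exists>v\<in>V. Z (L v) = Z w"
  proof (rule linear_solvable[OF linear_L])
    fix v assume v: "v \<in> V" "v \<noteq> 0"
    have "0 < c * ip v v" using ip_pos[OF v] c_pos by simp
    also have "\<dots> \<le> ip (L v) v" by (rule coercive[OF v(1)])
    finally show "0 < ip (L v) v" .
  qed
  then show ?thesis by (auto simp: zero_ext_id assms)
qed

lemma inv_in_Hh: "inv_on L w \<in> V"
  unfolding inv_on_def by (rule inv_into_into[OF surj_L[OF zero_ext_in_Hh]])

lemma L_inv: "L (inv_on L w) = Z w"
  unfolding inv_on_def by (rule f_inv_into_f[OF surj_L[OF zero_ext_in_Hh]])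

lemma inv_eqI: "v \<in> V \<Longrightarrow> L v = Z w \<Longrightarrow> inv_on L w = v"
  using inj_on_L L_inv by (metis inv_in_Hh inj_onD)

lemma inv_L: "w \<in> V \<Longrightarrow> inv_on L (L w) = w"
  by (rule inv_eqI) (simp_all add: zero_ext_id)

lemma linear_inv: "linear (inv_on L)"
proof (rule linearI)
  show "inv_on L (x + y) = inv_on L x + inv_on L y" for x y
    by (rule inv_eqI)
      (simp_all add: Hh_closed inv_in_Hh linear_add[OF linear_L] linear_add[OF linear_zero_ext] L_inv)
  show "inv_on L (r *\<^sub>R x) = r *\<^sub>R inv_on L x" for r x
    by (rule inv_eqI)
      (simp_all add: Hh_closed inv_in_Hh linear_scale[OF linear_L] linear_scale[OF linear_zero_ext] L_inv)
qed

lemma inv_sym: "ip (inv_on L v) w = ip v (inv_on L w)"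
  using L_sym[OF inv_in_Hh inv_in_Hh, of v w] by (simp add: L_inv)

lemma inv_coercive: "c * ip (inv_on L v) (inv_on L v) \<le> ip (inv_on L v) v"
  using coercive[OF inv_in_Hh, of v] by (simp add: L_inv ip_sym)

lemma inv_nonneg: "0 \<le> ip (inv_on L v) v"
  using inv_coercive[of v] ip_nonneg[of "inv_on L v"] c_pos
  by (meson less_imp_le mult_nonneg_nonneg order_trans)

lemma norm_inv_le: "c * sqrt (ip (inv_on L v) (inv_on L v)) \<le> sqrt (ip v v)"
proof (cases "ip (inv_on L v) (inv_on L v) = 0")
  case False
  let ?n = "sqrt (ip (inv_on L v) (inv_on L v))"
  from False have pos: "0 < ?n" using ip_nonneg[of "inv_on L v"] by simp
  have "?n * (c * ?n) = c * ip (inv_on L v) (inv_on L v)"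
    using ip_nonneg[of "inv_on L v"] by simp
  also have "\<dots> \<le> ?n * sqrt (ip v v)"
    using inv_coercive[of v] ip_Cauchy[of "inv_on L v" v] by linarith
  finally show ?thesis using pos by (simp only: mult_le_cancel_left_pos)
qed (use ip_nonneg[of v] in simp)

lemma inv_form_le: "c * ip (inv_on L v) v \<le> ip v v"
proof -
  have "c * ip (inv_on L v) v \<le> (c * sqrt (ip (inv_on L v) (inv_on L v))) * sqrt (ip v v)"
    using mult_left_mono[OF ip_Cauchy[of "inv_on L v" v], of c] c_pos by simp
  also have "\<dots> \<le> sqrt (ip v v) * sqrt (ip v v)"
    by (intro mult_right_mono norm_inv_le) (simp add: ip_nonneg)
  finally show ?thesis using ip_nonneg[of v] by simp
qed

end

context mesh_space
begin

text \<open>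
  The operator \<open>s\<^sub>k\<^sub>N\<close> in \<open>H\<^sub>h\<close>; by \<open>sH_eq\<close> it is \<open>I + h\<^sub>k\<^sup>2/12 \<Lambda>\<^sub>k\<close>, a polynomial in \<open>\<Lambda>\<^sub>k\<close>.
\<close>

definition sH :: "'n \<Rightarrow> (real ^ 'n \<Rightarrow> real) \<Rightarrow> real ^ 'n \<Rightarrow> real" where
  "sH k w = Z (sN h k w)"

definition c12 :: "'n \<Rightarrow> real" where "c12 k = (h $ k)\<^sup>2 / 12"

lemma c12_nonneg: "0 \<le> c12 k" by (simp add: c12_def)

lemma linear_sN: "linear (sN h k)"
proof (rule linearI)
  show "sN h k (v + w) = sN h k v + sN h k w" for v w
    by (simp add: sN_def fun_eq_iff add_divide_distrib distrib_left)
  show "sN h k (c *\<^sub>R w) = c *\<^sub>R sN h k w" for c w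
    by (simp add: sN_def fun_eq_iff algebra_simps)
qed

lemma linear_sH: "linear (sH k)"
proof (rule linearI)
  show "sH k (v + w) = sH k v + sH k w" for v w
    by (simp add: sH_def linear_add[OF linear_sN] linear_add[OF linear_zero_ext])
  show "sH k (c *\<^sub>R w) = c *\<^sub>R sH k w" for c w
    by (simp add: sH_def linear_scale[OF linear_sN] linear_scale[OF linear_zero_ext])
qed

lemma sH_in_Hh [simp]: "sH k w \<in> V"
  by (simp add: sH_def)

lemma sH_eq: assumes "w \<in> V" shows "sH k w = w - c12 k *\<^sub>R nLam k w"
proof
  fix x show "sH k w x = (w - c12 k *\<^sub>R nLam k w) x"
    using Hh_zero[OF assms, of x]
    by (auto simp: sH_def c12_def nLam_def zero_ext_def sN_def Lam_def field_simps)
qed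

lemma sH_ge:
  assumes "v \<in> V"
  shows "2 / 3 * ip v v \<le> ip (sH k v) v"
proof -
  have "c12 k * ip (nLam k v) v \<le> c12 k * (4 / (h $ k)\<^sup>2 * ip v v)"
    by (intro mult_left_mono nLam_le assms c12_nonneg)
  also have "\<dots> = 1 / 3 * ip v v" by (simp add: c12_def)
  finally show ?thesis by (simp add: sH_eq[OF assms] ip_linear)
qed

lemma sH_sym: "v \<in> V \<Longrightarrow> w \<in> V \<Longrightarrow> ip (sH k v) w = ip v (sH k w)"
  by (simp add: sH_eq ip_linear nLam_sym)

lemma nLam_sH_commute: "w \<in> V \<Longrightarrow> nLam l (sH k w) = sH k (nLam l w)"
  by (simp add: sH_eq nLam_linear nLam_commute[of w l k])

definition sHinv :: "'n \<Rightarrow> (real ^ 'n \<Rightarrow> real) \<Rightarrow> real ^ 'n \<Rightarrow> real" where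
  "sHinv k = inv_on (sH k)"

lemma sHinv_eq: "sHinv k w = sN_inv N h k (Z w)"
  by (simp add: sHinv_def inv_on_def sN_inv_def sH_def[abs_def])

lemma coercive_sH: "coercive_operator N h (sH k) (2 / 3)"
  by (intro coercive_operator.intro coercive_operator_axioms.intro mesh_space_axioms
      linear_sH sH_in_Hh sH_sym sH_ge) simp_all

lemmas linear_sHinv = coercive_operator.linear_inv[OF coercive_sH, folded sHinv_def]
lemmas sHinv_in_Hh [simp] = coercive_operator.inv_in_Hh[OF coercive_sH, folded sHinv_def]
lemmas sH_sHinv = coercive_operator.L_inv[OF coercive_sH, folded sHinv_def]
lemmas sHinv_eqI = coercive_operator.inv_eqI[OF coercive_sH, folded sHinv_def]
lemmas sHinv_sym = coercive_operator.inv_sym[OF coercive_sH, folded sHinv_def]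
lemmas sHinv_nonneg = coercive_operator.inv_nonneg[OF coercive_sH, folded sHinv_def]
lemmas norm_sHinv_le = coercive_operator.norm_inv_le[OF coercive_sH, folded sHinv_def]

lemma sHinv_nLam_commute: assumes "w \<in> V" shows "sHinv k (nLam k w) = nLam k (sHinv k w)"
proof (rule sHinv_eqI)
  show "sH k (nLam k (sHinv k w)) = Z (nLam k w)"
    using nLam_sH_commute[of "sHinv k w" k k] by (simp add: sH_sHinv zero_ext_id assms)
qed simp

text \<open>
  The equation \<open>s A = \<Lambda>\<close> for \<open>A = s\<^sup>-\<^sup>1 \<Lambda>\<close>, with \<open>s = I + h\<^sub>k\<^sup>2/12 \<Lambda>\<^sub>k\<close> inserted; all comparisons of
  \<open>E\<^sub>h\<close> with \<open>-L\<^sub>h\<close> are read off from the second term.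
\<close>

lemma sHinv_nLam_expand: assumes "w \<in> V" shows "sHinv k (nLam k w) = nLam k w + c12 k *\<^sub>R nLam k (sHinv k (nLam k w))"
proof -
  have "nLam k w = sHinv k (nLam k w) - c12 k *\<^sub>R nLam k (sHinv k (nLam k w))"
    using sH_eq[of "sHinv k (nLam k w)" k] by (simp add: sH_sHinv zero_ext_id)
  then show ?thesis by (metis diff_add_cancel)
qed

lemma psd_form_operator:
  assumes A: "linear A" and sym: "\<And>v w. v \<in> V \<Longrightarrow> w \<in> V \<Longrightarrow> ip (A v) w = ip v (A w)"
    and nonneg: "\<And>v. v \<in> V \<Longrightarrow> 0 \<le> ip (A v) v"
  shows "psd_form (\<lambda>x y. ip (A (Z x)) y)"
  unfolding psd_form_def
proof (intro conjI allI)
  fix y show "linear (\<lambda>x. ip (A (Z x)) y)"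
    by (rule linearI)
      (simp_all add: ip_linear linear_add[OF linear_zero_ext] linear_scale[OF linear_zero_ext]
        linear_add[OF A] linear_scale[OF A])
next
  fix x y
  have "ip (A (Z x)) (Z y) = ip (Z x) (A (Z y))" by (rule sym) simp_all
  then show "ip (A (Z x)) y = ip (A (Z y)) x" by (simp add: ip_sym)
next
  fix x show "0 \<le> ip (A (Z x)) x" using nonneg[of "Z x"] by simp
qed

text \<open>
  \<open>A\<^sup>2 \<le> \<mu> A\<close> for a semidefinite operator \<open>A \<le> \<mu> I\<close>, by the Cauchy inequality for the form of \<open>A\<close>.
\<close>

lemma norm_operator_le:
  assumes Q: "psd_form (\<lambda>x y. ip (A (Z x)) y)" and w: "w \<in> V"
    and le: "\<And>v. v \<in> V \<Longrightarrow> ip (A v) v \<le> \<mu> * ip v v"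
  shows "ip (A w) (A w) \<le> \<mu> * ip (A w) w"
proof (cases "ip (A w) (A w) = 0")
  case True
  then have "\<And>x. x \<in> S \<Longrightarrow> A w x = 0" by (rule ip_eq_0D)
  then have "ip (A w) w = 0" by (simp add: inner_h_def)
  with True show ?thesis by simp
next
  case False
  define t where "t = ip (A w) (A w)"
  define z where "z = Z (A w)"
  have t: "0 < t" using False ip_nonneg[of "A w"] by (simp add: t_def)
  have Aw: "0 \<le> ip (A w) w" using psd_form_nonneg[OF Q, of w] by (simp add: zero_ext_id w)
  have "t = ip (A (Z w)) z" by (simp add: t_def z_def zero_ext_id w)
  also have "\<dots> \<le> sqrt (ip (A w) w) * sqrt (ip (A z) z)"
    using psd_form_Cauchy[OF Q, of w z] by (simp add: zero_ext_id w z_def)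
  also have "\<dots> \<le> sqrt (ip (A w) w) * sqrt (\<mu> * t)"
    using le[of z] Aw by (intro mult_left_mono real_sqrt_le_mono) (simp_all add: t_def z_def)
  finally have le': "t \<le> sqrt (ip (A w) w * (\<mu> * t))" by (simp add: real_sqrt_mult)
  then have "t\<^sup>2 \<le> (sqrt (ip (A w) w * (\<mu> * t)))\<^sup>2" using t by (intro power_mono) auto
  also have "\<dots> = ip (A w) w * (\<mu> * t)"
    using le' t by (intro real_sqrt_pow2) (metis less_le_trans not_le less_imp_le real_sqrt_lt_0_iff)
  finally have "t * t \<le> t * (\<mu> * ip (A w) w)" by (simp add: power2_eq_square algebra_simps)
  then show ?thesis using t by (simp add: t_def)
qed

lemma psd_form_nLam: "psd_form (\<lambda>x y. ip (nLam k (Z x)) y)"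
  by (rule psd_form_operator[OF linear_nLam nLam_sym nLam_nonneg])

lemma nLam_norm_le: "w \<in> V \<Longrightarrow> ip (nLam k w) (nLam k w) \<le> (4 / (h $ k)\<^sup>2)\<^sup>2 * ip w w"
  using norm_operator_le[OF psd_form_nLam, of w k "4 / (h $ k)\<^sup>2"] nLam_le
    mult_left_mono[OF nLam_le[of w k], of "4 / (h $ k)\<^sup>2"]
  by (simp add: power2_eq_square[of "4 / (h $ k)\<^sup>2"])

end

section \<open>Comparison of the two discrete elliptic operators\<close>

text \<open>
  The sequence \<open>s i = Q(T\<^sup>i x, T\<^sup>i x)\<close> is logarithmically convex by the Cauchy inequality.  One
  increase \<open>s 0 < s 1\<close> would force it to increase forever, so it would not tend to 0; and
  \<open>s 1 \<le> s 0\<close> implies the claim by the Cauchy inequality once more.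
\<close>

lemma symmetrized_contraction:
  fixes T :: "'v::real_vector \<Rightarrow> 'v"
  assumes Q: "psd_form Q" and sym: "\<And>x y. Q (T x) y = Q x (T y)"
    and lim: "(\<lambda>i. Q ((T ^^ i) x) ((T ^^ i) x)) \<longlonglongrightarrow> 0"
  shows "Q (T x) x \<le> Q x x"
proof -
  define s where "s i = Q ((T ^^ i) x) ((T ^^ i) x)" for i
  have s_nonneg: "0 \<le> s i" for i unfolding s_def by (rule psd_form_nonneg[OF Q])
  have log_convex: "s (Suc i) \<le> sqrt (s i) * sqrt (s (Suc (Suc i)))" for i
    using psd_form_Cauchy[OF Q, of "(T ^^ i) x" "(T ^^ Suc (Suc i)) x"]
    by (simp add: s_def sym)
  have "s 1 \<le> s 0"
  proof (rule ccontr)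
    assume "\<not> s 1 \<le> s 0"
    then have s01: "s 0 < s 1" by simp
    have grow: "s 1 \<le> s (Suc i) \<and> s i \<le> s (Suc i)" for i
    proof (induction i)
      case (Suc i)
      then have pos: "0 < s (Suc i)" using s01 s_nonneg[of 0] by linarith
      have "s (Suc i) \<le> sqrt (s (Suc i)) * sqrt (s (Suc (Suc i)))"
        using log_convex[of i] Suc s_nonneg
        by (meson mult_right_mono order_trans real_sqrt_ge_zero real_sqrt_le_mono)
      then have "sqrt (s (Suc i)) * sqrt (s (Suc i)) \<le> sqrt (s (Suc i)) * sqrt (s (Suc (Suc i)))"
        using s_nonneg[of "Suc i"] by simp
      then have "s (Suc i) \<le> s (Suc (Suc i))"
        using pos by (subst (asm) mult_le_cancel_left_pos) simp_all
      then show ?case using Suc by simp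
    qed (use s01 in simp)
    have "s 1 \<le> 0"
    proof (rule LIMSEQ_le_const)
      show "(\<lambda>i. s (Suc i)) \<longlonglongrightarrow> 0" using lim unfolding s_def[symmetric] by (rule LIMSEQ_Suc)
    qed (use grow in blast)
    then show False using s01 s_nonneg[of 0] by linarith
  qed
  moreover have "Q (T x) x \<le> sqrt (s 1) * sqrt (s 0)"
    using psd_form_Cauchy[OF Q, of "T x" x] by (simp add: s_def)
  ultimately have "Q (T x) x \<le> sqrt (s 0) * sqrt (s 0)"
    using s_nonneg by (meson mult_right_mono order_trans real_sqrt_ge_zero real_sqrt_le_mono)
  then show ?thesis using s_nonneg[of 0] by (simp add: s_def)
qed

context mesh_space
begin

text \<open>
  The product of the commuting semidefinite operators \<open>-\<Lambda>\<^sub>l\<close> and \<open>s\<^sub>k\<^sub>N\<close> is semidefinite.  For the form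
  \<open>Q\<close> of \<open>-\<Lambda>\<^sub>l\<close> the operator \<open>T = I - s\<^sub>k\<^sub>N\<close> is symmetric, and it is a contraction by \<open>1/3\<close> in the norm of
  \<open>H\<^sub>h\<close>, so \<open>Q(T x, x) \<le> Q(x, x)\<close>.
\<close>

lemma nLam_sH_nonneg: assumes x: "x \<in> V" shows "0 \<le> ip (nLam l x) (sH k x)"
proof -
  define Q where "Q = (\<lambda>x y. ip (nLam l (Z x)) y)"
  define T where "T = (\<lambda>w. c12 k *\<^sub>R nLam k (Z w))"
  have Q: "psd_form Q" unfolding Q_def by (rule psd_form_nLam)
  have T_V: "T w \<in> V" for w by (simp add: T_def Hh_closed)
  have Ti_V: "(T ^^ i) x \<in> V" for i by (cases i) (simp_all add: x T_V)
  have T_le: "ip (T w) (T w) \<le> 1 / 9 * ip w w" if "w \<in> V" for w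
  proof -
    have "ip (T w) (T w) = (c12 k)\<^sup>2 * ip (nLam k w) (nLam k w)"
      by (simp add: T_def ip_linear zero_ext_id that power2_eq_square)
    also have "\<dots> \<le> (c12 k)\<^sup>2 * ((4 / (h $ k)\<^sup>2)\<^sup>2 * ip w w)"
      by (intro mult_left_mono nLam_norm_le that) simp
    also have "\<dots> = 1 / 9 * ip w w"
      by (simp add: c12_def power_divide)
    finally show ?thesis .
  qed
  have Ti_le: "ip ((T ^^ i) x) ((T ^^ i) x) \<le> (1 / 9) ^ i * ip x x" for i
  proof (induction i)
    case (Suc i)
    then show ?case using T_le[OF Ti_V[of i]] by simp
  qed simp
  have "Q (T x) x \<le> Q x x"
  proof (rule symmetrized_contraction[OF Q])
    fix v w
    have "ip (nLam l (nLam k (Z v))) (Z w) = ip (nLam k (nLam l (Z v))) (Z w)" by (simp only: nLam_commute zero_ext_in_Hh)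
    also have "\<dots> = ip (nLam l (Z v)) (nLam k (Z w))" by (rule nLam_sym) simp_all
    finally show "Q (T v) w = Q v (T w)"
      by (simp add: Q_def T_def ip_linear zero_ext_id Hh_closed nLam_linear)
  next
    have "(\<lambda>i. 4 / (h $ l)\<^sup>2 * ((1 / 9) ^ i * ip x x)) \<longlonglongrightarrow> 4 / (h $ l)\<^sup>2 * (0 * ip x x)"
      by (intro tendsto_intros LIMSEQ_power_zero) simp
    then have lim: "(\<lambda>i. 4 / (h $ l)\<^sup>2 * ((1 / 9) ^ i * ip x x)) \<longlonglongrightarrow> 0" by simp
    have Q_le: "Q ((T ^^ i) x) ((T ^^ i) x) \<le> 4 / (h $ l)\<^sup>2 * ((1 / 9) ^ i * ip x x)" for i
      using nLam_le[OF Ti_V[of i], of l] mult_left_mono[OF Ti_le[of i], of "4 / (h $ l)\<^sup>2"]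
      by (simp add: Q_def zero_ext_id Ti_V)
    show "(\<lambda>i. Q ((T ^^ i) x) ((T ^^ i) x)) \<longlonglongrightarrow> 0"
      by (rule tendsto_sandwich[OF _ _ tendsto_const lim])
        (use Q_le psd_form_nonneg[OF Q] in \<open>auto intro!: always_eventually\<close>)
  qed
  then have "Q x (T x) \<le> Q x x" using psd_form_sym[OF Q] by metis
  then show ?thesis by (simp add: Q_def T_def sH_eq x zero_ext_id ip_linear)
qed

lemma sHinv_nLam_nonneg: assumes "y \<in> V" shows "0 \<le> ip (sHinv k y) (nLam l y)"
proof -
  have "0 \<le> ip (nLam l (sHinv k y)) (sH k (sHinv k y))" by (rule nLam_sH_nonneg) simp
  also have "\<dots> = ip (sHinv k y) (nLam l y)"
    using nLam_sym[of "sHinv k y" y l] assms by (simp add: sH_sHinv)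
  finally show ?thesis .
qed

lemma sHinv_nLam_sym:
  assumes "v \<in> V" "w \<in> V"
  shows "ip (sHinv k (nLam k v)) w = ip v (sHinv k (nLam k w))"
proof -
  have "ip (sHinv k (nLam k v)) w = ip (nLam k v) (sHinv k w)" by (rule sHinv_sym)
  also have "\<dots> = ip v (nLam k (sHinv k w))" by (rule nLam_sym) (simp_all add: assms)
  finally show ?thesis using assms by (simp add: sHinv_nLam_commute)
qed

lemma nLam_le_sHinv_nLam: assumes "w \<in> V" shows "ip (nLam k w) w \<le> ip (sHinv k (nLam k w)) w"
proof -
  have "ip (sHinv k (nLam k w)) w = ip (nLam k w) w + c12 k * ip (nLam k (sHinv k (nLam k w))) w"
    by (subst sHinv_nLam_expand[OF assms]) (simp add: ip_linear)
  also have "ip (nLam k (sHinv k (nLam k w))) w = ip (sHinv k (nLam k w)) (nLam k w)"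
    by (rule nLam_sym) (simp_all add: assms)
  finally show ?thesis using mult_nonneg_nonneg[OF c12_nonneg sHinv_nonneg, of k k "nLam k w"] by simp
qed

text \<open>
  The difference of the two sides is a multiple of \<open>(s\<^sub>k\<^sub>N\<^sup>-\<^sup>1 y, -\<Lambda>\<^sub>l y)\<close> for \<open>y = -\<Lambda>\<^sub>k w\<close>, by commutation.
\<close>

lemma nLam_nLam_le_sHinv_nLam_nLam: assumes "w \<in> V" shows "ip (nLam k w) (nLam l w) \<le> ip (sHinv k (nLam k w)) (nLam l w)"
proof -
  have "ip (sHinv k (nLam k w)) (nLam l w) = ip (nLam k w) (nLam l w) + c12 k * ip (nLam k (sHinv k (nLam k w))) (nLam l w)"
    by (subst sHinv_nLam_expand[OF assms]) (simp add: ip_linear)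
  also have "ip (nLam k (sHinv k (nLam k w))) (nLam l w) = ip (sHinv k (nLam k w)) (nLam k (nLam l w))"
    by (rule nLam_sym) simp_all
  also have "\<dots> = ip (sHinv k (nLam k w)) (nLam l (nLam k w))" by (simp only: nLam_commute[OF assms])
  finally show ?thesis using mult_nonneg_nonneg[OF c12_nonneg sHinv_nLam_nonneg[of "nLam k w" k l], of k] by simp
qed

text \<open>
  The operator \<open>-L\<^sub>h\<close> in \<open>H\<^sub>h\<close>.
\<close>

definition nLh :: "real ^ 'n \<Rightarrow> (real ^ 'n \<Rightarrow> real) \<Rightarrow> real ^ 'n \<Rightarrow> real" where
  "nLh a w = (\<Sum>k\<in>UNIV. (a $ k)\<^sup>2 *\<^sub>R nLam k w)"

lemma zero_ext_Lh: "Z (Lh a h w) = - nLh a w"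
  by (auto simp: nLh_def Lh_def nLam_def zero_ext_def fun_eq_iff sum_negf)

lemma linear_nLh: "linear (nLh a)"
proof (rule linearI)
  show "nLh a (v + w) = nLh a v + nLh a w" for v w
    by (simp add: nLh_def nLam_linear scaleR_add_right sum.distrib)
  show "nLh a (c *\<^sub>R w) = c *\<^sub>R nLh a w" for c w
    by (simp add: nLh_def nLam_linear scaleR_sum_right mult.commute)
qed

lemma nLh_in_Hh [simp]: "nLh a w \<in> V"
  unfolding nLh_def by (intro subspace_sum subspace_Hh Hh_closed nLam_in_Hh)

lemma nLh_sym: "v \<in> V \<Longrightarrow> w \<in> V \<Longrightarrow> ip (nLh a v) w = ip v (nLh a w)"
  by (simp add: nLh_def ip_sum ip_linear nLam_sym)

lemma nLh_nonneg: "v \<in> V \<Longrightarrow> 0 \<le> ip (nLh a v) v"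
  by (auto simp: nLh_def ip_sum ip_linear intro!: sum_nonneg mult_nonneg_nonneg nLam_nonneg)

lemma nLh_le: assumes "v \<in> V" shows "ip (nLh a v) v \<le> (4 * (\<Sum>k\<in>UNIV. (a $ k)\<^sup>2 / (h $ k)\<^sup>2)) * ip v v"
proof -
  have "ip (nLh a v) v = (\<Sum>k\<in>UNIV. (a $ k)\<^sup>2 * ip (nLam k v) v)" by (simp add: nLh_def ip_sum ip_linear)
  also have "\<dots> \<le> (\<Sum>k\<in>UNIV. (a $ k)\<^sup>2 * (4 / (h $ k)\<^sup>2 * ip v v))"
    by (intro sum_mono mult_left_mono nLam_le assms) simp
  also have "\<dots> = (4 * (\<Sum>k\<in>UNIV. (a $ k)\<^sup>2 / (h $ k)\<^sup>2)) * ip v v"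
    by (simp add: sum_distrib_left sum_distrib_right mult_ac)
  finally show ?thesis .
qed

lemma psd_form_nLh: "psd_form (\<lambda>x y. ip (nLh a (Z x)) y)"
  by (rule psd_form_operator[OF linear_nLh nLh_sym nLh_nonneg])

lemma norm_nLh_le: "w \<in> V \<Longrightarrow> ip (nLh a w) (nLh a w) \<le> (4 * (\<Sum>k\<in>UNIV. (a $ k)\<^sup>2 / (h $ k)\<^sup>2)) * ip (nLh a w) w"
  by (rule norm_operator_le[OF psd_form_nLh _ nLh_le])

lemma Eh_eq: "Eh a N h w = (\<Sum>k\<in>UNIV. (a $ k)\<^sup>2 *\<^sub>R sHinv k (nLam k w))"
  by (simp add: Eh_def fun_eq_iff nLam_def linear_neg[OF linear_sHinv] sum_negf)
    (simp add: sHinv_eq zero_ext_id)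

lemma linear_Eh: "linear (Eh a N h)"
proof (rule linearI)
  show "Eh a N h (v + w) = Eh a N h v + Eh a N h w" for v w
    by (simp add: Eh_eq nLam_linear linear_add[OF linear_sHinv] scaleR_add_right sum.distrib)
  show "Eh a N h (c *\<^sub>R w) = c *\<^sub>R Eh a N h w" for c w
    by (simp add: Eh_eq nLam_linear linear_scale[OF linear_sHinv] scaleR_sum_right mult.commute)
qed

lemma Eh_in_Hh [simp]: "Eh a N h w \<in> V"
  unfolding Eh_eq by (intro subspace_sum subspace_Hh Hh_closed sHinv_in_Hh)

lemma Eh_sym: "v \<in> V \<Longrightarrow> w \<in> V \<Longrightarrow> ip (Eh a N h v) w = ip v (Eh a N h w)"
  by (simp add: Eh_eq ip_sum ip_linear sHinv_nLam_sym)

lemma nLh_le_Eh: "w \<in> V \<Longrightarrow> ip (nLh a w) w \<le> ip (Eh a N h w) w"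
  by (auto simp: Eh_eq nLh_def ip_sum ip_linear intro!: sum_mono mult_left_mono nLam_le_sHinv_nLam)

lemma Eh_nonneg: "w \<in> V \<Longrightarrow> 0 \<le> ip (Eh a N h w) w"
  using nLh_le_Eh[of w a] nLh_nonneg[of w a] by simp

lemma psd_form_Eh: "psd_form (\<lambda>x y. ip (Eh a N h (Z x)) y)"
  by (rule psd_form_operator[OF linear_Eh Eh_sym Eh_nonneg])

lemma nLh_nLh_le_Eh_nLh: "w \<in> V \<Longrightarrow> ip (nLh a w) (nLh a w) \<le> ip (Eh a N h w) (nLh a w)"
  by (auto simp: Eh_eq nLh_def ip_sum ip_linear intro!: sum_mono mult_left_mono nLam_nLam_le_sHinv_nLam_nLam)

text \<open>
  A bound for \<open>E\<^sub>h w\<close> in the dual norm suffices, since \<open>nLh_nLh_le_Eh_nLh\<close> tests \<open>E\<^sub>h w\<close> with \<open>-L\<^sub>h w\<close>.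
\<close>

lemma norm_nLh_le_Eh:
  assumes w: "w \<in> V" and r: "0 \<le> r" and sH: "\<And>y. ip (Eh a N h w) y \<le> r * sqrt (ip y y)"
  shows "sqrt (ip (nLh a w) (nLh a w)) \<le> r"
proof (cases "ip (nLh a w) (nLh a w) = 0")
  case True
  then show ?thesis using r by simp
next
  case False
  let ?n = "sqrt (ip (nLh a w) (nLh a w))"
  have pos: "0 < ?n" using False ip_nonneg[of "nLh a w"] by simp
  have "?n * ?n \<le> r * ?n" using nLh_nLh_le_Eh_nLh[OF w, of a] sH[of "nLh a w"] ip_nonneg[of "nLh a w"] by simp
  then show ?thesis using pos by (rule mult_right_le_imp_le)
qed

end

section \<open>Stability of the scheme\<close>

text \<open>
  The summands belong to the three terms of the error: the time difference, the energy norm, and the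
  sum over the time levels, where the last product stems from the final level.
\<close>

definition stability_const :: "real \<Rightarrow> real \<Rightarrow> real \<Rightarrow> real" where
  "stability_const lo hi T = ((3 * T + 1) / sqrt lo + 2 * (3 * T + 1)
     + (hi / sqrt lo * (2 * T + 2 * (3 * T + 1)) + sqrt (12 * lo) * (2 * (3 * T + 1)))) / sqrt lo"

locale stable_scheme = mesh_space N h for N :: "'n::finite \<Rightarrow> nat" and h :: "real ^ 'n" +
  fixes a :: "real ^ 'n" and \<rho> :: "real ^ 'n \<Rightarrow> real" and \<tau> \<epsilon> \<epsilon>\<^sub>0 lo hi :: real
  assumes lo_pos: "0 < lo" and rho_ge: "x \<in> S \<Longrightarrow> lo \<le> \<rho> x" and rho_le: "x \<in> S \<Longrightarrow> \<rho> x \<le> hi"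
    and lo_hi: "lo \<le> hi" and \<tau>_pos: "0 < \<tau>" and eps: "0 < \<epsilon>" "\<epsilon> < 1" and eps0: "0 < \<epsilon>\<^sub>0" "\<epsilon>\<^sub>0 < 1"
    and cfl: "1 / 3 * \<tau>\<^sup>2 * (\<Sum>k\<in>UNIV. (a $ k)\<^sup>2 / (h $ k)\<^sup>2) \<le> (1 - \<epsilon>) * lo"
    and Eh_le: "w \<in> V \<Longrightarrow> \<tau>\<^sup>2 / 4 * ip (Eh a N h w) w \<le> (1 - \<epsilon>\<^sub>0\<^sup>2) * lo * ip w w"
begin

lemma rho_pos: "x \<in> S \<Longrightarrow> 0 < \<rho> x"
  using rho_ge lo_pos by fastforce

lemma ip_rho_sym: "ip (\<rho> * v) w = ip v (\<rho> * w)"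
  by (rule ip_cong) simp

lemma ip_rho_ge: "lo * ip w w \<le> ip (\<rho> * w) w"
proof -
  have "ip (lo *\<^sub>R w) w \<le> ip (\<rho> * w) w"
    by (rule ip_mono) (use mult_right_mono[OF rho_ge zero_le_square] in \<open>simp add: mult.assoc\<close>)
  then show ?thesis by (simp add: ip_linear)
qed

lemma ip_rho_rho_le: "ip (\<rho> * w) (\<rho> * w) \<le> hi\<^sup>2 * ip w w"
proof -
  have "ip (\<rho> * w) (\<rho> * w) \<le> ip (hi *\<^sub>R w) (hi *\<^sub>R w)"
  proof (rule ip_mono)
    fix x assume x: "x \<in> S"
    have "(\<rho> x)\<^sup>2 * (w x)\<^sup>2 \<le> hi\<^sup>2 * (w x)\<^sup>2"
      using rho_le[OF x] rho_pos[OF x] by (intro mult_right_mono power_mono) auto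
    then show "(\<rho> * w) x * (\<rho> * w) x \<le> (hi *\<^sub>R w) x * (hi *\<^sub>R w) x"
      by (simp add: power2_eq_square mult_ac)
  qed
  then show ?thesis by (simp add: ip_linear power2_eq_square)
qed

text \<open>
  The operator \<open>\<rho> I + h\<^sub>t\<^sup>2/12 L\<^sub>h\<close> in \<open>H\<^sub>h\<close>.
\<close>

definition Bop :: "(real ^ 'n \<Rightarrow> real) \<Rightarrow> real ^ 'n \<Rightarrow> real" where
  "Bop w = Z (\<rho> * w) - (\<tau>\<^sup>2 / 12) *\<^sub>R nLh a w"

lemma linear_Bop: "linear Bop"
proof (rule linearI)
  show "Bop (v + w) = Bop v + Bop w" for v w
    by (simp add: Bop_def distrib_left linear_add[OF linear_zero_ext] linear_add[OF linear_nLh] scaleR_add_right)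
  show "Bop (c *\<^sub>R w) = c *\<^sub>R Bop w" for c w
  proof -
    have "\<rho> * (c *\<^sub>R w) = c *\<^sub>R (\<rho> * w)" by (simp add: fun_eq_iff)
    then show ?thesis
      by (simp add: Bop_def linear_scale[OF linear_zero_ext] linear_scale[OF linear_nLh] scaleR_diff_right mult.commute)
  qed
qed

lemma Bop_in_Hh: "Bop w \<in> V"
  unfolding Bop_def by (intro Hh_closed zero_ext_in_Hh nLh_in_Hh)

lemma ip_Bop: "ip (Bop v) w = ip (\<rho> * v) w - \<tau>\<^sup>2 / 12 * ip (nLh a v) w"
  by (simp add: Bop_def ip_linear)

lemma Bop_sym: "v \<in> V \<Longrightarrow> w \<in> V \<Longrightarrow> ip (Bop v) w = ip v (Bop w)"
  using nLh_sym[of v w a] ip_rho_sym[of v w] by (simp add: ip_Bop ip_sym[of v "Bop w"]) (simp add: ip_sym)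

lemma Bop_le: "w \<in> V \<Longrightarrow> ip (Bop w) w \<le> ip (\<rho> * w) w"
  using nLh_nonneg[of w a] by (simp add: ip_Bop)

text \<open>
  Since \<open>-L\<^sub>h\<close> is at most four times the sum of the \<open>a\<^sub>k\<^sup>2/h\<^sub>k\<^sup>2\<close>, this is the first stability
  condition.
\<close>

lemma Bop_ge: assumes "w \<in> V" shows "\<epsilon> * lo * ip w w \<le> ip (Bop w) w"
proof -
  have "\<tau>\<^sup>2 / 12 * ip (nLh a w) w \<le> \<tau>\<^sup>2 / 12 * (4 * (\<Sum>k\<in>UNIV. (a $ k)\<^sup>2 / (h $ k)\<^sup>2) * ip w w)"
    by (intro mult_left_mono nLh_le assms) simp
  also have "\<dots> = 1 / 3 * \<tau>\<^sup>2 * (\<Sum>k\<in>UNIV. (a $ k)\<^sup>2 / (h $ k)\<^sup>2) * ip w w" by simp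
  also have "\<dots> \<le> (1 - \<epsilon>) * lo * ip w w" by (intro mult_right_mono cfl ip_nonneg)
  finally show ?thesis using ip_rho_ge[of w] by (simp add: ip_Bop algebra_simps)
qed

lemma coercive_Bop: "coercive_operator N h Bop (\<epsilon> * lo)"
  by (intro coercive_operator.intro coercive_operator_axioms.intro mesh_space_axioms
      linear_Bop Bop_in_Hh Bop_sym Bop_ge) (simp_all add: eps lo_pos)

definition Binv :: "(real ^ 'n \<Rightarrow> real) \<Rightarrow> real ^ 'n \<Rightarrow> real" where
  "Binv = inv_on Bop"

lemmas linear_Binv = coercive_operator.linear_inv[OF coercive_Bop, folded Binv_def]
lemmas Binv_in_Hh = coercive_operator.inv_in_Hh[OF coercive_Bop, folded Binv_def]
lemmas Bop_Binv = coercive_operator.L_inv[OF coercive_Bop, folded Binv_def]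
lemmas Binv_Bop = coercive_operator.inv_L[OF coercive_Bop, folded Binv_def]
lemmas Binv_sym = coercive_operator.inv_sym[OF coercive_Bop, folded Binv_def]
lemmas Binv_nonneg = coercive_operator.inv_nonneg[OF coercive_Bop, folded Binv_def]
lemmas Binv_coercive = coercive_operator.inv_coercive[OF coercive_Bop, folded Binv_def]
lemmas Binv_form_le = coercive_operator.inv_form_le[OF coercive_Bop, folded Binv_def]

lemma Binv_cong: "Z v = Z w \<Longrightarrow> Binv v = Binv w"
  by (simp add: Binv_def inv_on_def)

text \<open>
  The form of \<open>\<rho> B\<^sup>-\<^sup>1 \<rho>\<close>.
\<close>

definition D :: "(real ^ 'n \<Rightarrow> real) \<Rightarrow> (real ^ 'n \<Rightarrow> real) \<Rightarrow> real" where
  "D x y = ip (Binv (\<rho> * x)) (\<rho> * y)"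

definition E :: "(real ^ 'n \<Rightarrow> real) \<Rightarrow> (real ^ 'n \<Rightarrow> real) \<Rightarrow> real" where
  "E x y = ip (Eh a N h (Z x)) y"

lemma psd_form_D: "psd_form D"
  unfolding psd_form_def
proof (intro conjI allI)
  fix y show "linear (\<lambda>x. D x y)"
  proof (rule linearI)
    show "D (v + w) y = D v y + D w y" for v w
      by (simp add: D_def distrib_left linear_add[OF linear_Binv] ip_linear)
    show "D (c *\<^sub>R w) y = c *\<^sub>R D w y" for c w
    proof -
      have "\<rho> * (c *\<^sub>R w) = c *\<^sub>R (\<rho> * w)" by (simp add: fun_eq_iff)
      then show ?thesis by (simp add: D_def linear_scale[OF linear_Binv] ip_linear)
    qed
  qed
next
  fix x y show "D x y = D y x"
    using Binv_sym[of "\<rho> * x" "\<rho> * y"] by (simp add: D_def ip_sym[of "\<rho> * x"])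
next
  fix x show "0 \<le> D x x" unfolding D_def by (rule Binv_nonneg)
qed

lemma psd_form_E: "psd_form E"
  unfolding E_def[abs_def] by (rule psd_form_Eh)

text \<open>
  The inequality \<open>B \<le> \<rho>\<close> is inverted by the Cauchy inequality for the form of \<open>B\<close>: with
  \<open>B z = \<rho> x\<close>, the number \<open>(\<rho> x, x) = (B z, x)\<close> is at most the geometric mean of \<open>(B z, z) = D(x, x)\<close>
  and \<open>(B x, x) \<le> (\<rho> x, x)\<close>.
\<close>

lemma D_ge: "lo * ip x x \<le> D x x"
proof -
  define z where "z = Binv (\<rho> * x)"
  define t where "t = ip (\<rho> * x) x"
  have z: "z \<in> V" by (simp add: z_def Binv_in_Hh)
  have t: "0 \<le> t" using ip_rho_ge[of x] ip_nonneg[of x] lo_pos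
    by (simp add: t_def) (meson mult_nonneg_nonneg less_imp_le order_trans)
  have B: "psd_form (\<lambda>x y. ip (Bop (Z x)) y)"
    by (rule psd_form_operator[OF linear_Bop Bop_sym])
      (use Bop_ge ip_nonneg eps lo_pos in \<open>meson mult_nonneg_nonneg less_imp_le order_trans\<close>)+
  have "t = ip (Bop (Z z)) x" by (simp add: t_def z_def zero_ext_id Binv_in_Hh Bop_Binv)
  also have "\<dots> \<le> sqrt (ip (Bop (Z z)) z) * sqrt (ip (Bop (Z x)) x)"
    by (rule psd_form_Cauchy[OF B])
  also have "ip (Bop (Z z)) z = D x x"
    by (simp add: z_def zero_ext_id Binv_in_Hh Bop_Binv D_def ip_sym)
  also have "ip (Bop (Z x)) x \<le> t"
  proof -
    have "ip (Bop (Z x)) (Z x) \<le> ip (\<rho> * Z x) (Z x)" by (rule Bop_le) simp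
    also have "\<dots> = t" unfolding t_def by (rule ip_cong) (simp add: zero_ext_def)
    finally show ?thesis by simp
  qed
  then have "sqrt (D x x) * sqrt (ip (Bop (Z x)) x) \<le> sqrt (D x x) * sqrt t"
    using psd_form_nonneg[OF psd_form_D] by (intro mult_left_mono) auto
  finally have *: "t \<le> sqrt (D x x) * sqrt t" .
  have "t \<le> D x x"
  proof (cases "t = 0")
    case False
    with t have pos: "0 < sqrt t" by simp
    have "sqrt t * sqrt t \<le> sqrt (D x x) * sqrt t" using * t by simp
    then have "sqrt t \<le> sqrt (D x x)" using pos by (rule mult_right_le_imp_le)
    then show ?thesis by simp
  qed (simp add: psd_form_nonneg[OF psd_form_D])
  then show ?thesis using ip_rho_ge[of x] by (simp add: t_def)
qed

lemma norm_le_D: "sqrt lo * sqrt (ip x x) \<le> sqrt (D x x)"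
  using D_ge[of x] by (simp flip: real_sqrt_mult)

lemma D_le: "D x y \<le> hi / sqrt (\<epsilon> * lo) * sqrt (D x x) * sqrt (ip y y)"
proof -
  define z where "z = Binv (\<rho> * x)"
  have pos: "0 < sqrt (\<epsilon> * lo)" using eps lo_pos by simp
  have "sqrt (\<epsilon> * lo) * sqrt (ip z z) \<le> sqrt (D x x)"
    using Binv_coercive[of "\<rho> * x"] by (simp add: z_def D_def flip: real_sqrt_mult)
  then have z: "sqrt (ip z z) \<le> sqrt (D x x) / sqrt (\<epsilon> * lo)"
    using pos by (simp add: field_simps)
  have "D x y = ip (\<rho> * z) y" by (simp add: D_def z_def ip_rho_sym)
  also have "\<dots> \<le> sqrt (ip (\<rho> * z) (\<rho> * z)) * sqrt (ip y y)" by (rule ip_Cauchy)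
  also have "sqrt (ip (\<rho> * z) (\<rho> * z)) \<le> hi * sqrt (ip z z)"
    using real_sqrt_le_mono[OF ip_rho_rho_le[of z]] lo_pos lo_hi by (simp add: real_sqrt_mult)
  also have "\<dots> \<le> hi * (sqrt (D x x) / sqrt (\<epsilon> * lo))"
    using z lo_pos lo_hi by (intro mult_left_mono) auto
  finally have "D x y \<le> hi * (sqrt (D x x) / sqrt (\<epsilon> * lo)) * sqrt (ip y y)"
    by (simp add: mult_right_mono ip_nonneg)
  then show ?thesis by simp
qed

text \<open>
  The second stability condition, sharpened by \<open>D_ge\<close>.
\<close>

lemma E_le_D: "\<tau>\<^sup>2 / 4 * E x x \<le> (1 - \<epsilon>\<^sub>0\<^sup>2) * D x x"
proof -
  have "\<tau>\<^sup>2 / 4 * E x x = \<tau>\<^sup>2 / 4 * ip (Eh a N h (Z x)) (Z x)" by (simp add: E_def)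
  also have "\<dots> \<le> (1 - \<epsilon>\<^sub>0\<^sup>2) * lo * ip (Z x) (Z x)" by (rule Eh_le) simp
  also have "\<dots> = (1 - \<epsilon>\<^sub>0\<^sup>2) * (lo * ip x x)" by simp
  also have "\<dots> \<le> (1 - \<epsilon>\<^sub>0\<^sup>2) * D x x"
    using eps0 by (intro mult_left_mono D_ge) (simp add: power_le_one)
  finally show ?thesis .
qed

lemma E_le_D': "\<tau>\<^sup>2 / 4 * E x x \<le> D x x"
proof -
  have "0 \<le> \<epsilon>\<^sub>0\<^sup>2 * D x x" using psd_form_nonneg[OF psd_form_D] by simp
  then show ?thesis using E_le_D[of x] by (simp add: algebra_simps)
qed

lemma rho_op_eq: "p \<in> V \<Longrightarrow> x \<in> S \<Longrightarrow> rho_op \<rho> a h \<tau> p x = Bop (\<lambda>x. p x / \<rho> x) x"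
  using rho_pos[of x] zero_ext_Lh[of a "\<lambda>x. p x / \<rho> x", THEN fun_cong, of x]
  by (simp add: rho_op_def Bop_def zero_ext_def)

text \<open>
  Multiplication of an equation of the scheme by \<open>\<rho> B\<^sup>-\<^sup>1\<close>, which turns \<open>B (p / \<rho>)\<close> into \<open>p\<close>.
\<close>

lemma D_equation:
  assumes p: "p \<in> V"
    and eq: "\<And>x. x \<in> S \<Longrightarrow> \<rho> x * v x = \<alpha> * rho_op \<rho> a h \<tau> p x + \<beta> * r x"
  shows "D v z = \<alpha> * ip p z + \<beta> * D (\<lambda>x. r x / \<rho> x) z"
proof -
  let ?q = "\<lambda>x. p x / \<rho> x"
  have q: "?q \<in> V" using p by (simp add: Hh_def)
  have "Binv (\<rho> * v) = Binv (\<alpha> *\<^sub>R Bop ?q + \<beta> *\<^sub>R (\<rho> * (\<lambda>x. r x / \<rho> x)))"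
    by (rule Binv_cong)
      (use rho_pos in \<open>force simp: fun_eq_iff zero_ext_def eq rho_op_eq[OF p]\<close>)
  then have "Binv (\<rho> * v) = \<alpha> *\<^sub>R ?q + \<beta> *\<^sub>R Binv (\<rho> * (\<lambda>x. r x / \<rho> x))"
    by (simp add: linear_add[OF linear_Binv] linear_scale[OF linear_Binv] Binv_Bop[OF q])
  then have "D v z = \<alpha> * ip ?q (\<rho> * z) + \<beta> * D (\<lambda>x. r x / \<rho> x) z"
    by (simp add: D_def ip_linear)
  also have "ip ?q (\<rho> * z) = ip p z"
    by (rule ip_cong) (use rho_pos in force)
  finally show ?thesis .
qed

text \<open>
  The square root of \<open>\<epsilon>\<close> is lost only in the part with \<open>r\<close>, where the squared \<open>D\<close>-norm of \<open>r / \<rho>\<close> is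
  \<open>(B\<^sup>-\<^sup>1 r, r)\<close>.
\<close>

lemma sqrt_D_le:
  assumes p: "p \<in> V" and \<alpha>: "0 \<le> \<alpha>" and \<beta>: "0 \<le> \<beta>"
    and eq: "\<And>x. x \<in> S \<Longrightarrow> \<rho> x * v x = \<alpha> * rho_op \<rho> a h \<tau> p x + \<beta> * r x"
    and p_le: "sqrt (ip p p) \<le> \<eta>" and r_le: "sqrt (ip r r) \<le> \<eta>"
  shows "sqrt \<epsilon> * sqrt (D v v) \<le> (\<alpha> + \<beta>) * (\<eta> / sqrt lo)"
proof (cases "D v v = 0")
  case True
  have "0 \<le> \<eta>" using p_le ip_nonneg[of p] by (meson order_trans real_sqrt_ge_zero)
  then show ?thesis using True \<alpha> \<beta> lo_pos by simp
next
  case False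
  let ?d = "sqrt (D v v)" and ?s = "\<lambda>x. r x / \<rho> x"
  have pos: "0 < ?d" using False psd_form_nonneg[OF psd_form_D, of v] by simp
  have \<eta>: "0 \<le> \<eta>" using p_le ip_nonneg[of p] by (meson order_trans real_sqrt_ge_zero)
  have lo: "0 < sqrt lo" using lo_pos by simp
  have v: "sqrt (ip v v) \<le> ?d / sqrt lo" using norm_le_D[of v] lo by (simp add: field_simps)
  have 1: "ip p v \<le> \<eta> / sqrt lo * ?d"
  proof -
    have "ip p v \<le> sqrt (ip p p) * sqrt (ip v v)" by (rule ip_Cauchy)
    also have "\<dots> \<le> \<eta> * (?d / sqrt lo)"
      using p_le v \<eta> by (intro mult_mono) (auto simp: ip_nonneg)
    finally show ?thesis by simp
  qed
  have 2: "sqrt \<epsilon> * D ?s v \<le> \<eta> / sqrt lo * ?d"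
  proof -
    have Z: "Z (\<rho> * ?s) = Z r" using rho_pos by (force simp: zero_ext_def fun_eq_iff)
    have "D ?s ?s = ip (Binv r) (\<rho> * ?s)" unfolding D_def using Binv_cong[OF Z] by simp
    also have "\<dots> = ip (Binv r) r" by (rule ip_cong) (use rho_pos in force)
    finally have "\<epsilon> * lo * D ?s ?s \<le> ip r r" using Binv_form_le[of r] by simp
    then have "sqrt (\<epsilon> * lo * D ?s ?s) \<le> \<eta>" using r_le real_sqrt_le_mono order_trans by blast
    then have s: "sqrt \<epsilon> * sqrt (D ?s ?s) \<le> \<eta> / sqrt lo"
      using lo by (simp add: real_sqrt_mult field_simps)
    have "sqrt \<epsilon> * D ?s v \<le> sqrt \<epsilon> * (sqrt (D ?s ?s) * ?d)"
      using eps by (intro mult_left_mono psd_form_Cauchy[OF psd_form_D]) auto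
    also have "\<dots> = (sqrt \<epsilon> * sqrt (D ?s ?s)) * ?d" by simp
    also have "\<dots> \<le> \<eta> / sqrt lo * ?d" using s pos by (intro mult_right_mono) auto
    finally show ?thesis .
  qed
  have e1: "sqrt \<epsilon> \<le> 1" using eps by simp
  have D_v: "D v v = \<alpha> * ip p v + \<beta> * D ?s v" by (rule D_equation[OF p eq])
  have "?d * (sqrt \<epsilon> * ?d) = sqrt \<epsilon> * D v v" using pos by simp
  also have "\<dots> = \<alpha> * (sqrt \<epsilon> * ip p v) + \<beta> * (sqrt \<epsilon> * D ?s v)"
    by (subst D_v) (simp add: algebra_simps)
  also have "\<dots> \<le> \<alpha> * (\<eta> / sqrt lo * ?d) + \<beta> * (\<eta> / sqrt lo * ?d)"
  proof (intro add_mono mult_left_mono \<alpha> \<beta> 2)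
    have "sqrt \<epsilon> * ip p v \<le> sqrt \<epsilon> * (\<eta> / sqrt lo * ?d)" using 1 eps by (intro mult_left_mono) auto
    also have "\<dots> \<le> 1 * (\<eta> / sqrt lo * ?d)"
      using e1 \<eta> lo pos by (intro mult_right_mono) auto
    finally show "sqrt \<epsilon> * ip p v \<le> \<eta> / sqrt lo * ?d" by simp
  qed
  also have "\<dots> = ?d * ((\<alpha> + \<beta>) * (\<eta> / sqrt lo))" by (simp add: algebra_simps add_divide_distrib)
  finally show ?thesis using pos by (simp only: mult_le_cancel_left_pos)
qed

text \<open>
  An inverse inequality: by the first stability condition \<open>h\<^sub>t\<^sup>2 (-L\<^sub>h) \<le> 12 \<rho>_lo I\<close>.
\<close>

lemma tau_norm_nLh_le:
  assumes "w \<in> V"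
  shows "\<tau> * sqrt (ip (nLh a w) (nLh a w)) \<le> sqrt (12 * lo) * sqrt (ip (nLh a w) w)"
proof -
  let ?\<mu> = "4 * (\<Sum>k\<in>UNIV. (a $ k)\<^sup>2 / (h $ k)\<^sup>2)"
  have "\<tau>\<^sup>2 * ip (nLh a w) (nLh a w) \<le> \<tau>\<^sup>2 * (?\<mu> * ip (nLh a w) w)"
    by (intro mult_left_mono norm_nLh_le assms) simp
  also have "\<dots> = 12 * (1 / 3 * \<tau>\<^sup>2 * (\<Sum>k\<in>UNIV. (a $ k)\<^sup>2 / (h $ k)\<^sup>2)) * ip (nLh a w) w" by simp
  also have "\<dots> \<le> 12 * ((1 - \<epsilon>) * lo) * ip (nLh a w) w"
    by (intro mult_right_mono mult_left_mono cfl nLh_nonneg assms) simp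
  also have "\<dots> \<le> 12 * lo * ip (nLh a w) w"
    using eps lo_pos nLh_nonneg[OF assms, of a] by (intro mult_right_mono mult_left_mono) (auto simp: mult_le_cancel_right1)
  finally have "sqrt (\<tau>\<^sup>2 * ip (nLh a w) (nLh a w)) \<le> sqrt (12 * lo * ip (nLh a w) w)"
    by (rule real_sqrt_le_mono)
  then show ?thesis using \<tau>_pos by (simp add: real_sqrt_mult)
qed

end

text \<open>
  The equations for the error after elimination of the auxiliary unknowns: \<open>y\<close> is the error,
  \<open>q\<close> the residual of the compact approximations of \<open>\<partial>\<^sub>k\<^sup>2 u\<close>, and \<open>r\<close> the residual of the main
  equation, with the residual of the first step as \<open>r 0\<close>.
\<close>

locale scheme_error = stable_scheme N h a \<rho> \<tau> \<epsilon> \<epsilon>\<^sub>0 lo hi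
  for N :: "'n::finite \<Rightarrow> nat" and h a :: "real ^ 'n" and \<rho> \<tau> \<epsilon> \<epsilon>\<^sub>0 lo hi +
  fixes M :: nat and T \<eta> :: real and y q r :: "nat \<Rightarrow> real ^ 'n \<Rightarrow> real"
  assumes M: "2 \<le> M" and T: "real M * \<tau> = T"
    and y_V: "m \<le> M \<Longrightarrow> y m \<in> V" and q_V: "m < M \<Longrightarrow> q m \<in> V" and y_0: "y 0 = 0"
    and step: "1 \<le> m \<Longrightarrow> m < M \<Longrightarrow> x \<in> S \<Longrightarrow>
      \<rho> x * (y (m + 1) x - 2 * y m x + y (m - 1) x) / \<tau>\<^sup>2
        = rho_op \<rho> a h \<tau> (q m - Eh a N h (y m)) x + r m x"
    and first: "x \<in> S \<Longrightarrow> \<rho> x * (y 1 x - y 0 x) / \<tau>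
        = \<tau> / 2 * rho_op \<rho> a h \<tau> (q 0 - Eh a N h (y 0)) x + r 0 x"
    and q_le: "m < M \<Longrightarrow> sqrt (ip (q m) (q m)) \<le> \<eta>"
    and r_le: "m < M \<Longrightarrow> sqrt (ip (r m) (r m)) \<le> \<eta>"
begin

text \<open>
  The source of the symmetric equation, \<open>D\<^sup>-\<^sup>1\<close> applied to \<open>q + \<rho> B\<^sup>-\<^sup>1 r\<close>.
\<close>

definition G :: "nat \<Rightarrow> real ^ 'n \<Rightarrow> real" where
  "G m = (\<lambda>x. (rho_op \<rho> a h \<tau> (q m) x + r m x) / \<rho> x)"

definition b :: "nat \<Rightarrow> real ^ 'n \<Rightarrow> real" where
  "b m = (1 / \<tau>) *\<^sub>R (y m - y (m - 1))"

definition \<kappa> :: real where "\<kappa> = \<eta> / sqrt lo"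

abbreviation En :: "nat \<Rightarrow> real" where "En m \<equiv> energy D E \<tau> (y m) (y (m - 1))"

lemma \<kappa>_nonneg: "0 \<le> \<kappa>"
proof -
  have "0 \<le> \<eta>" using q_le[of 0] M ip_nonneg[of "q 0"] by (meson order_trans real_sqrt_ge_zero less_le_trans zero_less_numeral)
  then show ?thesis using lo_pos by (simp add: \<kappa>_def)
qed

lemma T_pos: "0 < T" and \<tau>_le: "\<tau> \<le> T"
  using M \<tau>_pos T by (auto simp: mult_le_cancel_right1 simp flip: T)

lemma G_equation: assumes "m < M"
  shows "D (G m) z = ip (q m) z + D (\<lambda>x. r m x / \<rho> x) z"
  using D_equation[OF q_V[OF assms], of "G m" 1 1 "r m" z] rho_pos by (force simp: G_def)

lemma sqrt_D_G: assumes "m < M" shows "sqrt \<epsilon> * sqrt (D (G m) (G m)) \<le> 2 * \<kappa>"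
  using sqrt_D_le[OF q_V[OF assms], of 1 1 "G m" "r m" \<eta>] rho_pos q_le[OF assms] r_le[OF assms]
  by (force simp: G_def \<kappa>_def)

lemma D_step:
  assumes m: "1 \<le> m" "m < M"
  shows "D (y (m + 1) - 2 *\<^sub>R y m + y (m - 1)) z + \<tau>\<^sup>2 * E (y m) z = \<tau>\<^sup>2 * D (G m) z"
proof -
  have W: "q m - Eh a N h (y m) \<in> V" by (intro Hh_closed q_V m Eh_in_Hh)
  have "D (y (m + 1) - 2 *\<^sub>R y m + y (m - 1)) z
      = \<tau>\<^sup>2 * ip (q m - Eh a N h (y m)) z + \<tau>\<^sup>2 * D (\<lambda>x. r m x / \<rho> x) z"
    using step[OF m] \<tau>_pos by (intro D_equation[OF W]) (simp add: field_simps)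
  moreover have "E (y m) z = ip (Eh a N h (y m)) z"
    using y_V[of m] m by (simp add: E_def zero_ext_id)
  ultimately show ?thesis by (simp add: G_equation m ip_linear algebra_simps)
qed

text \<open>
  Since \<open>y 0 = 0\<close>, the two occurrences of \<open>E\<close> in the first energy cancel, and it equals the squared
  \<open>D\<close>-norm of the first difference quotient, which the starting equation determines.
\<close>

lemma energy_first: "sqrt \<epsilon> * sqrt (En 1) \<le> (T + 1) * \<kappa>"
proof -
  have "Eh a N h (y 0) = 0" by (simp add: y_0 linear_0[OF linear_Eh])
  then have eq: "\<rho> x * b 1 x = \<tau> / 2 * rho_op \<rho> a h \<tau> (q 0) x + 1 * r 0 x" if "x \<in> S" for x
    using first[OF that] by (simp add: b_def)
  have "En 1 = D (y 1) (y 1) / \<tau>\<^sup>2"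
    using \<tau>_pos by (simp add: energy_def y_0 field_simps)
  also have "\<dots> = D (b 1) (b 1)"
    by (simp add: b_def y_0 psd_form_linear[OF psd_form_D] power2_eq_square)
  finally have "sqrt \<epsilon> * sqrt (En 1) = sqrt \<epsilon> * sqrt (D (b 1) (b 1))" by simp
  also have "\<dots> \<le> (\<tau> / 2 + 1) * \<kappa>"
    unfolding \<kappa>_def
    by (rule sqrt_D_le[OF q_V _ _ eq q_le r_le]) (use M \<tau>_pos in auto)
  also have "\<dots> \<le> (T + 1) * \<kappa>" using \<tau>_le \<tau>_pos by (intro mult_right_mono \<kappa>_nonneg) auto
  finally show ?thesis .
qed

lemma energy_bound: assumes "1 \<le> m" "m \<le> M" shows "sqrt \<epsilon> * sqrt (En m) \<le> (3 * T + 1) * \<kappa>"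
proof -
  have "sqrt \<epsilon> * sqrt (En m) \<le> (T + 1) * \<kappa> + real (m - 1) * \<tau> * (2 * \<kappa>)"
    using assms
  proof (induction m rule: nat_induct_at_least)
    case base then show ?case using energy_first by simp
  next
    case (Suc m)
    have "D (y (Suc m) - 2 *\<^sub>R y m + y (m - 1)) z + \<tau>\<^sup>2 * E (y m) z = \<tau>\<^sup>2 * D (G m) z" for z
      using D_step[of m z] Suc by simp
    then have "sqrt (energy D E \<tau> (y (Suc m)) (y m)) \<le> sqrt (En m) + \<tau> * sqrt (D (G m) (G m))"
      by (rule energy_step[OF psd_form_D psd_form_E E_le_D' \<tau>_pos])
    then have "sqrt (En (Suc m)) \<le> sqrt (En m) + \<tau> * sqrt (D (G m) (G m))" by simp
    then have "sqrt \<epsilon> * sqrt (En (Suc m)) \<le> sqrt \<epsilon> * (sqrt (En m) + \<tau> * sqrt (D (G m) (G m)))"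
      using eps by (intro mult_left_mono) auto
    also have "\<dots> = sqrt \<epsilon> * sqrt (En m) + \<tau> * (sqrt \<epsilon> * sqrt (D (G m) (G m)))"
      by (simp add: algebra_simps)
    also have "\<dots> \<le> ((T + 1) * \<kappa> + real (m - 1) * \<tau> * (2 * \<kappa>)) + \<tau> * (2 * \<kappa>)"
      using Suc \<tau>_pos by (intro add_mono mult_left_mono sqrt_D_G) auto
    also have "\<dots> = (T + 1) * \<kappa> + real (Suc m - 1) * \<tau> * (2 * \<kappa>)"
      using Suc.hyps by (simp add: of_nat_diff algebra_simps)
    finally show ?case .
  qed
  also have "\<dots> \<le> (T + 1) * \<kappa> + T * (2 * \<kappa>)"
    using assms \<tau>_pos \<kappa>_nonneg unfolding T[symmetric] by (intro add_left_mono mult_right_mono) auto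
  finally show ?thesis by (simp add: algebra_simps)
qed

lemma D_b_bound: assumes "1 \<le> m" "m \<le> M" shows "\<epsilon>\<^sub>0 * (sqrt \<epsilon> * sqrt (D (b m) (b m))) \<le> (3 * T + 1) * \<kappa>"
proof -
  have D_b: "D (b m) (b m) = D (y m - y (m - 1)) (y m - y (m - 1)) / \<tau>\<^sup>2"
    "E (b m) (b m) = E (y m - y (m - 1)) (y m - y (m - 1)) / \<tau>\<^sup>2"
    by (simp_all add: b_def psd_form_linear(3,6)[OF psd_form_D] psd_form_linear(3,6)[OF psd_form_E] power2_eq_square)
  have "\<epsilon>\<^sub>0\<^sup>2 * D (b m) (b m) \<le> D (b m) (b m) - \<tau>\<^sup>2 / 4 * E (b m) (b m)"
    using E_le_D[of "b m"] by (simp add: algebra_simps)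
  also have "\<dots> \<le> En m"
    using psd_form_nonneg[OF psd_form_E, of "y m + y (m - 1)"]
    by (simp add: energy_def D_b diff_divide_distrib)
  finally have "sqrt (\<epsilon>\<^sub>0\<^sup>2 * D (b m) (b m)) \<le> sqrt (En m)" by (rule real_sqrt_le_mono)
  then have "\<epsilon>\<^sub>0 * sqrt (D (b m) (b m)) \<le> sqrt (En m)" using eps0 by (simp add: real_sqrt_mult)
  then have "sqrt \<epsilon> * (\<epsilon>\<^sub>0 * sqrt (D (b m) (b m))) \<le> sqrt \<epsilon> * sqrt (En m)"
    using eps by (intro mult_left_mono) auto
  then show ?thesis using energy_bound[OF assms] by (simp add: mult_ac)
qed

lemma norm_b_bound: assumes "1 \<le> m" "m \<le> M"
  shows "\<epsilon>\<^sub>0 * (sqrt \<epsilon> * sqrt (ip (b m) (b m))) \<le> (3 * T + 1) / sqrt lo * \<kappa>"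
proof -
  have lo: "0 < sqrt lo" using lo_pos by simp
  then have "sqrt (ip (b m) (b m)) \<le> sqrt (D (b m) (b m)) / sqrt lo"
    using norm_le_D[of "b m"] by (simp add: field_simps)
  then have "\<epsilon>\<^sub>0 * (sqrt \<epsilon> * sqrt (ip (b m) (b m))) \<le> \<epsilon>\<^sub>0 * (sqrt \<epsilon> * (sqrt (D (b m) (b m)) / sqrt lo))"
    using eps0 eps by (intro mult_left_mono) auto
  also have "\<dots> = (\<epsilon>\<^sub>0 * (sqrt \<epsilon> * sqrt (D (b m) (b m)))) / sqrt lo" by simp
  also have "\<dots> \<le> ((3 * T + 1) * \<kappa>) / sqrt lo"
    using lo by (intro divide_right_mono D_b_bound assms) auto
  finally show ?thesis by simp
qed

text \<open>
  The energy controls only mean values of two levels; \<open>y m\<close> differs from such a mean value by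
  \<open>\<tau>/2\<close> times the difference quotient, and the second stability condition turns its \<open>E\<close>-norm into the
  \<open>D\<close>-norm.
\<close>

lemma H1_bound: assumes m: "1 \<le> m" "m \<le> M"
  shows "\<epsilon>\<^sub>0 * (sqrt \<epsilon> * sqrt (ip (nLh a (y m)) (y m))) \<le> 2 * (3 * T + 1) * \<kappa>"
proof -
  let ?s = "(1 / 2) *\<^sub>R (y m + y (m - 1))" and ?d = "(\<tau> / 2) *\<^sub>R b m"
  have y: "y m = ?s + ?d" using \<tau>_pos by (simp add: b_def fun_eq_iff field_simps)
  have "ip (nLh a (y m)) (y m) \<le> E (y m) (y m)"
    using nLh_le_Eh[OF y_V[OF m(2)], of a] by (simp add: E_def zero_ext_id y_V m)
  then have "sqrt (ip (nLh a (y m)) (y m)) \<le> sqrt (E (y m) (y m))" by simp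
  also have "\<dots> \<le> sqrt (E ?s ?s) + sqrt (E ?d ?d)"
    using psd_form_triangle[OF psd_form_E, of ?s ?d] by (simp only: y[symmetric])
  also have "E ?d ?d = \<tau>\<^sup>2 / 4 * E (b m) (b m)"
    by (simp add: psd_form_linear(3,6)[OF psd_form_E] power2_eq_square)
  also have "sqrt \<dots> \<le> sqrt (D (b m) (b m))" by (intro real_sqrt_le_mono E_le_D')
  also have "E ?s ?s = E (y m + y (m - 1)) (y m + y (m - 1)) / 4"
    by (simp add: psd_form_linear(3,6)[OF psd_form_E])
  also have "\<dots> \<le> En m"
    using E_le_D'[of "y m - y (m - 1)"] by (auto simp: energy_def intro!: divide_nonneg_nonneg)
  finally have le: "sqrt (ip (nLh a (y m)) (y m)) \<le> sqrt (En m) + sqrt (D (b m) (b m))"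
    by simp
  have "\<epsilon>\<^sub>0 * (sqrt \<epsilon> * sqrt (ip (nLh a (y m)) (y m))) \<le> \<epsilon>\<^sub>0 * (sqrt \<epsilon> * (sqrt (En m) + sqrt (D (b m) (b m))))"
    using le eps eps0 by (intro mult_left_mono) auto
  also have "\<dots> = \<epsilon>\<^sub>0 * (sqrt \<epsilon> * sqrt (En m)) + \<epsilon>\<^sub>0 * (sqrt \<epsilon> * sqrt (D (b m) (b m)))"
    by (simp add: algebra_simps)
  also have "\<dots> \<le> 1 * ((3 * T + 1) * \<kappa>) + (3 * T + 1) * \<kappa>"
    using eps eps0 T_pos \<kappa>_nonneg energy_nonneg[of E \<tau> D, OF psd_form_E E_le_D']
    by (intro add_mono D_b_bound mult_mono energy_bound m) auto
  finally show ?thesis by (simp add: algebra_simps)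
qed

text \<open>
  The equations of the levels \<open>1, \<dots>, m\<close> are summed; the second differences telescope.
\<close>

lemma Eh_sum:
  assumes "m < M"
  shows "ip (Eh a N h (\<tau> *\<^sub>R (\<Sum>l=1..m. y l))) z = \<tau> * (\<Sum>l=1..m. D (G l) z) - D (b (m + 1)) z + D (b 1) z"
  using assms
proof (induction m)
  case 0
  have z: "\<tau> *\<^sub>R (\<Sum>l=1..0. y l) = 0" by simp
  show ?case unfolding z linear_0[OF linear_Eh] by (simp add: inner_h_def)
next
  case (Suc m)
  have "D (y (Suc m + 1) - 2 *\<^sub>R y (Suc m) + y (Suc m - 1)) z = \<tau> * (D (b (Suc m + 1)) z - D (b (Suc m)) z)"
    using \<tau>_pos by (simp add: b_def psd_form_linear[OF psd_form_D] field_simps)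
  with D_step[of "Suc m" z] Suc.prems have "\<tau> * (\<tau> * E (y (Suc m)) z) = \<tau> * (\<tau> * D (G (Suc m)) z - (D (b (Suc m + 1)) z - D (b (Suc m)) z))"
    by (simp add: power2_eq_square algebra_simps)
  then have E: "\<tau> * E (y (Suc m)) z = \<tau> * D (G (Suc m)) z - (D (b (Suc m + 1)) z - D (b (Suc m)) z)"
    using \<tau>_pos by (simp only: mult_cancel_left) auto
  have split: "ip (Eh a N h (\<tau> *\<^sub>R (\<Sum>l=1..Suc m. y l))) z
      = ip (Eh a N h (\<tau> *\<^sub>R (\<Sum>l=1..m. y l))) z + \<tau> * E (y (Suc m)) z"
    using y_V[of "Suc m"] Suc.prems
    by (simp add: scaleR_add_right linear_add[OF linear_Eh] linear_scale[OF linear_Eh] ip_linear E_def zero_ext_id)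
  have IH: "ip (Eh a N h (\<tau> *\<^sub>R (\<Sum>l=1..m. y l))) z
      = \<tau> * (\<Sum>l=1..m. D (G l) z) - D (b (Suc m)) z + D (b 1) z"
    using Suc.IH Suc.prems unfolding Suc_eq_plus1 by linarith
  have "\<tau> * (\<Sum>l=1..Suc m. D (G l) z) = \<tau> * (\<Sum>l=1..m. D (G l) z) + \<tau> * D (G (Suc m)) z"
    by (simp add: distrib_left)
  then show ?case unfolding split IH using E by linarith
qed

lemma I_bound_interior: assumes m: "1 \<le> m" "m < M"
  shows "\<epsilon>\<^sub>0 * (\<epsilon> * sqrt (ip (nLh a (\<tau> *\<^sub>R (\<Sum>l=1..m. y l))) (nLh a (\<tau> *\<^sub>R (\<Sum>l=1..m. y l)))))
    \<le> hi / sqrt lo * (2 * T + 2 * (3 * T + 1)) * \<kappa>"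
proof -
  define z where "z = \<tau> *\<^sub>R (\<Sum>l=1..m. y l)"
  define d where "d w = sqrt (D w w)" for w
  define s where "s = \<tau> * (\<Sum>l=1..m. d (G l)) + d (b (m + 1)) + d (b 1)"
  define c where "c = hi / sqrt (\<epsilon> * lo)"
  have c: "0 \<le> c" using lo_pos lo_hi eps by (simp add: c_def)
  have d: "0 \<le> d w" for w using psd_form_nonneg[OF psd_form_D] by (simp add: d_def)
  have s: "0 \<le> s" using \<tau>_pos by (auto simp: s_def intro!: add_nonneg_nonneg mult_nonneg_nonneg sum_nonneg d)
  have z_V: "z \<in> V" unfolding z_def by (intro Hh_closed subspace_sum subspace_Hh y_V) (use m in auto)
  have dle: "D w x \<le> c * d w * sqrt (ip x x)" "- D w x \<le> c * d w * sqrt (ip x x)" for w x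
  proof -
    show "D w x \<le> c * d w * sqrt (ip x x)" for x unfolding c_def d_def by (rule D_le)
    from this[of "- 1 *\<^sub>R x"] show "- D w x \<le> c * d w * sqrt (ip x x)"
      by (simp only: psd_form_linear[OF psd_form_D] ip_linear) simp
  qed
  have "ip (Eh a N h z) x \<le> c * s * sqrt (ip x x)" for x
  proof -
    have "(\<Sum>l=1..m. D (G l) x) \<le> (\<Sum>l=1..m. c * d (G l) * sqrt (ip x x))"
      by (intro sum_mono dle)
    then have "\<tau> * (\<Sum>l=1..m. D (G l) x) \<le> \<tau> * (\<Sum>l=1..m. c * d (G l) * sqrt (ip x x))"
      using \<tau>_pos by (intro mult_left_mono) auto
    then have "ip (Eh a N h z) x \<le> \<tau> * (\<Sum>l=1..m. c * d (G l) * sqrt (ip x x))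
        + c * d (b (m + 1)) * sqrt (ip x x) + c * d (b 1) * sqrt (ip x x)"
      unfolding z_def Eh_sum[OF m(2)] using dle[of "b (m + 1)" x] dle[of "b 1" x] by linarith
    also have "\<dots> = c * s * sqrt (ip x x)"
      by (simp add: s_def sum_distrib_left sum_distrib_right algebra_simps)
    finally show ?thesis .
  qed
  then have "sqrt (ip (nLh a z) (nLh a z)) \<le> c * s"
    using c s by (intro norm_nLh_le_Eh z_V) auto
  then have "\<epsilon>\<^sub>0 * (\<epsilon> * sqrt (ip (nLh a z) (nLh a z))) \<le> \<epsilon>\<^sub>0 * (\<epsilon> * (c * s))"
    using eps eps0 by (intro mult_left_mono) auto
  also have "\<dots> = hi / sqrt lo * (\<epsilon>\<^sub>0 * (sqrt \<epsilon> * s))"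
  proof -
    have "\<epsilon>\<^sub>0 * (\<epsilon> * (c * s)) = hi / sqrt lo * (\<epsilon>\<^sub>0 * (\<epsilon> / sqrt \<epsilon> * s))"
      by (simp add: c_def real_sqrt_mult mult_ac)
    then show ?thesis using eps by (simp add: real_div_sqrt)
  qed
  also have "\<dots> \<le> hi / sqrt lo * ((2 * T + 2 * (3 * T + 1)) * \<kappa>)"
  proof (rule mult_left_mono)
    have "\<epsilon>\<^sub>0 * (sqrt \<epsilon> * s) = \<epsilon>\<^sub>0 * (\<tau> * (\<Sum>l=1..m. sqrt \<epsilon> * d (G l)))
        + \<epsilon>\<^sub>0 * (sqrt \<epsilon> * d (b (m + 1))) + \<epsilon>\<^sub>0 * (sqrt \<epsilon> * d (b 1))"
      by (simp add: s_def sum_distrib_left algebra_simps)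
    also have "\<dots> \<le> T * (2 * \<kappa>) + (3 * T + 1) * \<kappa> + (3 * T + 1) * \<kappa>"
    proof (intro add_mono)
      have "(\<Sum>l=1..m. sqrt \<epsilon> * d (G l)) \<le> (\<Sum>l=1..m. 2 * \<kappa>)"
        using m by (intro sum_mono) (auto simp: d_def intro!: sqrt_D_G)
      also have "\<dots> \<le> real M * (2 * \<kappa>)" using m \<kappa>_nonneg by (simp add: mult_right_mono)
      finally have "\<tau> * (\<Sum>l=1..m. sqrt \<epsilon> * d (G l)) \<le> \<tau> * (real M * (2 * \<kappa>))"
        using \<tau>_pos by (intro mult_left_mono) auto
      then have "\<epsilon>\<^sub>0 * (\<tau> * (\<Sum>l=1..m. sqrt \<epsilon> * d (G l))) \<le> 1 * (\<tau> * (real M * (2 * \<kappa>)))"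
        using eps eps0 \<tau>_pos \<kappa>_nonneg by (intro mult_mono) (auto intro!: mult_nonneg_nonneg sum_nonneg d)
      then show "\<epsilon>\<^sub>0 * (\<tau> * (\<Sum>l=1..m. sqrt \<epsilon> * d (G l))) \<le> T * (2 * \<kappa>)"
        by (simp add: T[symmetric] mult_ac)
      show "\<epsilon>\<^sub>0 * (sqrt \<epsilon> * d (b (m + 1))) \<le> (3 * T + 1) * \<kappa>"
        unfolding d_def by (rule D_b_bound) (use m in auto)
      show "\<epsilon>\<^sub>0 * (sqrt \<epsilon> * d (b 1)) \<le> (3 * T + 1) * \<kappa>"
        unfolding d_def by (rule D_b_bound) (use m in auto)
    qed
    finally show "\<epsilon>\<^sub>0 * (sqrt \<epsilon> * s) \<le> (2 * T + 2 * (3 * T + 1)) * \<kappa>" by (simp add: algebra_simps)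
  qed (use lo_pos lo_hi in auto)
  finally show ?thesis by (simp add: z_def)
qed

text \<open>
  For \<open>m = M\<close> the equation at level \<open>M\<close> is missing; the last summand is bounded by the inverse
  inequality.
\<close>

lemma I_bound: assumes m: "1 \<le> m" "m \<le> M"
  shows "\<epsilon>\<^sub>0 * (\<epsilon> * sqrt (ip (nLh a (\<tau> *\<^sub>R (\<Sum>l=1..m. y l))) (nLh a (\<tau> *\<^sub>R (\<Sum>l=1..m. y l)))))
    \<le> (hi / sqrt lo * (2 * T + 2 * (3 * T + 1)) + sqrt (12 * lo) * (2 * (3 * T + 1))) * \<kappa>"
proof (cases "m < M")
  case True
  have "0 \<le> sqrt (12 * lo) * (2 * (3 * T + 1)) * \<kappa>"
    using lo_pos T_pos \<kappa>_nonneg by (intro mult_nonneg_nonneg) auto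
  then show ?thesis using I_bound_interior[OF m(1) True] by (simp only: distrib_right)
next
  case False
  then have mM: "m = M" using m by simp
  let ?n = "\<lambda>w. sqrt (ip (nLh a w) (nLh a w))"
  let ?z = "\<tau> *\<^sub>R (\<Sum>l=1..M - 1. y l)"
  have "\<tau> *\<^sub>R (\<Sum>l=1..M. y l) = ?z + \<tau> *\<^sub>R y M"
    using M by (cases M) (auto simp: scaleR_add_right)
  then have split: "?n (\<tau> *\<^sub>R (\<Sum>l=1..M. y l)) \<le> ?n ?z + ?n (\<tau> *\<^sub>R y M)"
    using psd_form_triangle[OF psd_form_ip, of "nLh a ?z" "nLh a (\<tau> *\<^sub>R y M)"]
    by (simp add: linear_add[OF linear_nLh])
  have "?n (\<tau> *\<^sub>R y M) = \<tau> * ?n (y M)"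
    using psd_form_scale_sqrt[OF psd_form_ip, of \<tau> "nLh a (y M)"] \<tau>_pos
    by (simp add: linear_scale[OF linear_nLh])
  also have "\<dots> \<le> sqrt (12 * lo) * sqrt (ip (nLh a (y M)) (y M))"
    by (rule tau_norm_nLh_le) (simp add: y_V)
  finally have le: "?n (\<tau> *\<^sub>R (\<Sum>l=1..M. y l)) \<le> ?n ?z + sqrt (12 * lo) * sqrt (ip (nLh a (y M)) (y M))"
    by (rule order_trans[OF split add_left_mono])
  have "\<epsilon>\<^sub>0 * (\<epsilon> * ?n (\<tau> *\<^sub>R (\<Sum>l=1..M. y l)))
      \<le> \<epsilon>\<^sub>0 * (\<epsilon> * (?n ?z + sqrt (12 * lo) * sqrt (ip (nLh a (y M)) (y M))))"
    by (intro mult_left_mono le less_imp_le[OF eps(1)] less_imp_le[OF eps0(1)])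
  also have "\<dots> = \<epsilon>\<^sub>0 * (\<epsilon> * ?n ?z)
      + sqrt (12 * lo) * (sqrt \<epsilon> * (\<epsilon>\<^sub>0 * (sqrt \<epsilon> * sqrt (ip (nLh a (y M)) (y M)))))"
    using eps by (simp add: algebra_simps flip: mult.assoc)
  also have "\<dots> \<le> hi / sqrt lo * (2 * T + 2 * (3 * T + 1)) * \<kappa> + sqrt (12 * lo) * (1 * (2 * (3 * T + 1) * \<kappa>))"
    using M eps eps0 lo_pos \<kappa>_nonneg T_pos nLh_nonneg[OF y_V[of M], of a]
    by (intro add_mono I_bound_interior mult_mono mult_left_mono H1_bound) auto
  finally show ?thesis unfolding mM by (simp add: algebra_simps)
qed

lemma error_bound: assumes m: "1 \<le> m" "m \<le> M"
  shows "sqrt \<epsilon> * \<epsilon>\<^sub>0 * (norm_h N h (b m) + sqrt (ip (nLh a (y m)) (y m))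
      + sqrt \<epsilon> * norm_h N h (nLh a (\<tau> *\<^sub>R (\<Sum>l=1..m. y l)))) \<le> stability_const lo hi T * \<eta>"
proof -
  have "sqrt \<epsilon> * \<epsilon>\<^sub>0 * (norm_h N h (b m) + sqrt (ip (nLh a (y m)) (y m))
      + sqrt \<epsilon> * norm_h N h (nLh a (\<tau> *\<^sub>R (\<Sum>l=1..m. y l))))
    = \<epsilon>\<^sub>0 * (sqrt \<epsilon> * sqrt (ip (b m) (b m))) + \<epsilon>\<^sub>0 * (sqrt \<epsilon> * sqrt (ip (nLh a (y m)) (y m)))
      + \<epsilon>\<^sub>0 * (\<epsilon> * sqrt (ip (nLh a (\<tau> *\<^sub>R (\<Sum>l=1..m. y l))) (nLh a (\<tau> *\<^sub>R (\<Sum>l=1..m. y l)))))"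
    using eps by (simp add: norm_h_eq distrib_left mult_ac flip: mult.assoc)
  also have "\<dots> \<le> (3 * T + 1) / sqrt lo * \<kappa> + 2 * (3 * T + 1) * \<kappa>
      + (hi / sqrt lo * (2 * T + 2 * (3 * T + 1)) + sqrt (12 * lo) * (2 * (3 * T + 1))) * \<kappa>"
    by (intro add_mono norm_b_bound H1_bound I_bound m)
  also have "\<dots> = stability_const lo hi T * \<eta>"
    by (simp add: stability_const_def \<kappa>_def add_divide_distrib distrib_right)
  finally show ?thesis .
qed

end

section \<open>Difference quotients of smooth functions of one variable\<close>

text \<open>
  \<open>F i\<close> is the \<open>i\<close>-th derivative of \<open>F 0\<close> on \<open>J\<close>, for \<open>i \<le> p\<close>, one-sided at the end points.
\<close>

definition deriv_chain :: "real set \<Rightarrow> nat \<Rightarrow> (nat \<Rightarrow> real \<Rightarrow> real) \<Rightarrow> bool" where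
  "deriv_chain J p F \<longleftrightarrow> convex J \<and>
     (\<forall>i<p. \<forall>s\<in>J. (F i has_field_derivative F (Suc i) s) (at s within J))"

lemma deriv_chain_shift:
  "deriv_chain J (p + j) F \<Longrightarrow> deriv_chain J p (\<lambda>i. F (i + j))"
  by (auto simp: deriv_chain_def)

lemma taylor_bound:
  assumes F: "deriv_chain J (Suc n) F" and B: "\<And>s. s \<in> J \<Longrightarrow> \<bar>F (Suc n) s\<bar> \<le> B"
    and "c \<in> J" "s \<in> J"
  shows "\<bar>F 0 s - (\<Sum>i\<le>n. F i c * (s - c) ^ i / fact i)\<bar> \<le> B * \<bar>s - c\<bar> ^ Suc n"
proof -
  have B0: "0 \<le> B" using B[OF \<open>c \<in> J\<close>] by simp
  have "norm (F 0 s - (\<Sum>i\<le>n. F i c * (s - c) ^ i / fact i)) \<le> B * norm (s - c) ^ Suc n / fact n"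
    by (rule field_Taylor[of J]) (use assms in \<open>auto simp: deriv_chain_def\<close>)
  also have "\<dots> \<le> B * norm (s - c) ^ Suc n / 1"
    using B0 by (intro divide_left_mono) (auto simp: fact_ge_1)
  finally show ?thesis by (simp add: real_norm_def)
qed

lemma second_difference_2:
  assumes F: "deriv_chain J 2 F" and B: "\<And>s. s \<in> J \<Longrightarrow> \<bar>F 2 s\<bar> \<le> B"
    and J: "s \<in> J" "s + d \<in> J" "s - d \<in> J"
  shows "\<bar>F 0 (s + d) - 2 * F 0 s + F 0 (s - d)\<bar> \<le> 2 * B * d ^ 2"
proof -
  have F': "deriv_chain J (Suc 1) F" "\<And>s. s \<in> J \<Longrightarrow> \<bar>F (Suc 1) s\<bar> \<le> B"
    using F B by (simp_all add: numeral_2_eq_2)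
  from taylor_bound[OF F' J(1,2)] taylor_bound[OF F' J(1,3)]
  show ?thesis by (simp add: power_even_abs numeral_2_eq_2[symmetric])
qed

lemma second_difference_4:
  assumes F: "deriv_chain J 4 F" and B: "\<And>s. s \<in> J \<Longrightarrow> \<bar>F 4 s\<bar> \<le> B"
    and J: "s \<in> J" "s + d \<in> J" "s - d \<in> J"
  shows "\<bar>F 0 (s + d) - 2 * F 0 s + F 0 (s - d) - d ^ 2 * F 2 s\<bar> \<le> 2 * B * d ^ 4"
proof -
  have F': "deriv_chain J (Suc 3) F" "\<And>s. s \<in> J \<Longrightarrow> \<bar>F (Suc 3) s\<bar> \<le> B"
    using F B by (simp_all add: eval_nat_numeral)
  have S: "(\<Sum>i\<le>3. F i s * e ^ i / fact i)
      = F 0 s + F 1 s * e + F 2 s * e ^ 2 / 2 + F 3 s * e ^ 3 / 6" for e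
    by (simp add: eval_nat_numeral)
  from taylor_bound[OF F' J(1,2)] taylor_bound[OF F' J(1,3)]
  show ?thesis by (simp add: S power_even_abs abs_le_iff algebra_simps)
qed

text \<open>
  Both second differences are expanded around \<open>s\<close>: the weights \<open>1/12, 10/12, 1/12\<close> reproduce the term with
  the fourth derivative.
\<close>

lemma second_difference_numerov:
  assumes F: "deriv_chain J 6 F" and B: "\<And>s. s \<in> J \<Longrightarrow> \<bar>F 6 s\<bar> \<le> B"
    and J: "s \<in> J" "s + d \<in> J" "s - d \<in> J"
  shows "\<bar>F 0 (s + d) - 2 * F 0 s + F 0 (s - d)
    - d ^ 2 / 12 * (F 2 (s + d) + 10 * F 2 s + F 2 (s - d))\<bar> \<le> 3 * B * d ^ 6"
proof -
  have F': "deriv_chain J (Suc 5) F" "\<And>s. s \<in> J \<Longrightarrow> \<bar>F (Suc 5) s\<bar> \<le> B"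
    using F B by (simp_all add: eval_nat_numeral)
  have S: "(\<Sum>i\<le>5. F i s * e ^ i / fact i)
      = F 0 s + F 1 s * e + F 2 s * e ^ 2 / 2 + F 3 s * e ^ 3 / 6 + F 4 s * e ^ 4 / 24 + F 5 s * e ^ 5 / 120" for e
    by (simp add: eval_nat_numeral)
  have A: "\<bar>F 0 (s + d) - 2 * F 0 s + F 0 (s - d) - d ^ 2 * F 2 s - d ^ 4 / 12 * F 4 s\<bar> \<le> 2 * B * d ^ 6"
    using taylor_bound[OF F' J(1,2)] taylor_bound[OF F' J(1,3)]
    by (simp add: S power_even_abs abs_le_iff algebra_simps)
  have "\<bar>F 2 (s + d) - 2 * F 2 s + F 2 (s - d) - d ^ 2 * F 4 s\<bar> \<le> 2 * B * d ^ 4"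
    using second_difference_4[OF deriv_chain_shift[of J 4 2 F] _ J, of B] F B by (simp flip: numeral_2_eq_2)
  then have "\<bar>d ^ 2 / 12\<bar> * \<bar>F 2 (s + d) - 2 * F 2 s + F 2 (s - d) - d ^ 2 * F 4 s\<bar> \<le> \<bar>d ^ 2 / 12\<bar> * (2 * B * d ^ 4)"
    by (rule mult_left_mono) simp
  then have C: "\<bar>d ^ 2 / 12 * (F 2 (s + d) - 2 * F 2 s + F 2 (s - d) - d ^ 2 * F 4 s)\<bar> \<le> B * d ^ 6 / 6"
    unfolding abs_mult[symmetric] by (simp add: power_add[symmetric])
  have "0 \<le> B" using B[OF J(1)] by simp
  then have "B * d ^ 6 / 6 \<le> B * d ^ 6" by simp
  moreover have "F 0 (s + d) - 2 * F 0 s + F 0 (s - d) - d ^ 2 / 12 * (F 2 (s + d) + 10 * F 2 s + F 2 (s - d))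
      = (F 0 (s + d) - 2 * F 0 s + F 0 (s - d) - d ^ 2 * F 2 s - d ^ 4 / 12 * F 4 s)
        - d ^ 2 / 12 * (F 2 (s + d) - 2 * F 2 s + F 2 (s - d) - d ^ 2 * F 4 s)"
    by (simp add: field_simps power2_eq_square power4_eq_xxxx)
  ultimately show ?thesis using A C by linarith
qed

section \<open>The starting quadrature\<close>

text \<open>
  Both admissible right-hand sides of the first step have this form, see \<open>f_d0_three_level_eq\<close> and
  \<open>f_d0_half_step_eq\<close>; they are averages of values at \<open>0\<close>, \<open>\<theta> \<tau>\<close> and \<open>2 \<tau>\<close>.
\<close>

definition start_avg :: "real \<Rightarrow> real \<Rightarrow> real \<Rightarrow> real \<Rightarrow> (real \<Rightarrow> real) \<Rightarrow> real" where
  "start_avg p \<theta> q \<tau> \<phi> = \<phi> 0 + p * (\<phi> (\<theta> * \<tau>) - \<phi> 0) + q * (\<phi> (2 * \<tau>) - \<phi> 0)"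

text \<open>
  The two equations say that the average of \<open>\<phi>\<close> is \<open>\<phi>(0) + \<tau>/3 \<phi>'(0) + \<tau>\<^sup>2/12 \<phi>''(0)\<close> up to third order.
  These are the values at which \<open>\<tau>\<^sup>2/2\<close> times the average of \<open>\<partial>\<^sub>t\<^sup>2 u\<close> agrees with the terms of order 2 to 4
  of the Taylor expansion of \<open>u\<close>.
\<close>

definition start_weights :: "real \<Rightarrow> real \<Rightarrow> real \<Rightarrow> bool" where
  "start_weights p \<theta> q \<longleftrightarrow> \<bar>p\<bar> \<le> 1 \<and> 0 \<le> \<theta> \<and> \<theta> \<le> 1 \<and> \<bar>q\<bar> \<le> 1 \<and>
     p * \<theta> + 2 * q = 1 / 3 \<and> p * \<theta>\<^sup>2 + 4 * q = 1 / 6"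

lemma start_avg_expansion:
  assumes w: "start_weights p \<theta> q" and F: "deriv_chain {0..T} 3 F"
    and B: "\<And>s. s \<in> {0..T} \<Longrightarrow> \<bar>F 3 s\<bar> \<le> B" and \<tau>: "0 < \<tau>" "2 * \<tau> \<le> T"
  shows "\<bar>start_avg p \<theta> q \<tau> (F 0) - F 0 0 - \<tau> / 3 * F 1 0 - \<tau>\<^sup>2 / 12 * F 2 0\<bar> \<le> 9 * B * \<tau> ^ 3"
proof -
  have F': "deriv_chain {0..T} (Suc 2) F" "\<And>s. s \<in> {0..T} \<Longrightarrow> \<bar>F (Suc 2) s\<bar> \<le> B"
    using F B by (simp_all add: eval_nat_numeral)
  have S: "(\<Sum>i\<le>2. F i 0 * e ^ i / fact i) = F 0 0 + F 1 0 * e + F 2 0 * e ^ 2 / 2" for e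
    by (simp add: eval_nat_numeral)
  have B0: "0 \<le> B" using B[of 0] \<tau> by force
  define R where "R t = F 0 t - (F 0 0 + F 1 0 * t + F 2 0 * t\<^sup>2 / 2)" for t
  have R: "\<bar>R t\<bar> \<le> B * t ^ 3" if "0 \<le> t" "t \<le> T" for t
    using taylor_bound[OF F', of 0 t] that \<tau> by (simp add: S R_def eval_nat_numeral)
  have \<theta>: "0 \<le> \<theta> * \<tau>" "\<theta> * \<tau> \<le> \<tau>" using w \<tau> by (auto simp: start_weights_def mult_le_cancel_right1)
  have "\<bar>R (\<theta> * \<tau>)\<bar> \<le> B * (\<theta> * \<tau>) ^ 3" by (intro R) (use \<theta> \<tau> in linarith)+
  also have "\<dots> \<le> B * \<tau> ^ 3" using B0 \<theta> by (intro mult_left_mono power_mono) auto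
  finally have "\<bar>p\<bar> * \<bar>R (\<theta> * \<tau>)\<bar> \<le> 1 * (B * \<tau> ^ 3)"
    using w by (intro mult_mono) (auto simp: start_weights_def)
  moreover have "\<bar>q\<bar> * \<bar>R (2 * \<tau>)\<bar> \<le> 1 * (B * (2 * \<tau>) ^ 3)"
    using w R[of "2 * \<tau>"] \<tau> by (intro mult_mono) (auto simp: start_weights_def)
  ultimately have le: "\<bar>p * R (\<theta> * \<tau>) + q * R (2 * \<tau>)\<bar> \<le> 9 * B * \<tau> ^ 3"
    using abs_triangle_ineq[of "p * R (\<theta> * \<tau>)" "q * R (2 * \<tau>)"]
    by (simp add: abs_mult power_mult_distrib)
  have "start_avg p \<theta> q \<tau> (F 0) - F 0 0 = p * R (\<theta> * \<tau>) + q * R (2 * \<tau>)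
      + (p * \<theta> + 2 * q) * \<tau> * F 1 0 + (p * \<theta>\<^sup>2 + 4 * q) * \<tau>\<^sup>2 / 2 * F 2 0"
    by (simp add: start_avg_def R_def algebra_simps power_mult_distrib)
  also have "p * \<theta> + 2 * q = 1 / 3" using w by (simp add: start_weights_def)
  also have "p * \<theta>\<^sup>2 + 4 * q = 1 / 6" using w by (simp add: start_weights_def)
  finally show ?thesis using le by simp
qed

section \<open>Classes of smooth functions on convex sets\<close>

lemma Ck_on_Suc_imp: "Ck_on (Suc K) S F \<Longrightarrow> Ck_on K S F"
  by (induction K arbitrary: F) auto

lemma Ck_on_mono: "Ck_on K S F \<Longrightarrow> K' \<le> K \<Longrightarrow> Ck_on K' S F"
  by (induction K) (auto simp: le_Suc_eq dest: Ck_on_Suc_imp simp del: Ck_on.simps)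

lemma Ck_on_iterate: "Ck_on (K + i) S F \<Longrightarrow> b \<in> Basis \<Longrightarrow> Ck_on K S ((pd S b ^^ i) F)"
proof (induction i arbitrary: F)
  case (Suc i)
  then have "Ck_on (K + i) S (pd S b F)" by simp
  from Suc.IH[OF this Suc.prems(2)] show ?case by (simp add: funpow_swap1)
qed simp

lemma Ck_on_continuous: "Ck_on K S F \<Longrightarrow> continuous_on S F"
  by (cases K) auto

lemma Ck_on_bounded:
  assumes "Ck_on (i + j) S F" "compact S" "b \<in> Basis" "b' \<in> Basis"
  shows "\<exists>B. \<forall>z\<in>S. \<bar>(pd S b ^^ i) ((pd S b' ^^ j) F) z\<bar> \<le> B"
proof -
  have "Ck_on 0 S ((pd S b ^^ i) ((pd S b' ^^ j) F))"
    using assms by (intro Ck_on_iterate) auto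
  then have "compact ((pd S b ^^ i) ((pd S b' ^^ j) F) ` S)"
    using assms by (intro compact_continuous_image) auto
  then show ?thesis by (auto dest!: compact_imp_bounded simp: bounded_iff)
qed

text \<open>
  The definition of the class speaks of difference quotients at parameter 0 of the line through a point;
  translation of the parameter gives the derivative everywhere along a fixed line.
\<close>

lemma Ck_on_line_deriv:
  assumes F: "Ck_on (Suc K) S F" and b: "b \<in> Basis" and z: "z + s *\<^sub>R b \<in> S"
  shows "((\<lambda>s. F (z + s *\<^sub>R b)) has_field_derivative pd S b F (z + s *\<^sub>R b))
    (at s within {s. z + s *\<^sub>R b \<in> S})"
proof -
  define z' where "z' = z + s *\<^sub>R b"
  let ?J = "{s. z + s *\<^sub>R b \<in> S}"
  have img: "(\<lambda>r. r - s) ` ?J = {r. z' + r *\<^sub>R b \<in> S}"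
    by (auto simp: z'_def image_iff algebra_simps intro!: exI[of _ "_ + s"])
  have "(\<lambda>r. F (z' + r *\<^sub>R b)) differentiable (at 0 within {r. z' + r *\<^sub>R b \<in> S})"
    using F b z by (simp add: z'_def)
  then have D: "((\<lambda>r. F (z' + r *\<^sub>R b)) has_vector_derivative pd S b F z') (at (s - s) within (\<lambda>r. r - s) ` ?J)"
    unfolding img by (simp add: pd_def vector_derivative_works)
  have "((\<lambda>r. r - s) has_vector_derivative 1) (at s within ?J)"
    by (auto intro!: derivative_eq_intros)
  from vector_diff_chain_within[OF this D]
  have "((\<lambda>r. F (z' + (r - s) *\<^sub>R b)) has_vector_derivative pd S b F z') (at s within ?J)"
    by (simp add: o_def)
  then show ?thesis
    by (simp add: z'_def algebra_simps has_real_derivative_iff_has_vector_derivative)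
qed

lemma Ck_on_line_chain:
  assumes F: "Ck_on K S F" and b: "b \<in> Basis" and S: "convex S"
  shows "deriv_chain {s. z + s *\<^sub>R b \<in> S} K (\<lambda>i s. (pd S b ^^ i) F (z + s *\<^sub>R b))"
  unfolding deriv_chain_def
proof (intro conjI allI impI ballI)
  show "convex {s. z + s *\<^sub>R b \<in> S}"
  proof (rule convexI)
    fix r s v w :: real
    assume A: "r \<in> {s. z + s *\<^sub>R b \<in> S}" "s \<in> {s. z + s *\<^sub>R b \<in> S}" "0 \<le> v" "0 \<le> w" "v + w = 1"
    have "v *\<^sub>R (z + r *\<^sub>R b) + w *\<^sub>R (z + s *\<^sub>R b) \<in> S" using A by (intro convexD[OF S]) auto
    also have "v *\<^sub>R (z + r *\<^sub>R b) + w *\<^sub>R (z + s *\<^sub>R b) = (v + w) *\<^sub>R z + (v * r + w * s) *\<^sub>R b"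
      by (simp add: algebra_simps)
    finally show "v *\<^sub>R r + w *\<^sub>R s \<in> {s. z + s *\<^sub>R b \<in> S}" using A by simp
  qed
next
  fix i s assume i: "i < K" and s: "s \<in> {s. z + s *\<^sub>R b \<in> S}"
  have "Ck_on (Suc 0) S ((pd S b ^^ i) F)"
    by (rule Ck_on_iterate[OF Ck_on_mono[OF F] b]) (use i in simp)
  from Ck_on_line_deriv[OF this b, of z s] s
  show "((\<lambda>s. (pd S b ^^ i) F (z + s *\<^sub>R b)) has_field_derivative (pd S b ^^ Suc i) F (z + s *\<^sub>R b))
      (at s within {s. z + s *\<^sub>R b \<in> S})" by simp
qed

lemma pd_cong_line:
  assumes "\<And>s. z + s *\<^sub>R b \<in> S \<longleftrightarrow> z + s *\<^sub>R b \<in> S'"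
    and "\<And>s. z + s *\<^sub>R b \<in> S \<Longrightarrow> F (z + s *\<^sub>R b) = G (z + s *\<^sub>R b)" and "z \<in> S"
  shows "pd S b F z = pd S' b G z"
  unfolding pd_def
  by (rule vector_derivative_cong_eq) (use assms assms(1)[of 0] in \<open>auto intro!: always_eventually\<close>)

lemma pd2_cong_line:
  assumes SS: "\<And>s. z + s *\<^sub>R b \<in> S \<longleftrightarrow> z + s *\<^sub>R b \<in> S'"
    and FG: "\<And>s. z + s *\<^sub>R b \<in> S \<Longrightarrow> F (z + s *\<^sub>R b) = G (z + s *\<^sub>R b)" and z: "z \<in> S"
  shows "pd2 S b F z = pd2 S' b G z"
  unfolding pd2_def
proof (rule pd_cong_line[OF SS _ z])
  fix s assume s: "z + s *\<^sub>R b \<in> S"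
  have line: "z + s *\<^sub>R b + r *\<^sub>R b = z + (s + r) *\<^sub>R b" for r by (simp add: algebra_simps)
  show "pd S b F (z + s *\<^sub>R b) = pd S' b G (z + s *\<^sub>R b)"
    by (rule pd_cong_line) (use s SS FG line in \<open>simp_all add: line\<close>)
qed

section \<open>Consistency of the scheme\<close>

lemma deriv_chain_lincomb3:
  assumes "deriv_chain J p F" "deriv_chain J p G" "deriv_chain J p H"
  shows "deriv_chain J p (\<lambda>i s. c * F i s + d * G i s + e * H i s)"
  using assms unfolding deriv_chain_def by (auto intro!: derivative_eq_intros)

lemma abs_divide_diff_le:
  fixes A C D E :: real
  assumes "0 < D" "\<bar>A - D * C\<bar> \<le> E * D" shows "\<bar>A / D - C\<bar> \<le> E"
proof -
  have "A / D - C = (A - D * C) / D" using assms(1) by (simp add: diff_divide_distrib)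
  then show ?thesis using assms by (simp add: abs_divide pos_divide_le_eq)
qed

lemma dir_x_Basis: "dir_x k \<in> Basis"
  by (auto simp: dir_x_def Basis_prod_def Basis_vec_def)

lemma dir_t_Basis: "dir_t \<in> Basis"
  by (auto simp: dir_t_def Basis_prod_def)

locale smooth_ibvp =
  fixes X a :: "real ^ 'n::finite" and T lo hi :: real and \<rho> u\<^sub>0 u\<^sub>1 :: "real ^ 'n \<Rightarrow> real"
    and f g u :: "(real ^ 'n) \<times> real \<Rightarrow> real"
  assumes X_pos: "0 < X $ k" and T_pos: "0 < T" and lo_pos: "0 < lo"
    and rho_bounds: "x \<in> cbox 0 X \<Longrightarrow> lo \<le> \<rho> x" "x \<in> cbox 0 X \<Longrightarrow> \<rho> x \<le> hi"
    and rho_cont: "continuous_on (cbox 0 X) \<rho>"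
    and u_smooth: "Ck_on 6 (cyl X T) u"
    and sol: "ibvp_solution X T a \<rho> f g u\<^sub>0 u\<^sub>1 u"
begin

abbreviation Dt where "Dt i F \<equiv> (pd (cyl X T) dir_t ^^ i) F"
abbreviation Dx where "Dx k i F \<equiv> (pd (cyl X T) (dir_x k) ^^ i) F"

lemma convex_cyl: "convex (cyl X T)"
  by (intro convex_Times convex_box convex_real_interval)

lemma compact_cyl: "compact (cyl X T)"
  by (intro compact_Times compact_cbox compact_Icc)

lemma Ck_Dt: "j + K \<le> 6 \<Longrightarrow> Ck_on K (cyl X T) (Dt j u)"
  by (rule Ck_on_iterate[OF Ck_on_mono[OF u_smooth] dir_t_Basis]) simp

lemma Ck_Dx: "j + K \<le> 6 \<Longrightarrow> Ck_on K (cyl X T) (Dx k j u)"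
  by (rule Ck_on_iterate[OF Ck_on_mono[OF u_smooth] dir_x_Basis]) simp

text \<open>
  Both orders of differentiation are listed, since the two iterated derivatives are separate
  functions on the closed cylinder.
\<close>

definition deriv_bound :: "real \<Rightarrow> bool" where
  "deriv_bound B \<longleftrightarrow> 0 \<le> B \<and> (\<forall>k i j. i + j \<le> 6 \<longrightarrow>
     (\<forall>z\<in>cyl X T. \<bar>Dx k i (Dt j u) z\<bar> \<le> B \<and> \<bar>Dt i (Dx k j u) z\<bar> \<le> B))"

lemma ex_deriv_bound: "\<exists>B. deriv_bound B"
proof -
  have ex: "\<exists>B. \<forall>z\<in>cyl X T. \<bar>Dx k i (Dt j u) z\<bar> \<le> B \<and> \<bar>Dt i (Dx k j u) z\<bar> \<le> B"
    if "i + j \<le> 6" for k i j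
  proof -
    have C: "Ck_on (i + j) (cyl X T) u" by (rule Ck_on_mono[OF u_smooth that])
    obtain B1 where B1: "\<forall>z\<in>cyl X T. \<bar>Dx k i (Dt j u) z\<bar> \<le> B1"
      using Ck_on_bounded[OF C compact_cyl dir_x_Basis dir_t_Basis] by blast
    obtain B2 where B2: "\<forall>z\<in>cyl X T. \<bar>Dt i (Dx k j u) z\<bar> \<le> B2"
      using Ck_on_bounded[OF C compact_cyl dir_t_Basis dir_x_Basis] by blast
    show ?thesis by (rule exI[of _ "max B1 B2"]) (use B1 B2 in \<open>auto simp: le_max_iff_disj\<close>)
  qed
  define I where "I = (UNIV :: 'n set) \<times> {..6 :: nat} \<times> {..6 :: nat}"
  define Q where "Q p B \<longleftrightarrow> (case p of (k, i, j) \<Rightarrow> i + j \<le> 6 \<longrightarrow>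
      (\<forall>z\<in>cyl X T. \<bar>Dx k i (Dt j u) z\<bar> \<le> B \<and> \<bar>Dt i (Dx k j u) z\<bar> \<le> B))" for p B
  have "\<exists>B. Q p B" for p
    using ex by (cases p) (auto simp: Q_def simp del: mem_Times_iff)
  then obtain \<beta> where "\<And>p. Q p (\<beta> p)" by metis
  then have \<beta>: "i + j \<le> 6 \<Longrightarrow> z \<in> cyl X T
      \<Longrightarrow> \<bar>Dx k i (Dt j u) z\<bar> \<le> \<beta> (k, i, j) \<and> \<bar>Dt i (Dx k j u) z\<bar> \<le> \<beta> (k, i, j)" for k i j z
    unfolding Q_def by fastforce
  have fin: "finite I" by (simp add: I_def)
  define B where "B = (\<Sum>p\<in>I. \<bar>\<beta> p\<bar>)"
  have le: "\<beta> p \<le> B" if "p \<in> I" for p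
    using member_le_sum[OF that, of "\<lambda>p. \<bar>\<beta> p\<bar>"] fin by (simp add: B_def)
  have "deriv_bound B" unfolding deriv_bound_def
  proof (intro conjI allI impI ballI)
    show "0 \<le> B" by (simp add: B_def sum_nonneg)
    fix k i j z assume ij: "i + j \<le> (6 :: nat)" and z: "z \<in> cyl X T"
    have "(k, i, j) \<in> I" using ij by (auto simp: I_def)
    with \<beta>[OF ij z, of k] le[OF this]
    show "\<bar>Dx k i (Dt j u) z\<bar> \<le> B" "\<bar>Dt i (Dx k j u) z\<bar> \<le> B" by linarith+
  qed
  then show ?thesis ..
qed

lemma time_chain:
  assumes "Ck_on K (cyl X T) F" "x \<in> cbox 0 X"
  shows "deriv_chain {0..T} K (\<lambda>i t. Dt i F (x, t))"
  using Ck_on_line_chain[OF assms(1) dir_t_Basis convex_cyl, of "(x, 0)"] assms(2)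
  by (simp add: dir_t_def atLeastAtMost_def atLeast_def atMost_def Collect_conj_eq)

definition line :: "'n \<Rightarrow> real ^ 'n \<Rightarrow> real \<Rightarrow> real ^ 'n" where
  "line k x s = x + axis k s"

lemmas line_simps = line_def axis_0 axis_uminus

definition seg :: "'n \<Rightarrow> real ^ 'n \<Rightarrow> real set" where
  "seg k x = {s. line k x s \<in> cbox 0 X}"

lemma space_chain:
  assumes "Ck_on K (cyl X T) F" "t \<in> {0..T}"
  shows "deriv_chain (seg k x) K (\<lambda>i s. Dx k i F (line k x s, t))"
proof -
  have "(x, t) + s *\<^sub>R dir_x k = (line k x s, t)" for s
    by (simp add: dir_x_def line_def vec_eq_iff axis_def)
  with Ck_on_line_chain[OF assms(1) dir_x_Basis convex_cyl, of "(x, t)" k] assms(2)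
  show ?thesis by (simp add: seg_def)
qed

text \<open>
  A point whose neighbours in all coordinate directions lie in the closed box, such as an interior node.
\<close>

definition inner_pt :: "real ^ 'n \<Rightarrow> real ^ 'n \<Rightarrow> bool" where
  "inner_pt h x \<longleftrightarrow> x \<in> cbox 0 X \<and>
     (\<forall>k. 0 < h $ k \<and> x + axis k (h $ k) \<in> cbox 0 X \<and> x - axis k (h $ k) \<in> cbox 0 X)"

lemma inner_pt_seg: "inner_pt h x \<Longrightarrow> 0 \<in> seg k x \<and> h $ k \<in> seg k x \<and> - (h $ k) \<in> seg k x"
  by (simp add: inner_pt_def seg_def line_simps)

lemma Lam_line: "Lam h k w x = (w (line k x (0 + h $ k)) - 2 * w (line k x 0) + w (line k x (0 - h $ k))) / (h $ k)\<^sup>2"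
  by (simp add: Lam_def line_simps)

lemma Lam_bounded:
  assumes F: "Ck_on 2 (cyl X T) F" and B: "\<And>z. z \<in> cyl X T \<Longrightarrow> \<bar>Dx k 2 F z\<bar> \<le> B"
    and x: "inner_pt h x" and t: "t \<in> {0..T}"
  shows "\<bar>Lam h k (\<lambda>y. F (y, t)) x\<bar> \<le> 2 * B"
proof -
  have "0 < h $ k" using x by (simp add: inner_pt_def)
  then have h: "0 < (h $ k)\<^sup>2" by simp
  have "\<bar>F (line k x (0 + h $ k), t) - 2 * F (line k x 0, t) + F (line k x (0 - h $ k), t)\<bar> \<le> 2 * B * (h $ k)\<^sup>2"
    using second_difference_2[OF space_chain[OF F t], of k x B 0 "h $ k"] B t inner_pt_seg[OF x, of k]
    by (simp add: seg_def)
  then show ?thesis unfolding Lam_line using h by (simp add: abs_divide pos_divide_le_eq)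
qed

lemma numerov_space:
  assumes B: "deriv_bound B" and x: "inner_pt h x" and t: "t \<in> {0..T}"
  shows "\<bar>sN h k (\<lambda>y. Dx k 2 u (y, t)) x - Lam h k (\<lambda>y. u (y, t)) x\<bar> \<le> 3 * B * (h $ k) ^ 4"
proof -
  let ?d = "h $ k"
  have h: "0 < ?d" using x by (simp add: inner_pt_def)
  have bd: "\<bar>Dx k 6 u (line k x s, t)\<bar> \<le> B" if "s \<in> seg k x" for s
    using B[unfolded deriv_bound_def, THEN conjunct2, rule_format, of 6 0 "(line k x s, t)" k] that t
    by (simp add: seg_def)
  have "\<bar>u (line k x (0 + ?d), t) - 2 * u (line k x 0, t) + u (line k x (0 - ?d), t)
     - ?d\<^sup>2 / 12 * (Dx k 2 u (line k x (0 + ?d), t) + 10 * Dx k 2 u (line k x 0, t) + Dx k 2 u (line k x (0 - ?d), t))\<bar> \<le> 3 * B * ?d ^ 6"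
    (is "\<bar>?A - ?d\<^sup>2 / 12 * ?C\<bar> \<le> _")
    using second_difference_numerov[OF space_chain[OF u_smooth t], of k x B 0 ?d] bd inner_pt_seg[OF x, of k]
    by simp
  moreover have "3 * B * ?d ^ 6 = (3 * B * ?d ^ 4) * ?d\<^sup>2" by (simp add: power_add[symmetric] mult.assoc)
  ultimately have "\<bar>?A - ?d\<^sup>2 * (?C / 12)\<bar> \<le> (3 * B * ?d ^ 4) * ?d\<^sup>2" by simp
  then have le: "\<bar>?A / ?d\<^sup>2 - ?C / 12\<bar> \<le> 3 * B * ?d ^ 4"
    using h by (intro abs_divide_diff_le) simp_all
  have eqs: "sN h k (\<lambda>y. Dx k 2 u (y, t)) x = ?C / 12" "Lam h k (\<lambda>y. u (y, t)) x = ?A / ?d\<^sup>2"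
    by (simp_all add: sN_def line_simps Lam_line)
  show ?thesis unfolding eqs by (subst abs_minus_commute) (rule le)
qed

lemma numerov_time:
  assumes B: "deriv_bound B" and x: "x \<in> cbox 0 X" and t: "t \<in> {0..T}" "t + \<tau> \<in> {0..T}" "t - \<tau> \<in> {0..T}"
  shows "\<bar>u (x, t + \<tau>) - 2 * u (x, t) + u (x, t - \<tau>)
    - \<tau>\<^sup>2 / 12 * (Dt 2 u (x, t + \<tau>) + 10 * Dt 2 u (x, t) + Dt 2 u (x, t - \<tau>))\<bar> \<le> 3 * B * \<tau> ^ 6"
proof -
  have "\<bar>Dt 6 u (x, s)\<bar> \<le> B" if "s \<in> {0..T}" for s
    using B[unfolded deriv_bound_def, THEN conjunct2, rule_format, of 6 0 "(x, s)"] that x by simp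
  then show ?thesis
    using second_difference_numerov[OF time_chain[OF u_smooth x] _ t, of B] by simp
qed

lemma Lam_time_chain:
  assumes x: "inner_pt h x" and "p \<le> 6"
  shows "deriv_chain {0..T} p (\<lambda>i t. Lam h k (\<lambda>y. Dt i u (y, t)) x)"
proof -
  have "deriv_chain {0..T} p (\<lambda>i t. (1 / (h $ k)\<^sup>2) * Dt i u (x + axis k (h $ k), t)
      + (- 2 / (h $ k)\<^sup>2) * Dt i u (x, t) + (1 / (h $ k)\<^sup>2) * Dt i u (x - axis k (h $ k), t))"
    using x by (intro deriv_chain_lincomb3 time_chain Ck_on_mono[OF u_smooth \<open>p \<le> 6\<close>]) (auto simp: inner_pt_def)
  then show ?thesis by (simp add: Lam_def add_divide_distrib diff_divide_distrib)
qed

text \<open>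
  The restriction \<open>j \<le> 4\<close> leaves two derivatives in space for the second difference.
\<close>

lemma Lam_time_bounded:
  assumes B: "deriv_bound B" and x: "inner_pt h x" and t: "t \<in> {0..T}" and j: "j \<le> 4"
  shows "\<bar>Lam h k (\<lambda>y. Dt j u (y, t)) x\<bar> \<le> 2 * B"
proof (rule Lam_bounded[OF Ck_Dt _ x t])
  show "j + 2 \<le> 6" using j by simp
  show "\<bar>Dx k 2 (Dt j u) z\<bar> \<le> B" if "z \<in> cyl X T" for z
    using B[unfolded deriv_bound_def, THEN conjunct2, rule_format, of 2 j z] that j by simp
qed

text \<open>
  The nine-point difference \<open>\<Lambda>\<^sub>k \<Lambda>\<^sub>t u\<close> is expanded twice: in time, as the second difference of
  \<open>\<Phi> = \<Lambda>\<^sub>k u\<close>, and in space, as the second difference of the time difference \<open>\<Psi>\<close> of \<open>u\<close>.  The remainders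
  involve \<open>\<partial>\<^sub>k\<^sup>2 \<partial>\<^sub>t\<^sup>4 u\<close> and \<open>\<partial>\<^sub>t\<^sup>2 \<partial>\<^sub>k\<^sup>4 u\<close>.
\<close>

lemma mixed_difference:
  assumes B: "deriv_bound B" and x: "inner_pt h x"
    and \<tau>: "0 < \<tau>" and t: "t \<in> {0..T}" "t + \<tau> \<in> {0..T}" "t - \<tau> \<in> {0..T}"
  shows "\<bar>Lam h k (\<lambda>y. Dt 2 u (y, t)) x
      - (Dx k 2 u (x, t + \<tau>) - 2 * Dx k 2 u (x, t) + Dx k 2 u (x, t - \<tau>)) / \<tau>\<^sup>2\<bar> \<le> 4 * B * (\<tau>\<^sup>2 + (h $ k)\<^sup>2)"
proof -
  let ?d = "h $ k"
  have h: "0 < ?d" using x by (simp add: inner_pt_def)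
  have xb: "line k x s \<in> cbox 0 X" if "s \<in> seg k x" for s using that by (simp add: seg_def)
  define \<Phi> where "\<Phi> = (\<lambda>i t. Lam h k (\<lambda>y. Dt i u (y, t)) x)"
  have "deriv_chain {0..T} 4 \<Phi>" unfolding \<Phi>_def by (rule Lam_time_chain[OF x]) simp
  then have 1: "\<bar>\<Phi> 0 (t + \<tau>) - 2 * \<Phi> 0 t + \<Phi> 0 (t - \<tau>) - \<tau>\<^sup>2 * \<Phi> 2 t\<bar> \<le> 2 * (2 * B) * \<tau> ^ 4"
    by (rule second_difference_4) (use t Lam_time_bounded[OF B x, of _ 4] in \<open>auto simp: \<Phi>_def\<close>)
  define \<Psi> where "\<Psi> = (\<lambda>i s. 1 * Dx k i u (line k x s, t + \<tau>) + (- 2) * Dx k i u (line k x s, t) + 1 * Dx k i u (line k x s, t - \<tau>))"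
  have "deriv_chain (seg k x) 4 \<Psi>" unfolding \<Psi>_def
    by (intro deriv_chain_lincomb3 space_chain t Ck_on_mono[OF u_smooth]) simp_all
  moreover have "\<bar>\<Psi> 4 s\<bar> \<le> 2 * B * \<tau>\<^sup>2" if s: "s \<in> seg k x" for s
  proof -
    have "\<bar>Dt 2 (Dx k 4 u) (line k x s, r)\<bar> \<le> B" if "r \<in> {0..T}" for r
      using B[unfolded deriv_bound_def, THEN conjunct2, rule_format, of 2 4 "(line k x s, r)"] xb[OF s] that by simp
    then show ?thesis
      using second_difference_2[OF time_chain[OF Ck_Dx[of 4 2 k] xb[OF s]] _ t, of B] by (simp add: \<Psi>_def)
  qed
  ultimately have 2: "\<bar>\<Psi> 0 (0 + ?d) - 2 * \<Psi> 0 0 + \<Psi> 0 (0 - ?d) - ?d\<^sup>2 * \<Psi> 2 0\<bar> \<le> 2 * (2 * B * \<tau>\<^sup>2) * ?d ^ 4"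
    by (rule second_difference_4) (use inner_pt_seg[OF x, of k] in auto)
  have comm: "(\<Psi> 0 (0 + ?d) - 2 * \<Psi> 0 0 + \<Psi> 0 (0 - ?d)) / ?d\<^sup>2 = \<Phi> 0 (t + \<tau>) - 2 * \<Phi> 0 t + \<Phi> 0 (t - \<tau>)"
    using h by (simp add: \<Psi>_def \<Phi>_def Lam_line field_simps)
  have "\<bar>(\<Phi> 0 (t + \<tau>) - 2 * \<Phi> 0 t + \<Phi> 0 (t - \<tau>)) - \<Psi> 2 0\<bar> \<le> 4 * B * \<tau>\<^sup>2 * ?d\<^sup>2"
    unfolding comm[symmetric]
    by (rule abs_divide_diff_le) (use 2 h in \<open>simp_all add: mult_ac power_add[symmetric]\<close>)
  with 1 have "\<bar>\<tau>\<^sup>2 * \<Phi> 2 t - \<Psi> 2 0\<bar> \<le> 4 * B * \<tau> ^ 4 + 4 * B * \<tau>\<^sup>2 * ?d\<^sup>2" by linarith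
  also have "\<dots> = (4 * B * (\<tau>\<^sup>2 + ?d\<^sup>2)) * \<tau>\<^sup>2" by (simp add: algebra_simps power2_eq_square power4_eq_xxxx)
  finally have "\<bar>\<Psi> 2 0 / \<tau>\<^sup>2 - \<Phi> 2 t\<bar> \<le> 4 * B * (\<tau>\<^sup>2 + ?d\<^sup>2)"
    using \<tau> by (intro abs_divide_diff_le) (simp_all add: abs_minus_commute)
  then show ?thesis by (simp add: abs_minus_commute) (simp add: \<Phi>_def \<Psi>_def line_simps)
qed

text \<open>
  The order-five remainder of the Taylor expansion combines with \<open>\<tau>\<^sup>2/2\<close> times the third-order error of the
  average.
\<close>

lemma start_time:
  assumes B: "deriv_bound B" and w: "start_weights p \<theta> q" and x: "x \<in> cbox 0 X"
    and \<tau>: "0 < \<tau>" "2 * \<tau> \<le> T"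
  shows "\<bar>u (x, \<tau>) - u (x, 0) - \<tau> * Dt 1 u (x, 0) - \<tau>\<^sup>2 / 2 * start_avg p \<theta> q \<tau> (\<lambda>t. Dt 2 u (x, t))\<bar> \<le> 6 * B * \<tau> ^ 5"
proof -
  have bd: "\<bar>Dt 5 u (x, s)\<bar> \<le> B" if "s \<in> {0..T}" for s
    using B[unfolded deriv_bound_def, THEN conjunct2, rule_format, of 5 0 "(x, s)"] that x by simp
  have ch: "deriv_chain {0..T} 5 (\<lambda>i t. Dt i u (x, t))"
    by (rule time_chain[OF Ck_on_mono[OF u_smooth] x]) simp
  have ch': "deriv_chain {0..T} (Suc 4) (\<lambda>i t. Dt i u (x, t))" "\<And>s. s \<in> {0..T} \<Longrightarrow> \<bar>Dt (Suc 4) u (x, s)\<bar> \<le> B"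
    using ch bd by (simp_all only: Suc_numeral) simp_all
  have S: "(\<Sum>i\<le>4. Dt i u (x, 0) * e ^ i / fact i)
      = u (x, 0) + Dt 1 u (x, 0) * e + Dt 2 u (x, 0) * e ^ 2 / 2 + Dt 3 u (x, 0) * e ^ 3 / 6 + Dt 4 u (x, 0) * e ^ 4 / 24" for e
    by (simp add: eval_nat_numeral)
  have 1: "\<bar>u (x, \<tau>) - (u (x, 0) + Dt 1 u (x, 0) * \<tau> + Dt 2 u (x, 0) * \<tau> ^ 2 / 2 + Dt 3 u (x, 0) * \<tau> ^ 3 / 6 + Dt 4 u (x, 0) * \<tau> ^ 4 / 24)\<bar> \<le> B * \<tau> ^ 5"
    using taylor_bound[OF ch', of 0 \<tau>] \<tau> unfolding diff_zero S by simp
  have "\<bar>start_avg p \<theta> q \<tau> (\<lambda>t. Dt (0 + 2) u (x, t)) - Dt (0 + 2) u (x, 0) - \<tau> / 3 * Dt (1 + 2) u (x, 0)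
      - \<tau>\<^sup>2 / 12 * Dt (2 + 2) u (x, 0)\<bar> \<le> 9 * B * \<tau> ^ 3"
    by (rule start_avg_expansion[OF w deriv_chain_shift[of _ 3 2] _ \<tau>]) (use ch bd in simp_all)
  then have "\<bar>start_avg p \<theta> q \<tau> (\<lambda>t. Dt 2 u (x, t)) - Dt 2 u (x, 0) - \<tau> / 3 * Dt 3 u (x, 0)
      - \<tau>\<^sup>2 / 12 * Dt 4 u (x, 0)\<bar> \<le> 9 * B * \<tau> ^ 3" (is "\<bar>?R\<bar> \<le> _") by (simp only: add_0 one_add_one numeral_plus_one one_plus_numeral numeral_plus_numeral add_num_simps)
  then have 2: "\<bar>\<tau>\<^sup>2 / 2 * ?R\<bar> \<le> \<tau>\<^sup>2 / 2 * (9 * B * \<tau> ^ 3)"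
    unfolding abs_mult by (intro mult_mono) auto
  have "0 \<le> B" using B by (simp add: deriv_bound_def)
  have "u (x, \<tau>) - u (x, 0) - \<tau> * Dt 1 u (x, 0) - \<tau>\<^sup>2 / 2 * start_avg p \<theta> q \<tau> (\<lambda>t. Dt 2 u (x, t))
     = (u (x, \<tau>) - (u (x, 0) + Dt 1 u (x, 0) * \<tau> + Dt 2 u (x, 0) * \<tau> ^ 2 / 2 + Dt 3 u (x, 0) * \<tau> ^ 3 / 6 + Dt 4 u (x, 0) * \<tau> ^ 4 / 24))
       - \<tau>\<^sup>2 / 2 * ?R"
    by (simp add: field_simps power2_eq_square power3_eq_cube power4_eq_xxxx)
  moreover have "\<tau>\<^sup>2 / 2 * (9 * B * \<tau> ^ 3) \<le> 5 * B * \<tau> ^ 5"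
  proof -
    have "\<tau>\<^sup>2 / 2 * (9 * B * \<tau> ^ 3) = 9 / 2 * (B * \<tau> ^ 5)" by (simp add: power_add[symmetric])
    also have "\<dots> \<le> 5 * (B * \<tau> ^ 5)" using \<open>0 \<le> B\<close> \<tau> by (intro mult_right_mono) auto
    finally show ?thesis by simp
  qed
  ultimately show ?thesis using 1 2 by linarith
qed

text \<open>
  As in \<open>mixed_difference\<close>, two expansions of the same quantity are compared, here of \<open>\<Lambda>\<^sub>k\<close> applied
  to the difference between the average in time and the initial value of \<open>u\<close>.  That difference and
  its derivatives in space are \<open>O(\<tau>)\<close>, so that the error \<open>O(h\<^sub>k\<^sup>2)\<close> of \<open>\<Lambda>\<^sub>k\<close> gains a factor \<open>\<tau>\<close>.
\<close>

lemma start_space: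
  assumes B: "deriv_bound B" and w: "start_weights p \<theta> q" and x: "inner_pt h x"
    and \<tau>: "0 < \<tau>" "2 * \<tau> \<le> T"
  shows "\<bar>start_avg p \<theta> q \<tau> (\<lambda>t. Dx k 2 u (x, t)) - Dx k 2 u (x, 0)
     - \<tau> / 3 * Lam h k (\<lambda>y. Dt 1 u (y, 0)) x - \<tau>\<^sup>2 / 12 * Lam h k (\<lambda>y. Dt 2 u (y, 0)) x\<bar>
   \<le> 6 * B * \<tau> * (h $ k)\<^sup>2 + 18 * B * \<tau> ^ 3"
proof -
  let ?d = "h $ k"
  have h: "0 < ?d" using x by (simp add: inner_pt_def)
  have B0: "0 \<le> B" using B by (simp add: deriv_bound_def)
  have xb: "line k x s \<in> cbox 0 X" if "s \<in> seg k x" for s using that by (simp add: seg_def)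
  have w': "\<bar>p\<bar> \<le> 1" "\<bar>q\<bar> \<le> 1" "0 \<le> \<theta>" "\<theta> \<le> 1" using w by (auto simp: start_weights_def)
  have \<theta>: "0 \<le> \<theta> * \<tau>" "\<theta> * \<tau> \<le> \<tau>" using w' \<tau> by (auto simp: mult_le_cancel_right1)
  have t: "0 \<in> {0..T}" "\<theta> * \<tau> \<in> {0..T}" "2 * \<tau> \<in> {0..T}"
    unfolding atLeastAtMost_iff using \<theta> \<tau> by linarith+
  define \<Phi> where "\<Phi> = (\<lambda>i t. Lam h k (\<lambda>y. Dt i u (y, t)) x)"
  have "deriv_chain {0..T} 3 \<Phi>" unfolding \<Phi>_def by (rule Lam_time_chain[OF x]) simp
  then have 1: "\<bar>start_avg p \<theta> q \<tau> (\<Phi> 0) - \<Phi> 0 0 - \<tau> / 3 * \<Phi> 1 0 - \<tau>\<^sup>2 / 12 * \<Phi> 2 0\<bar> \<le> 9 * (2 * B) * \<tau> ^ 3"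
    by (rule start_avg_expansion[OF w _ _ \<tau>]) (use Lam_time_bounded[OF B x, of _ 3] in \<open>auto simp: \<Phi>_def\<close>)
  define \<Psi> where "\<Psi> = (\<lambda>i s. p * Dx k i u (line k x s, \<theta> * \<tau>) + q * Dx k i u (line k x s, 2 * \<tau>) + (- p - q) * Dx k i u (line k x s, 0))"
  have "deriv_chain (seg k x) 4 \<Psi>" unfolding \<Psi>_def
    by (intro deriv_chain_lincomb3 space_chain t Ck_on_mono[OF u_smooth]) simp_all
  moreover have "\<bar>\<Psi> 4 s\<bar> \<le> 3 * B * \<tau>" if s: "s \<in> seg k x" for s
  proof -
    have ch: "deriv_chain {0..T} (Suc 0) (\<lambda>i t. Dt i (Dx k 4 u) (line k x s, t))"
      by (rule time_chain[OF Ck_Dx xb[OF s]]) simp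
    have bd: "\<bar>Dt (Suc 0) (Dx k 4 u) (line k x s, r)\<bar> \<le> B" if "r \<in> {0..T}" for r
      using B[unfolded deriv_bound_def, THEN conjunct2, rule_format, of 1 4 "(line k x s, r)"] xb[OF s] that by simp
    have inc: "\<bar>Dx k 4 u (line k x s, r) - Dx k 4 u (line k x s, 0)\<bar> \<le> B * \<bar>r\<bar>" if "r \<in> {0..T}" for r
      using taylor_bound[OF ch bd t(1) that] by simp
    have "\<bar>\<Psi> 4 s\<bar> = \<bar>p * (Dx k 4 u (line k x s, \<theta> * \<tau>) - Dx k 4 u (line k x s, 0))
        + q * (Dx k 4 u (line k x s, 2 * \<tau>) - Dx k 4 u (line k x s, 0))\<bar>"
      by (simp add: \<Psi>_def algebra_simps)
    also have "\<dots> \<le> \<bar>p\<bar> * \<bar>Dx k 4 u (line k x s, \<theta> * \<tau>) - Dx k 4 u (line k x s, 0)\<bar>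
        + \<bar>q\<bar> * \<bar>Dx k 4 u (line k x s, 2 * \<tau>) - Dx k 4 u (line k x s, 0)\<bar>"
      unfolding abs_mult[symmetric] by (rule abs_triangle_ineq)
    also have "\<dots> \<le> 1 * (B * \<bar>\<theta> * \<tau>\<bar>) + 1 * (B * \<bar>2 * \<tau>\<bar>)"
      by (intro add_mono mult_mono inc t w') auto
    also have "\<dots> \<le> B * \<tau> + B * (2 * \<tau>)"
      using \<theta> \<tau> B0 by (intro add_mono) (auto intro!: mult_left_mono)
    finally show ?thesis by simp
  qed
  ultimately have 2: "\<bar>\<Psi> 0 (0 + ?d) - 2 * \<Psi> 0 0 + \<Psi> 0 (0 - ?d) - ?d\<^sup>2 * \<Psi> 2 0\<bar> \<le> 2 * (3 * B * \<tau>) * ?d ^ 4"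
    by (rule second_difference_4) (use inner_pt_seg[OF x, of k] in auto)
  have comm: "(\<Psi> 0 (0 + ?d) - 2 * \<Psi> 0 0 + \<Psi> 0 (0 - ?d)) / ?d\<^sup>2 = start_avg p \<theta> q \<tau> (\<Phi> 0) - \<Phi> 0 0"
    by (simp add: \<Psi>_def \<Phi>_def Lam_line start_avg_def divide_inverse algebra_simps)
  have "\<bar>(start_avg p \<theta> q \<tau> (\<Phi> 0) - \<Phi> 0 0) - \<Psi> 2 0\<bar> \<le> 6 * B * \<tau> * ?d\<^sup>2"
    unfolding comm[symmetric]
    by (rule abs_divide_diff_le) (use 2 h in \<open>simp_all add: mult_ac power_add[symmetric]\<close>)
  with 1 have "\<bar>\<Psi> 2 0 - \<tau> / 3 * \<Phi> 1 0 - \<tau>\<^sup>2 / 12 * \<Phi> 2 0\<bar> \<le> 6 * B * \<tau> * ?d\<^sup>2 + 9 * (2 * B) * \<tau> ^ 3" by linarith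
  moreover have "\<Psi> 2 0 = start_avg p \<theta> q \<tau> (\<lambda>t. Dx k 2 u (x, t)) - Dx k 2 u (x, 0)"
    by (simp add: \<Psi>_def start_avg_def line_simps algebra_simps)
  ultimately show ?thesis by (simp add: \<Phi>_def)
qed

end

section \<open>Identification of the data\<close>

lemma continuous_eq_on_closure:
  fixes F G :: "'a::topological_space \<Rightarrow> real"
  assumes "continuous_on (closure S) F" "continuous_on (closure S) G"
    and "\<And>x. x \<in> S \<Longrightarrow> F x = G x" and "x \<in> closure S"
  shows "F x = G x"
proof -
  have "F x - G x = 0"
    by (rule continuous_constant_on_closure[of S "\<lambda>x. F x - G x" 0])
      (use assms in \<open>auto intro!: continuous_intros\<close>)
  then show ?thesis by simp
qed

context smooth_ibvp
begin

lemma box_nonempty: "box 0 X \<noteq> {}"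
proof -
  have "(1 / 2) *\<^sub>R X \<in> box 0 X" by (simp add: mem_box_cart X_pos)
  then show ?thesis by blast
qed

lemma closure_box_X: "closure (box 0 X) = cbox 0 X"
  by (rule closure_box[OF box_nonempty])

lemma closure_open_cyl: "closure (box 0 X \<times> {0<..<T}) = cyl X T"
  using T_pos by (simp add: closure_Times closure_box_X)

lemma mem_frontier: "x \<in> frontier (box 0 X) \<longleftrightarrow> x \<in> cbox 0 X \<and> (\<exists>j. x $ j = 0 \<or> x $ j = X $ j)"
  using box_nonempty by (auto simp: frontier_box mem_box_cart less_le)

lemma closure_open_lateral: "closure (frontier (box 0 X) \<times> {0<..<T}) = lateral X T"
  using T_pos by (simp add: closure_Times frontier_closed closure_closed)

lemma lateral_subset: "lateral X T \<subseteq> cyl X T"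
  by (auto simp: mem_frontier)

lemma u_cont: "continuous_on (cyl X T) u"
  by (rule Ck_on_continuous[OF u_smooth])

lemma pd2_Dt: "pd2 (cyl X T) dir_t F = Dt 2 F" and pd2_Dx: "pd2 (cyl X T) (dir_x k) F = Dx k 2 F"
  by (simp_all add: pd2_def numeral_2_eq_2)

lemma pde:
  assumes "x \<in> cbox 0 X" "t \<in> {0..T}"
  shows "f (x, t) = \<rho> x * Dt 2 u (x, t) - (\<Sum>k\<in>UNIV. (a $ k)\<^sup>2 * Dx k 2 u (x, t))"
proof -
  let ?F = "\<lambda>z. \<rho> (fst z) * Dt 2 u z - (\<Sum>k\<in>UNIV. (a $ k)\<^sup>2 * Dx k 2 u z)"
  have "continuous_on (cyl X T) f" using sol by (simp add: ibvp_solution_def)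
  moreover have "continuous_on (cyl X T) (\<lambda>z. \<rho> (fst z))"
    by (rule continuous_on_compose2[OF rho_cont]) (auto intro!: continuous_intros)
  then have "continuous_on (cyl X T) ?F"
    by (intro continuous_intros Ck_on_continuous[of 0] Ck_Dt Ck_Dx) simp_all
  moreover have "f z = ?F z" if "z \<in> box 0 X \<times> {0<..<T}" for z
    using sol that by (auto simp: ibvp_solution_def pd2_Dt pd2_Dx)
  ultimately have "f (x, t) = ?F (x, t)"
    using assms continuous_eq_on_closure[of "box 0 X \<times> {0<..<T}" f ?F "(x, t)", unfolded closure_open_cyl]
    by blast
  then show ?thesis by simp
qed

lemma g_eq: assumes "z \<in> lateral X T" shows "g z = u z"
proof -
  have "continuous_on (lateral X T) g" using sol by (simp add: ibvp_solution_def)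
  moreover have "continuous_on (lateral X T) u" by (rule continuous_on_subset[OF u_cont lateral_subset])
  moreover have "g w = u w" if "w \<in> frontier (box 0 X) \<times> {0<..<T}" for w
    using sol that by (auto simp: ibvp_solution_def)
  ultimately show ?thesis
    using assms continuous_eq_on_closure[of "frontier (box 0 X) \<times> {0<..<T}" g u z, unfolded closure_open_lateral]
    by blast
qed

lemma initial_cont:
  assumes "continuous_on (cyl X T) F" shows "continuous_on (cbox 0 X) (\<lambda>x. F (x, 0))"
  by (rule continuous_on_compose2[OF assms, of "cbox 0 X" "\<lambda>x. (x, 0)"])
    (use T_pos in \<open>auto intro!: continuous_intros\<close>)

lemma u0_eq: assumes "x \<in> cbox 0 X" shows "u\<^sub>0 x = u (x, 0)"
proof -
  have "continuous_on (cbox 0 X) u\<^sub>0" "\<And>x. x \<in> box 0 X \<Longrightarrow> u\<^sub>0 x = u (x, 0)"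
    using sol by (auto simp: ibvp_solution_def)
  then show ?thesis
    using assms initial_cont[OF u_cont] continuous_eq_on_closure[of "box 0 X" u\<^sub>0 "\<lambda>x. u (x, 0)" x, unfolded closure_box_X]
    by blast
qed

lemma u1_eq: assumes "x \<in> cbox 0 X" shows "u\<^sub>1 x = Dt 1 u (x, 0)"
proof -
  have "continuous_on (cbox 0 X) u\<^sub>1" "\<And>x. x \<in> box 0 X \<Longrightarrow> u\<^sub>1 x = Dt 1 u (x, 0)"
    using sol by (auto simp: ibvp_solution_def)
  moreover have "continuous_on (cbox 0 X) (\<lambda>x. Dt 1 u (x, 0))"
    by (intro initial_cont Ck_on_continuous[of 0] Ck_Dt) simp
  ultimately show ?thesis
    using assms continuous_eq_on_closure[of "box 0 X" u\<^sub>1 "\<lambda>x. Dt 1 u (x, 0)" x, unfolded closure_box_X]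
    by blast
qed

text \<open>
  A line in direction \<open>l \<noteq> j\<close> through a point with \<open>x\<^sub>j\<close> equal to \<open>0\<close> or \<open>X\<^sub>j\<close> stays on that face, so the
  tangential derivatives of \<open>g\<close> are derivatives of \<open>u\<close>.
\<close>

lemma tangential_x:
  assumes x: "x \<in> cbox 0 X" "x $ j = 0 \<or> x $ j = X $ j" and lj: "l \<noteq> j" and t: "t \<in> {0..T}"
  shows "pd2 (lateral X T) (dir_x l) g (x, t) = Dx l 2 u (x, t)"
  unfolding pd2_Dx[symmetric]
proof (rule pd2_cong_line)
  fix s
  have eq: "(x, t) + s *\<^sub>R dir_x l = (line l x s, t)"
    by (simp add: dir_x_def line_def vec_eq_iff axis_def)
  have "line l x s $ j = x $ j" using lj by (simp add: line_def axis_def)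
  then have "line l x s \<in> frontier (box 0 X) \<longleftrightarrow> line l x s \<in> cbox 0 X"
    using x(2) unfolding mem_frontier by metis
  then show "(x, t) + s *\<^sub>R dir_x l \<in> lateral X T \<longleftrightarrow> (x, t) + s *\<^sub>R dir_x l \<in> cyl X T"
    unfolding eq by simp
qed (use x t in \<open>auto simp: mem_frontier intro!: g_eq\<close>)

lemma tangential_t:
  assumes x: "x \<in> frontier (box 0 X)" and t: "t \<in> {0..T}"
  shows "pd2 (lateral X T) dir_t g (x, t) = Dt 2 u (x, t)"
  unfolding pd2_Dt[symmetric]
  by (rule pd2_cong_line) (use x t in \<open>auto simp: dir_t_def mem_frontier intro!: g_eq\<close>)

text \<open>
  On a face orthogonal to direction \<open>k\<close> the equation, which holds up to the boundary, is solved for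
  \<open>a\<^sub>k\<^sup>2 \<partial>\<^sub>k\<^sup>2 u\<close>; on the other faces this derivative is tangential.
\<close>

lemma g_bd_eq:
  assumes x: "x \<in> frontier (box 0 X)" and t: "t \<in> {0..T}"
  shows "g_bd X T a \<rho> f g k x t = (a $ k)\<^sup>2 * Dx k 2 u (x, t)"
proof (cases "x $ k = 0 \<or> x $ k = X $ k")
  case True
  have xc: "x \<in> cbox 0 X" using x by (simp add: mem_frontier)
  have "(\<Sum>l\<in>UNIV - {k}. (a $ l)\<^sup>2 * pd2 (lateral X T) (dir_x l) g (x, t))
      = (\<Sum>l\<in>UNIV - {k}. (a $ l)\<^sup>2 * Dx l 2 u (x, t))"
    by (rule sum.cong) (use tangential_x[OF xc True _ t] in auto)
  then have "g_bd X T a \<rho> f g k x t = \<rho> x * Dt 2 u (x, t) - (\<Sum>l\<in>UNIV - {k}. (a $ l)\<^sup>2 * Dx l 2 u (x, t)) - f (x, t)"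
    using True tangential_t[OF x t] by (simp add: g_bd_def)
  also have "\<dots> = (\<Sum>l\<in>UNIV. (a $ l)\<^sup>2 * Dx l 2 u (x, t)) - (\<Sum>l\<in>UNIV - {k}. (a $ l)\<^sup>2 * Dx l 2 u (x, t))"
    unfolding pde[OF xc t] by simp
  also have "\<dots> = (a $ k)\<^sup>2 * Dx k 2 u (x, t)"
    by (subst sum.remove[of UNIV k]) simp_all
  finally show ?thesis .
next
  case False
  obtain j where j: "x $ j = 0 \<or> x $ j = X $ j" and xc: "x \<in> cbox 0 X" using x by (auto simp: mem_frontier)
  with False have "k \<noteq> j" by auto
  then show ?thesis using False tangential_x[OF xc j _ t] by (simp add: g_bd_def)
qed

section \<open>Residuals of the exact solution\<close>

lemma Lam_cong:
  assumes "\<And>y. y \<in> cbox 0 X \<Longrightarrow> v y = w y" "inner_pt h x"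
  shows "Lam h k v x = Lam h k w x"
  using assms by (simp add: Lam_def inner_pt_def)

text \<open>
  At every node of the stencil the equation gives \<open>(\<Sum> a\<^sub>k\<^sup>2 \<partial>\<^sub>k\<^sup>2 u) / \<rho> = \<partial>\<^sub>t\<^sup>2 u - f / \<rho>\<close>, so \<open>f / \<rho>\<close> cancels
  against the correction in \<open>f\<^sub>h\<close> and no derivative of \<open>\<rho>\<close> appears.
\<close>

lemma Lh_flux:
  assumes x: "inner_pt h x" and t: "t \<in> {0..T}"
  shows "Lh a h (\<lambda>y. (\<Sum>k\<in>UNIV. (a $ k)\<^sup>2 * Dx k 2 u (y, t)) / \<rho> y) x
    = Lh a h (\<lambda>y. Dt 2 u (y, t)) x - Lh a h (\<lambda>y. f (y, t) / \<rho> y) x"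
proof -
  have "Lam h k (\<lambda>y. (\<Sum>k\<in>UNIV. (a $ k)\<^sup>2 * Dx k 2 u (y, t)) / \<rho> y) x
      = Lam h k (\<lambda>y. Dt 2 u (y, t)) x - Lam h k (\<lambda>y. f (y, t) / \<rho> y) x" for k
  proof -
    have "Lam h k (\<lambda>y. (\<Sum>k\<in>UNIV. (a $ k)\<^sup>2 * Dx k 2 u (y, t)) / \<rho> y) x
        = Lam h k (\<lambda>y. Dt 2 u (y, t) - f (y, t) / \<rho> y) x"
    proof (rule Lam_cong[OF _ x])
      fix y assume y: "y \<in> cbox 0 X"
      then have "\<rho> y \<noteq> 0" using rho_bounds(1)[OF y] lo_pos by simp
      then show "(\<Sum>k\<in>UNIV. (a $ k)\<^sup>2 * Dx k 2 u (y, t)) / \<rho> y = Dt 2 u (y, t) - f (y, t) / \<rho> y"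
        using pde[OF y t] by (simp add: field_simps)
    qed
    then show ?thesis by (simp add: Lam_def diff_divide_distrib[symmetric] algebra_simps)
  qed
  then show ?thesis by (simp add: Lh_def right_diff_distrib sum_subtractf)
qed

abbreviation a2 where "a2 \<equiv> (\<Sum>k\<in>UNIV. (a $ k)\<^sup>2)"

abbreviation flux where "flux t \<equiv> (\<lambda>y. \<Sum>k\<in>UNIV. (a $ k)\<^sup>2 * Dx k 2 u (y, t))"

lemma abs_weighted_sum_le:
  assumes "\<And>k. \<bar>F k\<bar> \<le> c"
  shows "\<bar>\<Sum>k\<in>UNIV. (a $ k)\<^sup>2 * F k\<bar> \<le> a2 * c"
proof -
  have "\<bar>\<Sum>k\<in>UNIV. (a $ k)\<^sup>2 * F k\<bar> \<le> (\<Sum>k\<in>UNIV. \<bar>(a $ k)\<^sup>2 * F k\<bar>)" by (rule sum_abs)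
  also have "\<dots> \<le> (\<Sum>k\<in>UNIV. (a $ k)\<^sup>2 * c)"
    by (intro sum_mono) (simp add: abs_mult mult_left_mono assms)
  finally show ?thesis by (simp add: sum_distrib_right)
qed

text \<open>
  After insertion of the equation the residual is \<open>\<rho>\<close> times the Numerov error \<open>A\<close> in time, minus
  \<open>\<tau>\<^sup>2/12\<close> times the weighted sum of the mixed differences.
\<close>

lemma residual_step:
  assumes B: "deriv_bound B" and x: "inner_pt h x"
    and \<tau>: "0 < \<tau>" and t: "t \<in> {0..T}" "t + \<tau> \<in> {0..T}" "t - \<tau> \<in> {0..T}"
    and H: "\<tau> \<le> H" "\<And>k. h $ k \<le> H"
  shows "\<bar>\<rho> x * ((u (x, t + \<tau>) - 2 * u (x, t) + u (x, t - \<tau>)) / \<tau>\<^sup>2) - rho_op \<rho> a h \<tau> (flux t) x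
      - (f (x, t) + \<tau>\<^sup>2 / 12 * ((f (x, t + \<tau>) - 2 * f (x, t) + f (x, t - \<tau>)) / \<tau>\<^sup>2
          + Lh a h (\<lambda>y. f (y, t) / \<rho> y) x))\<bar>
    \<le> (3 * hi * B + a2 * B) * H ^ 4"
proof -
  have xc: "x \<in> cbox 0 X" using x by (simp add: inner_pt_def)
  have B0: "0 \<le> B" using B by (simp add: deriv_bound_def)
  have hi: "0 \<le> \<rho> x" "\<rho> x \<le> hi" using rho_bounds[OF xc] lo_pos by auto
  define A where "A = (u (x, t + \<tau>) - 2 * u (x, t) + u (x, t - \<tau>)) / \<tau>\<^sup>2
      - (Dt 2 u (x, t + \<tau>) + 10 * Dt 2 u (x, t) + Dt 2 u (x, t - \<tau>)) / 12"
  define mix where "mix k = Lam h k (\<lambda>y. Dt 2 u (y, t)) x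
      - (Dx k 2 u (x, t + \<tau>) - 2 * Dx k 2 u (x, t) + Dx k 2 u (x, t - \<tau>)) / \<tau>\<^sup>2" for k
  have "3 * B * \<tau> ^ 6 = 3 * B * \<tau> ^ 4 * \<tau>\<^sup>2" by (simp add: power_add[symmetric] mult.assoc)
  with numerov_time[OF B xc t] \<tau> have "\<bar>A\<bar> \<le> 3 * B * \<tau> ^ 4"
    unfolding A_def by (intro abs_divide_diff_le) (simp_all add: mult_ac)
  also have "\<dots> \<le> 3 * B * H ^ 4" using B0 \<tau> H by (intro mult_left_mono power_mono) auto
  finally have A: "\<bar>\<rho> x * A\<bar> \<le> hi * (3 * B * H ^ 4)"
    unfolding abs_mult using hi by (intro mult_mono) auto
  have "\<bar>mix k\<bar> \<le> 8 * B * H\<^sup>2" for k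
  proof -
    have "0 < h $ k" using x by (simp add: inner_pt_def)
    have "\<bar>mix k\<bar> \<le> 4 * B * (\<tau>\<^sup>2 + (h $ k)\<^sup>2)" unfolding mix_def by (rule mixed_difference[OF B x \<tau> t])
    also have "\<dots> \<le> 4 * B * (H\<^sup>2 + H\<^sup>2)"
      using B0 \<tau> H \<open>0 < h $ k\<close> by (intro mult_left_mono add_mono power_mono) (auto intro: less_imp_le)
    finally show ?thesis by simp
  qed
  then have "\<bar>\<Sum>k\<in>UNIV. (a $ k)\<^sup>2 * mix k\<bar> \<le> a2 * (8 * B * H\<^sup>2)"
    by (rule abs_weighted_sum_le)
  then have "\<bar>\<tau>\<^sup>2 / 12 * (\<Sum>k\<in>UNIV. (a $ k)\<^sup>2 * mix k)\<bar> \<le> H\<^sup>2 / 12 * (a2 * (8 * B * H\<^sup>2))"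
    unfolding abs_mult using \<tau> H by (intro mult_mono) (auto intro!: divide_right_mono power_mono)
  also have "\<dots> = (2 / 3) * (a2 * B * H ^ 4)" by (simp add: power2_eq_square power4_eq_xxxx)
  also have "\<dots> \<le> 1 * (a2 * B * H ^ 4)"
    using B0 by (intro mult_right_mono mult_nonneg_nonneg sum_nonneg) auto
  finally have mix: "\<bar>\<tau>\<^sup>2 / 12 * (\<Sum>k\<in>UNIV. (a $ k)\<^sup>2 * mix k)\<bar> \<le> a2 * B * H ^ 4" by simp
  have mix_sum: "(\<Sum>k\<in>UNIV. (a $ k)\<^sup>2 * mix k) = Lh a h (\<lambda>y. Dt 2 u (y, t)) x
      - (flux (t + \<tau>) x - 2 * flux t x + flux (t - \<tau>) x) / \<tau>\<^sup>2"
    by (simp add: mix_def Lh_def sum_subtractf sum.distrib sum_divide_distrib sum_distrib_left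
        add_divide_distrib diff_divide_distrib right_diff_distrib distrib_left mult_ac)
  have eq: "\<rho> x * ((u (x, t + \<tau>) - 2 * u (x, t) + u (x, t - \<tau>)) / \<tau>\<^sup>2) - rho_op \<rho> a h \<tau> (flux t) x
      - (f (x, t) + \<tau>\<^sup>2 / 12 * ((f (x, t + \<tau>) - 2 * f (x, t) + f (x, t - \<tau>)) / \<tau>\<^sup>2
          + Lh a h (\<lambda>y. f (y, t) / \<rho> y) x)) = \<rho> x * A - \<tau>\<^sup>2 / 12 * (\<Sum>k\<in>UNIV. (a $ k)\<^sup>2 * mix k)"
    unfolding mix_sum rho_op_def Lh_flux[OF x t(1)] pde[OF xc t(1)] pde[OF xc t(2)] pde[OF xc t(3)] A_def
    using \<tau> by (simp add: field_simps)
  have "\<bar>\<rho> x * A - \<tau>\<^sup>2 / 12 * (\<Sum>k\<in>UNIV. (a $ k)\<^sup>2 * mix k)\<bar> \<le> hi * (3 * B * H ^ 4) + a2 * B * H ^ 4"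
    using A mix by linarith
  then show ?thesis unfolding eq by (simp add: algebra_simps)
qed

text \<open>
  After insertion of the equation the residual is \<open>\<rho>\<close> times the error \<open>A\<close> of \<open>start_time\<close> divided by \<open>\<tau>\<close>,
  plus \<open>\<tau>/2\<close> times the weighted sum of the expressions in \<open>start_space\<close>.
\<close>

lemma residual_start:
  assumes B: "deriv_bound B" and w: "start_weights p \<theta> q" and x: "inner_pt h x"
    and \<tau>: "0 < \<tau>" "2 * \<tau> \<le> T" and H: "\<tau> \<le> H" "\<And>k. h $ k \<le> H"
  shows "\<bar>\<rho> x * ((u (x, \<tau>) - u (x, 0)) / \<tau>) - \<tau> / 2 * rho_op \<rho> a h \<tau> (flux 0) x
      - (\<rho> x * u\<^sub>1 x + \<tau>\<^sup>2 / 6 * Lh a h u\<^sub>1 x)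
      - \<tau> / 2 * (start_avg p \<theta> q \<tau> (\<lambda>t. f (x, t)) + \<tau>\<^sup>2 / 12 * Lh a h (\<lambda>y. f (y, 0) / \<rho> y) x)\<bar>
    \<le> (6 * hi * B + 12 * a2 * B) * H ^ 4"
proof -
  have xc: "x \<in> cbox 0 X" using x by (simp add: inner_pt_def)
  have B0: "0 \<le> B" using B by (simp add: deriv_bound_def)
  have hi: "0 \<le> \<rho> x" "\<rho> x \<le> hi" using rho_bounds[OF xc] lo_pos by auto
  have \<theta>: "0 \<le> \<theta> * \<tau>" "\<theta> * \<tau> \<le> \<tau>" using w \<tau> by (auto simp: start_weights_def mult_le_cancel_right1)
  have t: "0 \<in> {0..T}" "\<theta> * \<tau> \<in> {0..T}" "2 * \<tau> \<in> {0..T}"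
    unfolding atLeastAtMost_iff using \<theta> \<tau> by linarith+
  define A where "A = (u (x, \<tau>) - u (x, 0)) / \<tau> - Dt 1 u (x, 0) - \<tau> / 2 * start_avg p \<theta> q \<tau> (\<lambda>t. Dt 2 u (x, t))"
  define mix where "mix k = start_avg p \<theta> q \<tau> (\<lambda>t. Dx k 2 u (x, t)) - Dx k 2 u (x, 0)
     - \<tau> / 3 * Lam h k (\<lambda>y. Dt 1 u (y, 0)) x - \<tau>\<^sup>2 / 12 * Lam h k (\<lambda>y. Dt 2 u (y, 0)) x" for k
  have "\<bar>(u (x, \<tau>) - u (x, 0)) / \<tau> - (Dt 1 u (x, 0) + \<tau> / 2 * start_avg p \<theta> q \<tau> (\<lambda>t. Dt 2 u (x, t)))\<bar> \<le> 6 * B * \<tau> ^ 4"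
  proof (rule abs_divide_diff_le[OF \<tau>(1)])
    have eq: "u (x, \<tau>) - u (x, 0) - \<tau> * (Dt 1 u (x, 0) + \<tau> / 2 * start_avg p \<theta> q \<tau> (\<lambda>t. Dt 2 u (x, t)))
       = u (x, \<tau>) - u (x, 0) - \<tau> * Dt 1 u (x, 0) - \<tau>\<^sup>2 / 2 * start_avg p \<theta> q \<tau> (\<lambda>t. Dt 2 u (x, t))"
      by (simp add: algebra_simps power2_eq_square)
    have eq': "6 * B * \<tau> ^ 4 * \<tau> = 6 * B * \<tau> ^ 5" by (simp add: eval_nat_numeral)
    show "\<bar>u (x, \<tau>) - u (x, 0) - \<tau> * (Dt 1 u (x, 0) + \<tau> / 2 * start_avg p \<theta> q \<tau> (\<lambda>t. Dt 2 u (x, t)))\<bar>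
        \<le> 6 * B * \<tau> ^ 4 * \<tau>"
      unfolding eq eq' by (rule start_time[OF B w xc \<tau>])
  qed
  then have "\<bar>A\<bar> \<le> 6 * B * \<tau> ^ 4" by (simp add: A_def diff_diff_eq)
  also have "\<dots> \<le> 6 * B * H ^ 4" using B0 \<tau> H by (intro mult_left_mono power_mono) auto
  finally have A: "\<bar>\<rho> x * A\<bar> \<le> hi * (6 * B * H ^ 4)"
    unfolding abs_mult using hi by (intro mult_mono) auto
  have "\<bar>mix k\<bar> \<le> 24 * B * H ^ 3" for k
  proof -
    have "0 < h $ k" using x by (simp add: inner_pt_def)
    have "\<bar>mix k\<bar> \<le> 6 * B * \<tau> * (h $ k)\<^sup>2 + 18 * B * \<tau> ^ 3" unfolding mix_def by (rule start_space[OF B w x \<tau>])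
    also have "\<dots> \<le> 6 * B * H * H\<^sup>2 + 18 * B * H ^ 3"
      using B0 \<tau> H \<open>0 < h $ k\<close> by (intro mult_mono add_mono power_mono) (auto intro: less_imp_le)
    finally show ?thesis by (simp add: power2_eq_square power3_eq_cube)
  qed
  then have "\<bar>\<Sum>k\<in>UNIV. (a $ k)\<^sup>2 * mix k\<bar> \<le> a2 * (24 * B * H ^ 3)"
    by (rule abs_weighted_sum_le)
  then have "\<bar>\<tau> / 2 * (\<Sum>k\<in>UNIV. (a $ k)\<^sup>2 * mix k)\<bar> \<le> H / 2 * (a2 * (24 * B * H ^ 3))"
    unfolding abs_mult using \<tau> H by (intro mult_mono) auto
  also have "\<dots> = 12 * a2 * B * H ^ 4" by (simp add: power3_eq_cube power4_eq_xxxx)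
  finally have mix: "\<bar>\<tau> / 2 * (\<Sum>k\<in>UNIV. (a $ k)\<^sup>2 * mix k)\<bar> \<le> 12 * a2 * B * H ^ 4" .
  define avg where "avg = (\<Sum>k\<in>UNIV. (a $ k)\<^sup>2 * start_avg p \<theta> q \<tau> (\<lambda>t. Dx k 2 u (x, t)))"
  have mix_sum: "(\<Sum>k\<in>UNIV. (a $ k)\<^sup>2 * mix k) = avg - flux 0 x
      - \<tau> / 3 * Lh a h (\<lambda>y. Dt 1 u (y, 0)) x - \<tau>\<^sup>2 / 12 * Lh a h (\<lambda>y. Dt 2 u (y, 0)) x"
    by (simp add: mix_def avg_def Lh_def sum_subtractf sum_distrib_left right_diff_distrib mult_ac)
  have f_avg: "start_avg p \<theta> q \<tau> (\<lambda>t. f (x, t)) = \<rho> x * start_avg p \<theta> q \<tau> (\<lambda>t. Dt 2 u (x, t)) - avg"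
    unfolding start_avg_def avg_def pde[OF xc t(1)] pde[OF xc t(2)] pde[OF xc t(3)]
    by (simp add: algebra_simps sum.distrib sum_subtractf sum_distrib_left)
  have Lu1: "Lh a h u\<^sub>1 x = Lh a h (\<lambda>y. Dt 1 u (y, 0)) x"
    unfolding Lh_def using Lam_cong[OF u1_eq x] by simp
  have eq: "\<rho> x * ((u (x, \<tau>) - u (x, 0)) / \<tau>) - \<tau> / 2 * rho_op \<rho> a h \<tau> (flux 0) x
      - (\<rho> x * u\<^sub>1 x + \<tau>\<^sup>2 / 6 * Lh a h u\<^sub>1 x)
      - \<tau> / 2 * (start_avg p \<theta> q \<tau> (\<lambda>t. f (x, t)) + \<tau>\<^sup>2 / 12 * Lh a h (\<lambda>y. f (y, 0) / \<rho> y) x)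
     = \<rho> x * A + \<tau> / 2 * (\<Sum>k\<in>UNIV. (a $ k)\<^sup>2 * mix k)"
    unfolding mix_sum rho_op_def Lh_flux[OF x t(1)] f_avg Lu1 u1_eq[OF xc] A_def
    by (simp add: algebra_simps power2_eq_square)
  have "\<bar>\<rho> x * A + \<tau> / 2 * (\<Sum>k\<in>UNIV. (a $ k)\<^sup>2 * mix k)\<bar> \<le> hi * (6 * B * H ^ 4) + 12 * a2 * B * H ^ 4"
    using A mix by linarith
  then show ?thesis unfolding eq by (simp add: algebra_simps)
qed

end

section \<open>The error of the discrete solution\<close>

lemma mesh_subset_cbox:
  assumes X: "\<And>k. 0 < X $ k" and N: "\<And>k. 1 \<le> N k" and y: "y \<in> mesh N (mesh_step X N)"
  shows "y \<in> cbox 0 X"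
proof -
  obtain i where i: "y = (\<chi> k. real (i k) * mesh_step X N $ k)" "\<And>k. i k \<le> N k"
    using y by (auto simp: mesh_def)
  have "0 \<le> y $ k \<and> y $ k \<le> X $ k" for k
  proof -
    have y: "y $ k = X $ k * (real (i k) / real (N k))" by (simp add: i(1) mesh_step_def)
    have "real (i k) / real (N k) \<le> 1" using i(2)[of k] N[of k] by simp
    then have "X $ k * (real (i k) / real (N k)) \<le> X $ k * 1"
      using X[of k] by (intro mult_left_mono) auto
    then show ?thesis using X[of k] by (simp add: y)
  qed
  then show ?thesis by (simp add: mem_box_cart)
qed

lemma mesh_int_subset_mesh: "mesh_int N h \<subseteq> mesh N h"
  by (auto simp: mesh_int_def mesh_def less_imp_le)

locale discrete_solution =
  smooth_ibvp X a T lo hi \<rho> u\<^sub>0 u\<^sub>1 f g u + stable_scheme N h a \<rho> \<tau> \<epsilon> \<epsilon>\<^sub>0 lo hi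
  for N :: "'n::finite \<Rightarrow> nat" and h X a :: "real ^ 'n" and T lo hi :: real
    and \<rho> u\<^sub>0 u\<^sub>1 :: "real ^ 'n \<Rightarrow> real" and f g u :: "(real ^ 'n) \<times> real \<Rightarrow> real" and \<tau> \<epsilon> \<epsilon>\<^sub>0 :: real +
  fixes M :: nat and p \<theta> q :: real and v :: "nat \<Rightarrow> real ^ 'n \<Rightarrow> real"
    and vv :: "'n \<Rightarrow> nat \<Rightarrow> real ^ 'n \<Rightarrow> real"
  assumes h_eq: "h = mesh_step X N" and N_pos: "1 \<le> N k" and M: "2 \<le> M" and \<tau>_eq: "\<tau> = T / real M"
    and a_pos: "0 < a $ k" and weights: "start_weights p \<theta> q"
    and scheme: "scheme_solution X T a \<rho> f g u\<^sub>0 u\<^sub>1 N M (\<lambda>x. start_avg p \<theta> q \<tau> (\<lambda>t. f (x, t))) v vv"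
begin

lemma h_nth: "h $ k = X $ k / real (N k)"
  by (simp add: h_eq mesh_step_def)

lemma N_h: "real (N k) * h $ k = X $ k"
  using N_pos[of k] by (simp add: h_nth)

lemma M_\<tau>: "real M * \<tau> = T"
  using M by (simp add: \<tau>_eq)

lemma time_level: "m \<le> M \<Longrightarrow> real m * \<tau> \<in> {0..T}"
  using \<tau>_pos by (auto simp flip: M_\<tau>)

lemma mesh_subset: "y \<in> mesh N h \<Longrightarrow> y \<in> cbox 0 X"
  unfolding h_eq by (rule mesh_subset_cbox[OF X_pos N_pos])

lemma mesh_int_subset: "x \<in> S \<Longrightarrow> x \<in> mesh N h"
  using mesh_int_subset_mesh by blast

lemma neighbours: assumes "x \<in> S" shows "x + axis k (h $ k) \<in> mesh N h" "x - axis k (h $ k) \<in> mesh N h"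
proof -
  obtain i where i: "x = (\<chi> k. real (i k) * h $ k)" "\<And>k. 1 \<le> i k" "\<And>k. i k < N k"
    using assms by (auto simp: mesh_int_def)
  have "x + axis k (h $ k) = (\<chi> j. real ((i(k := i k + 1)) j) * h $ j)"
    by (simp add: i(1) vec_eq_iff axis_def algebra_simps)
  moreover have "\<forall>j. (i(k := i k + 1)) j \<le> N j" using i(3) by (simp add: less_imp_le Suc_leI)
  ultimately show "x + axis k (h $ k) \<in> mesh N h" unfolding mesh_def by blast
  have "x - axis k (h $ k) = (\<chi> j. real ((i(k := i k - 1)) j) * h $ j)"
    using i(2)[of k] by (simp add: i(1) vec_eq_iff axis_def of_nat_diff algebra_simps)
  moreover have "\<forall>j. (i(k := i k - 1)) j \<le> N j" using less_imp_le[OF i(3)] by (simp add: le_SucI le_diff_conv)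
  ultimately show "x - axis k (h $ k) \<in> mesh N h" unfolding mesh_def by blast
qed

lemma inner_pt_mesh_int: "x \<in> S \<Longrightarrow> inner_pt h x"
  by (simp add: inner_pt_def h_pos mesh_subset mesh_int_subset neighbours)

lemma mesh_bd_frontier: assumes "y \<in> mesh_bd N h" shows "y \<in> frontier (box 0 X)"
proof -
  obtain i where i: "y = (\<chi> k. real (i k) * h $ k)" "\<And>k. i k \<le> N k"
    using assms by (auto simp: mesh_bd_def mesh_def)
  have "\<not> (\<forall>k. 1 \<le> i k \<and> i k < N k)" using assms i(1) by (auto simp: mesh_bd_def mesh_int_def)
  then obtain k where "\<not> (1 \<le> i k \<and> i k < N k)" by blast
  with i(2)[of k] have "i k = 0 \<or> i k = N k" by auto
  then have "y $ k = 0 \<or> y $ k = X $ k" using N_h[of k] by (auto simp: i(1))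
  moreover have "y \<in> cbox 0 X" using assms by (auto simp: mesh_bd_def intro: mesh_subset)
  ultimately show ?thesis by (auto simp: mem_frontier)
qed

lemma zero_ext_mesh:
  assumes "\<And>y. y \<in> mesh_bd N h \<Longrightarrow> w y = 0" "y \<in> mesh N h" shows "Z w y = w y"
  using assms by (auto simp: zero_ext_def mesh_bd_def)

lemma stencil_cong:
  assumes "\<And>y. y \<in> mesh N h \<Longrightarrow> w y = w' y" "x \<in> S"
  shows "Lam h k w x = Lam h k w' x" "sN h k w x = sN h k w' x" "rho_op \<rho> a h \<tau> w x = rho_op \<rho> a h \<tau> w' x"
  using assms by (simp_all add: Lam_def sN_def rho_op_def Lh_def neighbours mesh_int_subset)

lemma rho_op_diff: "rho_op \<rho> a h \<tau> (\<lambda>y. w y - w' y) x = rho_op \<rho> a h \<tau> w x - rho_op \<rho> a h \<tau> w' x"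
proof -
  have "(\<lambda>y. (w y - w' y) / \<rho> y) = (\<lambda>y. w y / \<rho> y) - (\<lambda>y. w' y / \<rho> y)"
    by (simp add: fun_eq_iff diff_divide_distrib)
  then have "Lh a h (\<lambda>y. (w y - w' y) / \<rho> y) x = Lh a h (\<lambda>y. w y / \<rho> y) x - Lh a h (\<lambda>y. w' y / \<rho> y) x"
    by (simp add: Lh_def linear_diff[OF linear_Lam] right_diff_distrib sum_subtractf)
  then show ?thesis by (simp add: rho_op_def right_diff_distrib)
qed

definition err :: "nat \<Rightarrow> real ^ 'n \<Rightarrow> real" where
  "err m x = u (x, real m * \<tau>) - v m x"

definition err2 :: "'n \<Rightarrow> nat \<Rightarrow> real ^ 'n \<Rightarrow> real" where
  "err2 k m x = Dx k 2 u (x, real m * \<tau>) - vv k m x"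

definition res2 :: "'n \<Rightarrow> nat \<Rightarrow> real ^ 'n \<Rightarrow> real" where
  "res2 k m x = sN h k (\<lambda>y. Dx k 2 u (y, real m * \<tau>)) x - Lam h k (\<lambda>y. u (y, real m * \<tau>)) x"

text \<open>
  The residual of the exact solution in the main equation; \<open>m = 0\<close> stands for the equation of the first
  step.
\<close>

definition res :: "nat \<Rightarrow> real ^ 'n \<Rightarrow> real" where
  "res m x = (if m = 0 then
     \<rho> x * ((u (x, \<tau>) - u (x, 0)) / \<tau>) - \<tau> / 2 * rho_op \<rho> a h \<tau> (flux 0) x - u1_h \<rho> a h \<tau> u\<^sub>1 x
       - \<tau> / 2 * f_h0 \<rho> a h \<tau> f (\<lambda>x. start_avg p \<theta> q \<tau> (\<lambda>t. f (x, t))) x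
     else \<rho> x * Lam_t \<tau> (\<lambda>j. u (x, real j * \<tau>)) m - rho_op \<rho> a h \<tau> (flux (real m * \<tau>)) x - f_h \<rho> a h \<tau> f m x)"

text \<open>
  The part of \<open>\<Sum> a\<^sub>k\<^sup>2 (\<partial>\<^sub>k\<^sup>2 u - v\<^sub>k\<^sub>k)\<close> that is caused by the residuals of the compact approximations,
  see \<open>zero_ext_flux_error\<close>.
\<close>

definition flux_res :: "nat \<Rightarrow> real ^ 'n \<Rightarrow> real" where
  "flux_res m = (\<Sum>k\<in>UNIV. (a $ k)\<^sup>2 *\<^sub>R sHinv k (res2 k m))"

lemma scheme_eqs:
  shows scheme_step: "1 \<le> m \<Longrightarrow> m < M \<Longrightarrow> x \<in> S \<Longrightarrow>
      \<rho> x * Lam_t \<tau> (\<lambda>j. v j x) m - rho_op \<rho> a h \<tau> (\<lambda>x. \<Sum>k\<in>UNIV. (a $ k)\<^sup>2 * vv k m x) x = f_h \<rho> a h \<tau> f m x"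
    and scheme_vv: "m < M \<Longrightarrow> x \<in> S \<Longrightarrow> sN h k (vv k m) x = Lam h k (v m) x"
    and scheme_start: "x \<in> S \<Longrightarrow> \<rho> x * delta_t \<tau> (\<lambda>j. v j x) 0 =
      \<tau> / 2 * rho_op \<rho> a h \<tau> (\<lambda>x. \<Sum>k\<in>UNIV. (a $ k)\<^sup>2 * vv k 0 x) x + u1_h \<rho> a h \<tau> u\<^sub>1 x
        + \<tau> / 2 * f_h0 \<rho> a h \<tau> f (\<lambda>x. start_avg p \<theta> q \<tau> (\<lambda>t. f (x, t))) x"
    and scheme_v_bd: "1 \<le> m \<Longrightarrow> m \<le> M \<Longrightarrow> y \<in> mesh_bd N h \<Longrightarrow> v m y = g (y, real m * \<tau>)"
    and scheme_vv_bd: "m < M \<Longrightarrow> y \<in> mesh_bd N h \<Longrightarrow> (a $ k)\<^sup>2 * vv k m y = g_bd X T a \<rho> f g k y (real m * \<tau>)"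
    and scheme_v0: "y \<in> mesh N h \<Longrightarrow> v 0 y = u\<^sub>0 y"
  using scheme unfolding scheme_solution_def Let_def h_eq[symmetric] \<tau>_eq[symmetric] by auto

lemma err_0: "y \<in> mesh N h \<Longrightarrow> err 0 y = 0"
  by (simp add: err_def scheme_v0 u0_eq mesh_subset)

lemma err_bd: assumes "m \<le> M" "y \<in> mesh_bd N h" shows "err m y = 0"
proof (cases "m = 0")
  case True
  then show ?thesis using err_0 assms by (auto simp: mesh_bd_def)
next
  case False
  then show ?thesis using scheme_v_bd[of m y] assms g_eq[of "(y, real m * \<tau>)"] mesh_bd_frontier[of y] time_level[of m]
    by (simp add: err_def)
qed

lemma err2_bd: assumes "m < M" "y \<in> mesh_bd N h" shows "err2 k m y = 0"
proof -
  have "(a $ k)\<^sup>2 * vv k m y = (a $ k)\<^sup>2 * Dx k 2 u (y, real m * \<tau>)"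
    using scheme_vv_bd[OF assms, of k] g_bd_eq[OF mesh_bd_frontier[OF assms(2)] time_level, of m k] assms(1) by simp
  moreover have "(a $ k)\<^sup>2 \<noteq> 0" using a_pos[of k] by simp
  ultimately show ?thesis by (simp add: err2_def)
qed

text \<open>
  Both \<open>e\<close> and \<open>e\<^sub>k\<^sub>k\<close> vanish on the boundary, so \<open>s\<^sub>k\<^sub>N e\<^sub>k\<^sub>k = \<Lambda>\<^sub>k e + r\<^sub>k\<close> is an equation in \<open>H\<^sub>h\<close> and can
  be solved there.
\<close>

lemma zero_ext_err2: assumes m: "m < M"
  shows "Z (err2 k m) = sHinv k (res2 k m) - sHinv k (nLam k (Z (err m)))"
proof -
  have "sHinv k (res2 k m - nLam k (Z (err m))) = Z (err2 k m)"
  proof (rule sHinv_eqI)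
    show "sH k (Z (err2 k m)) = Z (res2 k m - nLam k (Z (err m)))"
    proof
      fix x
      show "sH k (Z (err2 k m)) x = Z (res2 k m - nLam k (Z (err m))) x"
      proof (cases "x \<in> S")
        case True
        have "sN h k (Z (err2 k m)) x = sN h k (err2 k m) x"
          by (rule stencil_cong(2)[OF _ True]) (simp add: zero_ext_mesh err2_bd[OF m])
        also have "\<dots> = sN h k (\<lambda>y. Dx k 2 u (y, real m * \<tau>)) x - Lam h k (v m) x"
          unfolding scheme_vv[OF m True, symmetric] by (simp add: sN_def err2_def diff_divide_distrib[symmetric])
        finally have 1: "sN h k (Z (err2 k m)) x = sN h k (\<lambda>y. Dx k 2 u (y, real m * \<tau>)) x - Lam h k (v m) x" .
        have "Lam h k (Z (err m)) x = Lam h k (err m) x"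
          by (rule stencil_cong(1)[OF _ True]) (use m in \<open>simp add: zero_ext_mesh err_bd\<close>)
        also have "\<dots> = Lam h k (\<lambda>y. u (y, real m * \<tau>)) x - Lam h k (v m) x"
          by (simp add: Lam_def err_def diff_divide_distrib[symmetric])
        finally have 2: "Lam h k (Z (err m)) x = Lam h k (\<lambda>y. u (y, real m * \<tau>)) x - Lam h k (v m) x" .
        show ?thesis using True 1 2 by (simp add: sH_def nLam_def res2_def zero_ext_def[of N h _ x])
      qed (simp add: sH_def zero_ext_def)
    qed
  qed simp
  then show ?thesis by (simp add: linear_diff[OF linear_sHinv])
qed

lemma zero_ext_flux_error: assumes m: "m < M"
  shows "Z (\<lambda>x. \<Sum>k\<in>UNIV. (a $ k)\<^sup>2 * err2 k m x) = flux_res m - Eh a N h (Z (err m))"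
proof -
  have "Z (\<lambda>x. \<Sum>k\<in>UNIV. (a $ k)\<^sup>2 * err2 k m x) = (\<Sum>k\<in>UNIV. (a $ k)\<^sup>2 *\<^sub>R Z (err2 k m))"
    by (auto simp: fun_eq_iff zero_ext_def)
  then show ?thesis
    by (simp add: zero_ext_err2[OF m] flux_res_def Eh_eq scaleR_diff_right sum_subtractf)
qed

lemma rho_op_flux_error: assumes m: "m < M" and x: "x \<in> S"
  shows "rho_op \<rho> a h \<tau> (flux_res m - Eh a N h (Z (err m))) x
    = rho_op \<rho> a h \<tau> (flux (real m * \<tau>)) x - rho_op \<rho> a h \<tau> (\<lambda>x. \<Sum>k\<in>UNIV. (a $ k)\<^sup>2 * vv k m x) x"
proof -
  let ?e = "\<lambda>x. \<Sum>k\<in>UNIV. (a $ k)\<^sup>2 * err2 k m x"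
  have "rho_op \<rho> a h \<tau> (flux_res m - Eh a N h (Z (err m))) x = rho_op \<rho> a h \<tau> ?e x"
    unfolding zero_ext_flux_error[OF m, symmetric]
    by (rule stencil_cong(3)[OF _ x]) (rule zero_ext_mesh, simp_all add: err2_bd[OF m])
  also have "?e = (\<lambda>y. flux (real m * \<tau>) y - (\<Sum>k\<in>UNIV. (a $ k)\<^sup>2 * vv k m y))"
    by (simp add: err2_def right_diff_distrib sum_subtractf)
  finally have eq: "rho_op \<rho> a h \<tau> (flux_res m - Eh a N h (Z (err m))) x
    = rho_op \<rho> a h \<tau> (\<lambda>y. flux (real m * \<tau>) y - (\<Sum>k\<in>UNIV. (a $ k)\<^sup>2 * vv k m y)) x" .
  show ?thesis unfolding eq by (rule rho_op_diff)
qed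

text \<open>
  There are at most \<open>N\<^sub>1 \<dots> N\<^sub>n\<close> interior nodes and \<open>N\<^sub>k h\<^sub>k = X\<^sub>k\<close>.
\<close>

lemma norm_le_sup:
  assumes "\<And>x. x \<in> S \<Longrightarrow> \<bar>w x\<bar> \<le> c" "0 \<le> c"
  shows "sqrt (ip w w) \<le> sqrt (\<Prod>k\<in>UNIV. X $ k) * c"
proof -
  have "card S \<le> (\<Prod>k\<in>UNIV. N k)"
  proof -
    have "S \<subseteq> (\<lambda>i. (\<chi> k. real (i k) * h $ k)) ` PiE UNIV (\<lambda>k. {..<N k})"
      by (auto simp: mesh_int_def PiE_UNIV_domain)
    moreover have "finite (PiE (UNIV :: 'n set) (\<lambda>k. {..<N k}))" by (intro finite_PiE) auto
    ultimately have "card S \<le> card (PiE (UNIV :: 'n set) (\<lambda>k. {..<N k}))" by (rule surj_card_le[rotated])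
    then show ?thesis by (simp add: card_PiE)
  qed
  then have "real (card S) \<le> (\<Prod>k\<in>UNIV. real (N k))" by (metis of_nat_le_iff of_nat_prod)
  then have "(\<Prod>k\<in>UNIV. h $ k) * real (card S) \<le> (\<Prod>k\<in>UNIV. h $ k) * (\<Prod>k\<in>UNIV. real (N k))"
    using prod_h_pos by (intro mult_left_mono) auto
  also have "\<dots> = (\<Prod>k\<in>UNIV. X $ k)" by (simp add: N_h mult.commute[of "h $ _"] flip: prod.distrib)
  finally have vol: "(\<Prod>k\<in>UNIV. h $ k) * real (card S) \<le> (\<Prod>k\<in>UNIV. X $ k)" .
  have "ip w w \<le> (\<Prod>k\<in>UNIV. h $ k) * (\<Sum>x\<in>S. c\<^sup>2)"
    unfolding inner_h_def using prod_h_pos assms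
    by (intro mult_left_mono sum_mono) (auto simp: power2_eq_square[symmetric] abs_le_square_iff[symmetric])
  also have "\<dots> = ((\<Prod>k\<in>UNIV. h $ k) * real (card S)) * c\<^sup>2" by simp
  also have "\<dots> \<le> (\<Prod>k\<in>UNIV. X $ k) * c\<^sup>2" by (intro mult_right_mono vol) simp
  finally have "sqrt (ip w w) \<le> sqrt ((\<Prod>k\<in>UNIV. X $ k) * c\<^sup>2)" by (rule real_sqrt_le_mono)
  then show ?thesis using assms(2) by (simp add: real_sqrt_mult)
qed

lemma norm_sum_le: "sqrt (ip (\<Sum>k\<in>A. w k) (\<Sum>k\<in>A. w k)) \<le> (\<Sum>k\<in>A. sqrt (ip (w k) (w k)))"
proof (induction A rule: infinite_finite_induct)
  case (insert k A)
  show ?case unfolding sum.insert[OF insert.hyps]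
    by (rule order_trans[OF psd_form_triangle[OF psd_form_ip] add_left_mono[OF insert.IH]])
qed (simp_all add: inner_h_def)

definition res_const :: "real \<Rightarrow> real" where
  "res_const B = sqrt (\<Prod>k\<in>UNIV. X $ k) * (6 * hi * B + 12 * a2 * B)"

lemma \<tau>_le_norm: "\<tau> \<le> norm (h, \<tau>)" and h_le_norm: "h $ k \<le> norm (h, \<tau>)"
proof -
  show "\<tau> \<le> norm (h, \<tau>)" using norm_snd_le[of \<tau> h] \<tau>_pos by simp
  have "h $ k \<le> norm h" using component_le_norm_cart[of h k] by simp
  also have "\<dots> \<le> norm (h, \<tau>)" using norm_fst_le[of h \<tau>] by simp
  finally show "h $ k \<le> norm (h, \<tau>)" .
qed

lemma res_bound: assumes B: "deriv_bound B" and m: "m < M"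
  shows "sqrt (ip (res m) (res m)) \<le> res_const B * norm (h, \<tau>) ^ 4"
proof -
  let ?H = "norm (h, \<tau>)" and ?A = a2
  have B0: "0 \<le> B" using B by (simp add: deriv_bound_def)
  have A0: "0 \<le> ?A" by (simp add: sum_nonneg)
  have hi: "0 \<le> hi" using lo_pos lo_hi by simp
  have "\<bar>res m x\<bar> \<le> (6 * hi * B + 12 * ?A * B) * ?H ^ 4" if x: "x \<in> S" for x
  proof (cases "m = 0")
    case True
    have "2 * \<tau> \<le> real M * \<tau>" using M \<tau>_pos by (intro mult_right_mono) auto
    then have "2 * \<tau> \<le> T" by (simp add: M_\<tau>)
    from residual_start[OF B weights inner_pt_mesh_int[OF x] \<tau>_pos this \<tau>_le_norm h_le_norm]
    show ?thesis using True by (simp add: res_def u1_h_def f_h0_def)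
  next
    case False
    define t where "t = real m * \<tau>"
    have lv: "real (Suc m) * \<tau> = t + \<tau>" "real (m - 1) * \<tau> = t - \<tau>"
      using False by (simp_all add: t_def of_nat_diff algebra_simps)
    have t: "t \<in> {0..T}" "t + \<tau> \<in> {0..T}" "t - \<tau> \<in> {0..T}"
      using time_level[of m] time_level[of "Suc m"] time_level[of "m - 1"] m lv by (simp_all add: t_def)
    have "\<bar>res m x\<bar> \<le> (3 * hi * B + ?A * B) * ?H ^ 4"
      using residual_step[OF B inner_pt_mesh_int[OF x] \<tau>_pos t \<tau>_le_norm h_le_norm] False
      by (simp only: res_def f_h_def Lam_t_def Suc_eq_plus1[symmetric] lv t_def[symmetric] if_False)
    also have "\<dots> \<le> (6 * hi * B + 12 * ?A * B) * ?H ^ 4"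
      using A0 B0 hi by (intro mult_right_mono add_mono) (auto intro!: mult_right_mono)
    finally show ?thesis .
  qed
  then have "sqrt (ip (res m) (res m)) \<le> sqrt (\<Prod>k\<in>UNIV. X $ k) * ((6 * hi * B + 12 * ?A * B) * ?H ^ 4)"
    using A0 B0 hi by (intro norm_le_sup) auto
  then show ?thesis by (simp add: res_const_def)
qed

lemma flux_res_bound: assumes B: "deriv_bound B" and m: "m < M"
  shows "sqrt (ip (flux_res m) (flux_res m)) \<le> res_const B * norm (h, \<tau>) ^ 4"
proof -
  let ?H = "norm (h, \<tau>)" and ?A = a2 and ?v = "sqrt (\<Prod>k\<in>UNIV. X $ k)"
  have B0: "0 \<le> B" using B by (simp add: deriv_bound_def)
  have hi: "0 \<le> hi" using lo_pos lo_hi by simp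
  have A0: "0 \<le> ?A" by (simp add: sum_nonneg)
  have v0: "0 \<le> ?v" using X_pos by (intro real_sqrt_ge_zero prod_nonneg) (auto intro: less_imp_le)
  have sHinv_le: "sqrt (ip (sHinv k (res2 k m)) (sHinv k (res2 k m))) \<le> 3 / 2 * (?v * (3 * B * ?H ^ 4))" for k
  proof -
    have "\<bar>res2 k m x\<bar> \<le> 3 * B * ?H ^ 4" if x: "x \<in> S" for x
    proof -
      have "\<bar>res2 k m x\<bar> \<le> 3 * B * (h $ k) ^ 4"
        unfolding res2_def using m by (intro numerov_space[OF B inner_pt_mesh_int[OF x]] time_level) simp
      also have "\<dots> \<le> 3 * B * ?H ^ 4"
        using B0 h_pos[of k] by (intro mult_left_mono power_mono h_le_norm) auto
      finally show ?thesis .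
    qed
    then have "sqrt (ip (res2 k m) (res2 k m)) \<le> ?v * (3 * B * ?H ^ 4)"
      using B0 by (intro norm_le_sup) auto
    then show ?thesis using norm_sHinv_le[of k "res2 k m"] by simp
  qed
  have "sqrt (ip (flux_res m) (flux_res m)) \<le> (\<Sum>k\<in>UNIV. (a $ k)\<^sup>2 * sqrt (ip (sHinv k (res2 k m)) (sHinv k (res2 k m))))"
    using norm_sum_le[of "\<lambda>k. (a $ k)\<^sup>2 *\<^sub>R sHinv k (res2 k m)" UNIV]
    unfolding flux_res_def by (simp only: psd_form_scale_sqrt[OF psd_form_ip] zero_le_power2)
  also have "\<dots> \<le> (\<Sum>k\<in>UNIV. (a $ k)\<^sup>2 * (3 / 2 * (?v * (3 * B * ?H ^ 4))))"
    by (intro sum_mono mult_left_mono sHinv_le) simp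
  also have "\<dots> = ?A * (3 / 2 * (?v * (3 * B * ?H ^ 4)))" by (simp only: sum_distrib_right)
  also have "\<dots> = ?v * (9 / 2 * ?A * B) * ?H ^ 4" by simp
  also have "\<dots> \<le> ?v * (6 * hi * B + 12 * ?A * B) * ?H ^ 4"
  proof (intro mult_right_mono mult_left_mono v0)
    have "9 / 2 * ?A * B \<le> 12 * ?A * B" using A0 B0 by (intro mult_right_mono) auto
    also have "\<dots> \<le> 6 * hi * B + 12 * ?A * B" using hi B0 by simp
    finally show "9 / 2 * ?A * B \<le> 6 * hi * B + 12 * ?A * B" .
  qed simp
  finally show ?thesis by (simp add: res_const_def)
qed

lemma scheme_error_of_exact_solution:
  assumes B: "deriv_bound B"
  shows "scheme_error N h a \<rho> \<tau> \<epsilon> \<epsilon>\<^sub>0 lo hi M T (res_const B * norm (h, \<tau>) ^ 4) (\<lambda>m. Z (err m)) flux_res res"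
proof (intro scheme_error.intro scheme_error_axioms.intro)
  show "stable_scheme N h a \<rho> \<tau> \<epsilon> \<epsilon>\<^sub>0 lo hi" by (rule stable_scheme_axioms)
  show "2 \<le> M" by (rule M)
  show "real M * \<tau> = T" by (rule M_\<tau>)
  show "Z (err m) \<in> V" for m by simp
  show "flux_res m \<in> V" for m
    unfolding flux_res_def by (intro subspace_sum subspace_Hh Hh_closed sHinv_in_Hh)
  show "Z (err 0) = 0" using err_0 mesh_int_subset by (auto simp: zero_ext_def fun_eq_iff)
  show "sqrt (ip (flux_res m) (flux_res m)) \<le> res_const B * norm (h, \<tau>) ^ 4" if "m < M" for m
    by (rule flux_res_bound[OF B that])
  show "sqrt (ip (res m) (res m)) \<le> res_const B * norm (h, \<tau>) ^ 4" if "m < M" for m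
    by (rule res_bound[OF B that])
next
  fix m x assume m: "1 \<le> m" "m < M" and x: "x \<in> S"
  have "\<rho> x * (Z (err (m + 1)) x - 2 * Z (err m) x + Z (err (m - 1)) x) / \<tau>\<^sup>2
      = \<rho> x * Lam_t \<tau> (\<lambda>j. u (x, real j * \<tau>)) m - \<rho> x * Lam_t \<tau> (\<lambda>j. v j x) m"
    using x \<tau>_pos by (simp add: zero_ext_def err_def Lam_t_def field_simps)
  then show "\<rho> x * (Z (err (m + 1)) x - 2 * Z (err m) x + Z (err (m - 1)) x) / \<tau>\<^sup>2
      = rho_op \<rho> a h \<tau> (flux_res m - Eh a N h (Z (err m))) x + res m x"
    using scheme_step[OF m x] rho_op_flux_error[OF m(2) x] m by (simp add: res_def)
next
  fix x assume x: "x \<in> S"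
  have "0 < M" using M by simp
  have "\<rho> x * (Z (err 1) x - Z (err 0) x) / \<tau>
      = \<rho> x * ((u (x, \<tau>) - u (x, 0)) / \<tau>) - \<rho> x * delta_t \<tau> (\<lambda>j. v j x) 0"
    using x \<tau>_pos by (simp add: zero_ext_def err_def delta_t_def field_simps)
  then show "\<rho> x * (Z (err 1) x - Z (err 0) x) / \<tau>
      = \<tau> / 2 * rho_op \<rho> a h \<tau> (flux_res 0 - Eh a N h (Z (err 0))) x + res 0 x"
    using scheme_start[OF x] rho_op_flux_error[OF \<open>0 < M\<close> x] by (simp add: res_def right_diff_distrib)
qed

text \<open>
  At the interior nodes the three error terms only see the values of \<open>e\<close> on the mesh, where \<open>e\<close> agrees
  with its extension by 0.
\<close>

lemma error_estimate:
  assumes B: "deriv_bound B" and m: "1 \<le> m" "m \<le> M"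
  shows "sqrt \<epsilon> * \<epsilon>\<^sub>0 * (norm_h N h (\<lambda>x. delta_bar_t \<tau> (\<lambda>j. err j x) m) + norm_H1 a N h (err m)
      + sqrt \<epsilon> * norm_h N h (\<lambda>x. I_t \<tau> (\<lambda>l. Lh a h (err l) x) m))
    \<le> stability_const lo hi T * res_const B * norm (h, \<tau>) ^ 4"
proof -
  interpret se: scheme_error N h a \<rho> \<tau> \<epsilon> \<epsilon>\<^sub>0 lo hi M T "res_const B * norm (h, \<tau>) ^ 4" "\<lambda>m. Z (err m)" flux_res res
    by (rule scheme_error_of_exact_solution[OF B])
  have Lh_err: "Lh a h (err l) x = - nLh a (Z (err l)) x" if "l \<le> M" "x \<in> S" for l x
  proof -
    have "Lh a h (err l) x = Lh a h (Z (err l)) x"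
      unfolding Lh_def using that
      by (intro sum.cong arg_cong2[of _ _ _ _ "(*)"] refl stencil_cong(1)) (simp_all add: zero_ext_mesh err_bd)
    also have "\<dots> = - nLh a (Z (err l)) x"
      using zero_ext_Lh[of a "Z (err l)", THEN fun_cong, of x] that by (simp add: zero_ext_def[of N h _ x])
    finally show ?thesis .
  qed
  have 1: "norm_h N h (\<lambda>x. delta_bar_t \<tau> (\<lambda>j. err j x) m) = norm_h N h (se.b m)"
    by (simp add: norm_h_def se.b_def zero_ext_def delta_bar_t_def cong: sum.cong)
  have 2: "norm_H1 a N h (err m) = sqrt (ip (nLh a (Z (err m))) (Z (err m)))"
    using m by (simp add: norm_H1_def inner_h_def Lh_err zero_ext_def[of N h "err m" for m] cong: sum.cong)
  have 3: "norm_h N h (\<lambda>x. I_t \<tau> (\<lambda>l. Lh a h (err l) x) m) = norm_h N h (nLh a (\<tau> *\<^sub>R (\<Sum>l=1..m. Z (err l))))"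
  proof -
    have "(I_t \<tau> (\<lambda>l. Lh a h (err l) x) m)\<^sup>2 = (nLh a (\<tau> *\<^sub>R (\<Sum>l=1..m. Z (err l))) x)\<^sup>2" if x: "x \<in> S" for x
    proof -
      have "I_t \<tau> (\<lambda>l. Lh a h (err l) x) m = \<tau> * (\<Sum>l=1..m. - nLh a (Z (err l)) x)"
        unfolding I_t_def using m x by (intro arg_cong[of _ _ "(*) \<tau>"] sum.cong) (auto simp: Lh_err)
      also have "\<dots> = - nLh a (\<tau> *\<^sub>R (\<Sum>l=1..m. Z (err l))) x"
        by (simp only: linear_scale[OF linear_nLh] linear_sum[OF linear_nLh] scaleR_fun_apply sum_fun_apply sum_negf)
          simp
      finally show ?thesis by simp
    qed
    then show ?thesis by (simp add: norm_h_def)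
  qed
  show ?thesis using se.error_bound[OF m] unfolding 1 2 3 by (simp add: mult.assoc)
qed

end

lemma f_d0_three_level_eq: "f_d0_three_level \<tau> f = (\<lambda>x. start_avg (1 / 2) 1 (- 1 / 12) \<tau> (\<lambda>t. f (x, t)))"
  by (simp add: f_d0_three_level_def start_avg_def fun_eq_iff field_simps)

lemma f_d0_half_step_eq: "f_d0_half_step \<tau> f = (\<lambda>x. start_avg (2 / 3) (1 / 2) 0 \<tau> (\<lambda>t. f (x, t)))"
  by (simp add: f_d0_half_step_def start_avg_def fun_eq_iff field_simps)

theorem theorem2:
  "\<exists>K. \<forall>(X :: real ^ 'n::finite) (a :: real ^ 'n) T \<rho> \<rho>_lo \<rho>_hi f g u\<^sub>0 u\<^sub>1 u.
     (\<forall>k. 0 < X $ k) \<and> 0 < T \<and> (\<forall>k. 0 < a $ k) \<and>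
     0 < \<rho>_lo \<and> (\<forall>x\<in>cbox 0 X. \<rho>_lo \<le> \<rho> x \<and> \<rho> x \<le> \<rho>_hi) \<and>
     Ck_on K (cbox 0 X) \<rho> \<and> Ck_on K (cbox 0 X \<times> {0..T}) u \<and>
     ibvp_solution X T a \<rho> f g u\<^sub>0 u\<^sub>1 u \<longrightarrow>
     (\<exists>C. \<forall>(N :: 'n \<Rightarrow> nat) (M :: nat) \<epsilon> \<epsilon>\<^sub>0 fd v vv h ht e.
        h = mesh_step X N \<and> ht = T / real M \<and> (\<forall>m x. e m x = u (x, real m * ht) - v m x) \<and>
        (\<forall>k. 1 \<le> N k) \<and> 2 \<le> M \<and>
        0 < \<epsilon> \<and> \<epsilon> < 1 \<and> 0 < \<epsilon>\<^sub>0 \<and> \<epsilon>\<^sub>0 < 1 \<and>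
        1 / 3 * ht\<^sup>2 * (\<Sum>k\<in>UNIV. (a $ k)\<^sup>2 / (h $ k)\<^sup>2) \<le> (1 - \<epsilon>) * \<rho>_lo \<and>
        op_le N h (\<lambda>w x. 1 / 4 * ht\<^sup>2 * Eh a N h w x) (\<lambda>w x. (1 - \<epsilon>\<^sub>0\<^sup>2) * \<rho>_lo * w x) \<and>
        (fd = f_d0_three_level ht f \<or> fd = f_d0_half_step ht f) \<and>
        scheme_solution X T a \<rho> f g u\<^sub>0 u\<^sub>1 N M fd v vv \<longrightarrow>
        sqrt \<epsilon> * \<epsilon>\<^sub>0 *
          Max ((\<lambda>m. norm_h N h (\<lambda>x. delta_bar_t ht (\<lambda>j. e j x) m)
                    + norm_H1 a N h (e m)
                    + sqrt \<epsilon> * norm_h N h (\<lambda>x. I_t ht (\<lambda>l. Lh a h (e l) x) m)) ` {1..M})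
          \<le> C * norm (h, ht) ^ 4)"
proof (rule exI[of _ 6], intro allI impI, goal_cases)
  \<comment> \<open>Six is the order of the highest derivative, in the Numerov and mixed remainders.\<close>
  case (1 X a T \<rho> \<rho>_lo \<rho>_hi f g u\<^sub>0 u\<^sub>1 u)
  note A = this
  interpret smooth_ibvp X a T \<rho>_lo \<rho>_hi \<rho> u\<^sub>0 u\<^sub>1 f g u
  proof
    show "continuous_on (cbox 0 X) \<rho>" using A Ck_on_continuous by blast
  qed (use A in \<open>simp_all del: Ck_on.simps\<close>)
  obtain B where B: "deriv_bound B" using ex_deriv_bound by blast
  have "0 \<in> cbox 0 X" using A by (auto simp: mem_box_cart less_imp_le)
  then have lo_hi: "\<rho>_lo \<le> \<rho>_hi" using A by force
  define C where "C = stability_const \<rho>_lo \<rho>_hi T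
    * (sqrt (\<Prod>k\<in>UNIV. X $ k) * (6 * \<rho>_hi * B + 12 * (\<Sum>k\<in>UNIV. (a $ k)\<^sup>2) * B))"
  show ?case
  proof (intro exI[of _ C] allI impI, goal_cases)
    case (1 N M \<epsilon> \<epsilon>\<^sub>0 fd v vv h ht e)
    note H = this
    obtain p \<theta> q where weights: "start_weights p \<theta> q" and fd: "fd = (\<lambda>x. start_avg p \<theta> q ht (\<lambda>t. f (x, t)))"
    proof -
      have "start_weights (1 / 2) 1 (- 1 / 12)" "start_weights (2 / 3) (1 / 2) 0"
        by (simp_all add: start_weights_def power2_eq_square)
      moreover have "fd = f_d0_three_level ht f \<or> fd = f_d0_half_step ht f" using H by blast
      ultimately show ?thesis using that unfolding f_d0_three_level_eq f_d0_half_step_eq by blast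
    qed
    have X: "0 < X $ k" and N: "1 \<le> N k" and h: "h = mesh_step X N" and M: "2 \<le> M" for k
      using A H by blast+
    have in_box: "x \<in> cbox 0 X" if "x \<in> mesh_int N h" for x
      by (rule mesh_subset_cbox[of X N, OF X N]) (use mesh_int_subset_mesh that h in blast)
    interpret discrete_solution N h X a T \<rho>_lo \<rho>_hi \<rho> u\<^sub>0 u\<^sub>1 f g u ht \<epsilon> \<epsilon>\<^sub>0 M p \<theta> q v vv
    proof unfold_locales
      show "0 < h $ k" for k using X[of k] N[of k] by (simp add: h mesh_step_def)
      show "\<rho>_lo \<le> \<rho> x" "\<rho> x \<le> \<rho>_hi" if "x \<in> mesh_int N h" for x using rho_bounds[OF in_box[OF that]] by auto
      show "0 < ht" using T_pos M H by simp
      show "scheme_solution X T a \<rho> f g u\<^sub>0 u\<^sub>1 N M (\<lambda>x. start_avg p \<theta> q ht (\<lambda>t. f (x, t))) v vv"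
        using H unfolding fd by blast
      show "0 < \<rho>_lo" "0 < a $ k" "0 < \<epsilon>" "\<epsilon> < 1" "0 < \<epsilon>\<^sub>0" "\<epsilon>\<^sub>0 < 1"
        "1 / 3 * ht\<^sup>2 * (\<Sum>k\<in>UNIV. (a $ k)\<^sup>2 / (h $ k)\<^sup>2) \<le> (1 - \<epsilon>) * \<rho>_lo" "ht = T / real M" for k
        using A H by blast+
      show "ht\<^sup>2 / 4 * inner_h N h (Eh a N h w) w \<le> (1 - \<epsilon>\<^sub>0\<^sup>2) * \<rho>_lo * inner_h N h w w" if "w \<in> Hh N h" for w
      proof -
        have scale: "inner_h N h (\<lambda>x. c * z x) w = c * inner_h N h z w" for c z
          by (simp add: inner_h_def sum_distrib_left mult_ac)
        have "inner_h N h (\<lambda>x. 1 / 4 * ht\<^sup>2 * Eh a N h w x) w \<le> inner_h N h (\<lambda>x. (1 - \<epsilon>\<^sub>0\<^sup>2) * \<rho>_lo * w x) w"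
          using H that unfolding op_le_def by blast
        then show ?thesis unfolding scale by simp
      qed
    qed (fact h N M lo_hi weights)+
    have e: "e = err" unfolding fun_eq_iff err_def using H by blast
    let ?F = "\<lambda>m. norm_h N h (\<lambda>x. delta_bar_t ht (\<lambda>j. err j x) m) + norm_H1 a N h (err m)
        + sqrt \<epsilon> * norm_h N h (\<lambda>x. I_t ht (\<lambda>l. Lh a h (err l) x) m)"
    have "Max (?F ` {1..M}) \<in> ?F ` {1..M}" using M by (intro Max_in) auto
    then obtain m where m: "1 \<le> m" "m \<le> M" "Max (?F ` {1..M}) = ?F m" by auto
    have "sqrt \<epsilon> * \<epsilon>\<^sub>0 * ?F m \<le> C * norm (h, ht) ^ 4"
      using error_estimate[OF B m(1,2)] unfolding C_def res_const_def .
    then show ?case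
      unfolding e m(3) .
  qed
qed

end
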